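(* Let $\phi(w)=aw+b$ with $a>0$ and $\mathrm{Re}(b)\geq 0$, regarded as a self-map of the open right half-plane $\mathbb{C}_+$. Then the composition operator $C_\phi$ is cyclic on $H^2(\mathbb{C}_+)$ if and only if $\phi$ is a parabolic non-automorphism or a hyperbolic non-automorphism of type $\mathrm{II}$; that is, precisely when $a\geq 1$ and $\mathrm{Re}(b)>0$.
   Context: $\mathbb{C}_+=\{w\in\mathbb{C}:\mathrm{Re}(w)>0\}$. The Hardy space $H^2(\mathbb{C}_+)$ is the Hilbert space of analytic functions $f$ on $\mathbb{C}_+$ for which $\|f\|_2^2=\sup_{0<x<\infty}\int_{-\infty}^{\infty}|f(x+iy)|^2\,dy$ is finite. For a holomorphic self-map $\phi$ of $\mathbb{C}_+$, the composition operator is $C_\phi f=f\circ\phi$; for $\phi(w)=aw+b$ with $a>0$ and $\mathrm{Re}(b)\ge 0$ it is a bounded operator on $H^2(\mathbb{C}_+)$. For such $\phi$: $\phi$ is a parabolic non-automorphism if $a=1$ and $\mathrm{Re}(b)>0$; $\phi$ is a hyperbolic non-automorphism if $a\neq 1$ and $\mathrm{Re}(b)>0$, and it is then of type $\mathrm{I}$ if $a\in(0,1)$ and of type $\mathrm{II}$ if $a\in(1,\infty)$. An operator $T$ on a separable Hilbert space $\mathcal{H}$ is cyclic if there is $f\in\mathcal{H}$ such that the linear span of the orbit $\{T^nf:n\ge 0\}$ is dense in $\mathcal{H}$. *)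

theory Defs
  imports "HOL-Complex_Analysis.Complex_Analysis" "HOL-Library.Function_Algebras"
begin

definition right_half_plane :: "complex set" where
  "right_half_plane = {w. Re w > 0}"

definition hardy_norm_sq :: "(complex \<Rightarrow> complex) \<Rightarrow> ennreal" where
  "hardy_norm_sq f =
     (SUP x\<in>{0<..}. \<integral>\<^sup>+ y. ennreal ((cmod (f (Complex x y)))\<^sup>2) \<partial>lborel)"

definition hardy_norm :: "(complex \<Rightarrow> complex) \<Rightarrow> real" where
  "hardy_norm f = sqrt (enn2real (hardy_norm_sq f))"

text \<open>A function on the half-plane is represented by its extension by zero, so that
  each element of the space has exactly one representative.\<close>

definition hardy_space :: "(complex \<Rightarrow> complex) set" where
  "hardy_space = {f. f holomorphic_on right_half_plane \<and> (\<forall>w. w \<notin> right_half_plane \<longrightarrow> f w = 0)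
                     \<and> hardy_norm_sq f < \<infinity>}"

definition comp_op :: "(complex \<Rightarrow> complex) \<Rightarrow> (complex \<Rightarrow> complex) \<Rightarrow> (complex \<Rightarrow> complex)" where
  "comp_op \<phi> f = (\<lambda>w. if w \<in> right_half_plane then f (\<phi> w) else 0)"

definition fun_scale :: "complex \<Rightarrow> (complex \<Rightarrow> complex) \<Rightarrow> (complex \<Rightarrow> complex)" where
  "fun_scale c f = (\<lambda>w. c * f w)"

interpretation cfun: vector_space fun_scale
  by unfold_locales (auto simp: fun_scale_def fun_eq_iff algebra_simps)

definition orbit :: "('a \<Rightarrow> 'a) \<Rightarrow> 'a \<Rightarrow> 'a set" where
  "orbit T f = {(T ^^ n) f | n. True}"

definition cyclic_on_hardy :: "((complex \<Rightarrow> complex) \<Rightarrow> (complex \<Rightarrow> complex)) \<Rightarrow> bool" where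
  "cyclic_on_hardy T \<longleftrightarrow>
     (\<exists>f\<in>hardy_space. \<forall>g\<in>hardy_space. \<forall>\<epsilon>>0.
        \<exists>h\<in>cfun.span (orbit T f). hardy_norm (g - h) < \<epsilon>)"

definition parabolic_nonautomorphism :: "(complex \<Rightarrow> complex) \<Rightarrow> bool" where
  "parabolic_nonautomorphism \<phi> \<longleftrightarrow>
     (\<exists>b. Re b > 0 \<and> (\<forall>w\<in>right_half_plane. \<phi> w = w + b))"

definition hyperbolic_nonautomorphism_II :: "(complex \<Rightarrow> complex) \<Rightarrow> bool" where
  "hyperbolic_nonautomorphism_II \<phi> \<longleftrightarrow>
     (\<exists>(a::real) b. a > 1 \<and> Re b > 0 \<and> (\<forall>w\<in>right_half_plane. \<phi> w = of_real a * w + b))"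

text \<open>The value \<open>enn2real \<infinity> = 0\<close> plays no role in the notion of cyclicity for the
  operators considered: the space is a linear subspace invariant under them, so \<open>hardy_norm\<close> is
  only evaluated on its elements.\<close>

lemma hardy_norm_sq_add_le:
  assumes f: "f holomorphic_on right_half_plane" and g: "g holomorphic_on right_half_plane"
  shows "hardy_norm_sq (f + g) \<le> 2 * hardy_norm_sq f + 2 * hardy_norm_sq g"
  unfolding hardy_norm_sq_def
proof (rule SUP_least)
  fix x :: real assume x: "x \<in> {0<..}"
  have meas: "(\<lambda>y. cmod (h (Complex x y))) \<in> borel_measurable borel"
    if h: "h holomorphic_on right_half_plane" for h
  proof -
    have "continuous_on UNIV (\<lambda>y. h (Complex x y))"
      using x by (intro continuous_on_compose2[OF holomorphic_on_imp_continuous_on[OF h]])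
        (auto simp: right_half_plane_def Complex_eq intro!: continuous_intros)
    thus ?thesis
      by (intro borel_measurable_continuous_onI continuous_on_norm)
  qed
  let ?I = "\<lambda>h. \<integral>\<^sup>+ y. ennreal ((cmod (h (Complex x y)))\<^sup>2) \<partial>lborel"
  have le: "(cmod (u + v))\<^sup>2 \<le> 2 * (cmod u)\<^sup>2 + 2 * (cmod v)\<^sup>2" for u v :: complex
  proof -
    have "(cmod (u + v))\<^sup>2 \<le> (cmod u + cmod v)\<^sup>2"
      by (intro power_mono norm_triangle_ineq) auto
    also have "\<dots> \<le> 2 * (cmod u)\<^sup>2 + 2 * (cmod v)\<^sup>2"
      using zero_le_power2[of "cmod u - cmod v"]
      by (simp add: power2_eq_square algebra_simps)
    finally show ?thesis .
  qed
  have "?I (f + g) \<le> (\<integral>\<^sup>+ y. 2 * ennreal ((cmod (f (Complex x y)))\<^sup>2)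
                         + 2 * ennreal ((cmod (g (Complex x y)))\<^sup>2) \<partial>lborel)"
  proof (rule nn_integral_mono)
    fix y
    have "ennreal ((cmod ((f + g) (Complex x y)))\<^sup>2)
          \<le> ennreal (2 * (cmod (f (Complex x y)))\<^sup>2 + 2 * (cmod (g (Complex x y)))\<^sup>2)"
      using le by (intro ennreal_leI) simp
    also have "\<dots> = 2 * ennreal ((cmod (f (Complex x y)))\<^sup>2)
                         + 2 * ennreal ((cmod (g (Complex x y)))\<^sup>2)"
      by (simp add: ennreal_plus ennreal_mult)
    finally show "ennreal ((cmod ((f + g) (Complex x y)))\<^sup>2) \<le> \<dots>" .
  qed
  also have "\<dots> = 2 * ?I f + 2 * ?I g"
    using meas[OF f] meas[OF g] by (simp add: nn_integral_add nn_integral_cmult)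
  also have "\<dots> \<le> 2 * (SUP x\<in>{0<..}. \<integral>\<^sup>+ y. ennreal ((cmod (f (Complex x y)))\<^sup>2) \<partial>lborel)
               + 2 * (SUP x\<in>{0<..}. \<integral>\<^sup>+ y. ennreal ((cmod (g (Complex x y)))\<^sup>2) \<partial>lborel)"
    using x by (intro add_mono mult_left_mono SUP_upper) auto
  finally show "?I (f + g) \<le> \<dots>" .
qed

lemma hardy_norm_sq_scale:
  assumes f: "f holomorphic_on right_half_plane"
  shows "hardy_norm_sq (fun_scale c f) \<le> ennreal ((cmod c)\<^sup>2) * hardy_norm_sq f"
  unfolding hardy_norm_sq_def
proof (rule SUP_least)
  fix x :: real assume x: "x \<in> {0<..}"
  have "continuous_on UNIV (\<lambda>y. f (Complex x y))"
    using x by (intro continuous_on_compose2[OF holomorphic_on_imp_continuous_on[OF f]])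
      (auto simp: right_half_plane_def Complex_eq intro!: continuous_intros)
  hence meas: "(\<lambda>y. cmod (f (Complex x y))) \<in> borel_measurable borel"
    by (intro borel_measurable_continuous_onI continuous_on_norm)
  have "(\<integral>\<^sup>+ y. ennreal ((cmod (fun_scale c f (Complex x y)))\<^sup>2) \<partial>lborel)
      = ennreal ((cmod c)\<^sup>2) * (\<integral>\<^sup>+ y. ennreal ((cmod (f (Complex x y)))\<^sup>2) \<partial>lborel)"
    using meas
    by (simp add: fun_scale_def norm_mult power_mult_distrib ennreal_mult nn_integral_cmult)
  also have "\<dots> \<le> ennreal ((cmod c)\<^sup>2) *
      (SUP x\<in>{0<..}. \<integral>\<^sup>+ y. ennreal ((cmod (f (Complex x y)))\<^sup>2) \<partial>lborel)"
    using x by (intro mult_left_mono SUP_upper) auto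
  finally show "(\<integral>\<^sup>+ y. ennreal ((cmod (fun_scale c f (Complex x y)))\<^sup>2) \<partial>lborel) \<le> \<dots>" .
qed

lemma subspace_hardy_space: "cfun.subspace hardy_space"
proof (rule cfun.subspaceI)
  show "0 \<in> hardy_space"
    by (simp add: hardy_space_def hardy_norm_sq_def zero_fun_def)
next
  fix f g assume fg: "f \<in> hardy_space" "g \<in> hardy_space"
  have "hardy_norm_sq (f + g) \<le> 2 * hardy_norm_sq f + 2 * hardy_norm_sq g"
    using fg by (intro hardy_norm_sq_add_le) (auto simp: hardy_space_def)
  also have "\<dots> < \<infinity>"
    using fg by (auto simp: hardy_space_def ennreal_mult_less_top)
  finally show "f + g \<in> hardy_space"
    using fg by (auto simp: hardy_space_def plus_fun_def intro!: holomorphic_intros)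
next
  fix c f assume f: "f \<in> hardy_space"
  have "hardy_norm_sq (fun_scale c f) \<le> ennreal ((cmod c)\<^sup>2) * hardy_norm_sq f"
    using f by (intro hardy_norm_sq_scale) (auto simp: hardy_space_def)
  also have "\<dots> < \<infinity>"
    using f by (auto simp: hardy_space_def ennreal_mult_less_top)
  finally show "fun_scale c f \<in> hardy_space"
    using f by (auto simp: hardy_space_def fun_scale_def intro!: holomorphic_intros)
qed

lemma comp_op_hardy_space:
  assumes a: "a > 0" and b: "Re b \<ge> 0" and f: "f \<in> hardy_space"
  shows "comp_op (\<lambda>w. of_real a * w + b) f \<in> hardy_space"
proof -
  let ?\<phi> = "\<lambda>w. of_real a * w + b"
  have hol: "f holomorphic_on right_half_plane" and fin: "hardy_norm_sq f < \<infinity>"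
    using f by (auto simp: hardy_space_def)
  have sub: "?\<phi> ` right_half_plane \<subseteq> right_half_plane"
    using a b by (auto simp: right_half_plane_def intro!: add_pos_nonneg)
  have "(f \<circ> ?\<phi>) holomorphic_on right_half_plane"
    by (rule holomorphic_on_compose_gen[OF _ hol sub]) (intro holomorphic_intros)
  hence hol': "comp_op ?\<phi> f holomorphic_on right_half_plane"
    by (rule holomorphic_transform) (simp add: comp_op_def)
  have "hardy_norm_sq (comp_op ?\<phi> f) \<le> ennreal (1 / a) * hardy_norm_sq f"
    unfolding hardy_norm_sq_def
  proof (rule SUP_least)
    fix x :: real assume x: "x \<in> {0<..}"
    define x' where "x' = a * x + Re b"
    have x': "x' > 0" using x a b by (auto simp: x'_def intro!: add_pos_nonneg)
    have "continuous_on UNIV (\<lambda>y. f (Complex x' y))"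
      using x' by (intro continuous_on_compose2[OF holomorphic_on_imp_continuous_on[OF hol]])
        (auto simp: right_half_plane_def Complex_eq intro!: continuous_intros)
    hence meas: "(\<lambda>y. cmod (f (Complex x' y))) \<in> borel_measurable borel"
      by (intro borel_measurable_continuous_onI continuous_on_norm)
    have pt: "comp_op ?\<phi> f (Complex x y) = f (Complex x' (Im b + a * y))" for y
    proof -
      have "of_real a * Complex x y + b = Complex x' (Im b + a * y)"
        by (simp add: complex_eq_iff x'_def)
      thus ?thesis using x by (simp add: comp_op_def right_half_plane_def)
    qed
    have "(\<integral>\<^sup>+ y. ennreal ((cmod (f (Complex x' y)))\<^sup>2) \<partial>lborel) =
       ennreal \<bar>a\<bar> * (\<integral>\<^sup>+ y. ennreal ((cmod (f (Complex x' (Im b + a * y))))\<^sup>2) \<partial>lborel)"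
      using meas a by (intro nn_integral_real_affine) auto
    hence "(\<integral>\<^sup>+ y. ennreal ((cmod (comp_op ?\<phi> f (Complex x y)))\<^sup>2) \<partial>lborel) =
       ennreal (1 / a) * (\<integral>\<^sup>+ y. ennreal ((cmod (f (Complex x' y)))\<^sup>2) \<partial>lborel)"
      using a by (simp add: pt mult.assoc[symmetric] ennreal_mult[symmetric])
    also have "\<dots> \<le> ennreal (1 / a) *
        (SUP x\<in>{0<..}. \<integral>\<^sup>+ y. ennreal ((cmod (f (Complex x y)))\<^sup>2) \<partial>lborel)"
      using x' by (intro mult_left_mono SUP_upper) auto
    finally show "(\<integral>\<^sup>+ y. ennreal ((cmod (comp_op ?\<phi> f (Complex x y)))\<^sup>2) \<partial>lborel) \<le> \<dots>" .
  qed
  also have "\<dots> < \<infinity>"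
    using fin by (auto simp: ennreal_mult_less_top)
  finally show ?thesis
    using hol' by (auto simp: hardy_space_def comp_op_def)
qed

end

theory Submission
  imports Defs "HOL-Probability.Sinc_Integral"
begin

text \<open>
  Three kinds of explicit objects on \<open>H\<^sup>2\<close> decide cyclicity: the reproducing kernels
  \<open>k\<^sub>l(z) = 1 / (z + cnj l)\<close>, eigenfunctionals of the composition operator, and multipliers that
  commute with it. The symbol is \<open>\<phi>(w) = a w + b\<close> throughout.

  \<^bold>\<open>The tool.\<close> Cauchy's formula on a vertical line (\<open>hardy_cauchy_formula\<close>) says that evaluation of
  \<open>f \<in> H\<^sup>2\<close> at \<open>x + l\<close> is, up to the factor \<open>2 \<pi>\<close>, the \<open>L\<^sup>2\<close> inner product of \<open>f\<close> on the line
  \<open>Re z = x\<close> with \<open>k\<^sub>l\<close> on the imaginary axis. Linear combinations of kernels are regular across the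
  imaginary axis, and their \<open>L\<^sup>2\<close> norm on any line \<open>Re z = x \<ge> 0\<close> is at most the one on that axis
  (\<open>normsq_ksum_le\<close>). This avoids boundary values of general functions, and it makes orthogonal
  projection onto a finite span of kernels the same as interpolation.

  \<^bold>\<open>Cyclic cases.\<close> For \<open>a \<ge> 1\<close> and \<open>Re b > 0\<close> the operator maps \<open>k\<^sub>l\<close> to a multiple of the kernel at
  \<open>(l + cnj b) / a\<close>, so it suffices that the kernels at the points of one orbit of this map span a
  dense subspace. If \<open>a > 1\<close> the points converge to \<open>cnj b / (a - 1)\<close>, which lies in the half-plane,
  and density follows from the identity theorem (\<open>kernels_dense\<close>). If \<open>a = 1\<close> the points are
  \<open>cnj b, 2 cnj b, 3 cnj b, \<dots>\<close>; their Blaschke products tend to \<open>0\<close>, and by an exact partial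
  fraction identity this puts every kernel into the closed span (\<open>hkernel_in_hclosure\<close>).

  \<^bold>\<open>Type I.\<close> If \<open>a < 1\<close> and \<open>Re b > 0\<close>, the fixed point \<open>p = b / (1 - a)\<close> is interior, and for
  \<open>0 < Re \<nu> < 1/2\<close> the functional \<open>f \<mapsto> \<integral> f(p + u) u\<^bsup>\<nu>-1\<^esup> du\<close> over \<open>u > 0\<close> is bounded and is an
  eigenvector of the transposed operator, with eigenvalue \<open>a\<^bsup>-\<nu>\<^esup>\<close>. Adding \<open>2 \<pi> \<i> / ln a\<close> to \<open>\<nu>\<close> keeps
  the eigenvalue, so some eigenvalue has multiplicity at least two. For any \<open>f\<close> a nonzero
  combination of two eigenfunctionals kills \<open>f\<close>, hence its whole orbit.

  \<^bold>\<open>Automorphisms.\<close> If \<open>Re b = 0\<close>, restrict functions to the line \<open>Re z = 1\<close> (if \<open>a = 1\<close>) or to the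
  horizontal ray issuing from the boundary fixed point (if \<open>a \<noteq> 1\<close>). In a suitable parameter the
  operator becomes a translation of \<open>L\<^sup>2(\<real>)\<close> up to a scalar. It commutes with all other translations
  and with multiplication by an oscillating factor of the same period, but these two do not commute
  with each other. The commutant of a normal operator with a cyclic vector is abelian, and the
  argument for that, applied to the restrictions, excludes cyclicity (\<open>not_cyclic_if_translation\<close>).
\<close>

section \<open>Square-integrable functions on the real line\<close>

definition L2 :: "(real \<Rightarrow> complex) set" where
  "L2 = {h. h \<in> borel_measurable borel \<and> integrable lborel (\<lambda>t. (cmod (h t))\<^sup>2)}"

definition inner2 :: "(real \<Rightarrow> complex) \<Rightarrow> (real \<Rightarrow> complex) \<Rightarrow> complex" where
  "inner2 g h = (\<integral>t. g t * cnj (h t) \<partial>lborel)"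

definition normsq :: "(real \<Rightarrow> complex) \<Rightarrow> real" where
  "normsq h = (\<integral>t. (cmod (h t))\<^sup>2 \<partial>lborel)"

lemma L2_D [measurable_dest]: "h \<in> L2 \<Longrightarrow> h \<in> borel_measurable borel"
  and L2_integrable: "h \<in> L2 \<Longrightarrow> integrable lborel (\<lambda>t. (cmod (h t))\<^sup>2)"
  by (auto simp: L2_def)

lemma borel_measurable_cnj [measurable (raw)]:
  "f \<in> borel_measurable M \<Longrightarrow> (\<lambda>x. cnj (f x)) \<in> borel_measurable M"
  by (rule measurable_compose[OF _ borel_measurable_continuous_onI]) (auto intro!: continuous_intros)

lemma normsq_nonneg: "0 \<le> normsq h"
  by (simp add: normsq_def)

lemma nn_integral_normsq:
  assumes "h \<in> L2"
  shows "(\<integral>\<^sup>+ t. ennreal ((cmod (h t))\<^sup>2) \<partial>lborel) = ennreal (normsq h)"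
  unfolding normsq_def by (rule nn_integral_eq_integral) (use L2_integrable[OF assms] in auto)

lemma L2I_nn:
  assumes "h \<in> borel_measurable borel"
    and "(\<integral>\<^sup>+ t. ennreal ((cmod (h t))\<^sup>2) \<partial>lborel) \<le> ennreal C" "0 \<le> C"
  shows "h \<in> L2" "normsq h \<le> C"
proof -
  show L: "h \<in> L2"
    unfolding L2_def using assms
    by (auto simp: integrable_iff_bounded intro: le_less_trans)
  show "normsq h \<le> C"
    using nn_integral_normsq[OF L] assms by (simp add: normsq_nonneg)
qed

lemma L2_mult_integrable:
  assumes [measurable]: "g \<in> L2" "h \<in> L2"
  shows "integrable lborel (\<lambda>t. g t * cnj (h t))"
proof (rule Bochner_Integration.integrable_bound)
  show "integrable lborel (\<lambda>t. (cmod (g t))\<^sup>2 + (cmod (h t))\<^sup>2)"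
    using assms by (intro Bochner_Integration.integrable_add L2_integrable)
  show "(\<lambda>t. g t * cnj (h t)) \<in> borel_measurable lborel"
    by measurable
  have "cmod (g t) * cmod (h t) \<le> (cmod (g t))\<^sup>2 + (cmod (h t))\<^sup>2" for t
    using sum_squares_bound[of "cmod (g t)" "cmod (h t)"]
      mult_nonneg_nonneg[OF norm_ge_zero[of "g t"] norm_ge_zero[of "h t"]] by linarith
  thus "AE t in lborel. norm (g t * cnj (h t)) \<le> norm ((cmod (g t))\<^sup>2 + (cmod (h t))\<^sup>2)"
    by (intro AE_I2) (simp add: norm_mult)
qed

lemma L2_dominated:
  assumes "h \<in> L2" "g \<in> borel_measurable borel" "\<And>t. cmod (g t) \<le> cmod (h t)"
  shows "g \<in> L2"
proof -
  note [measurable] = assms(2)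
  have "integrable lborel (\<lambda>t. (cmod (g t))\<^sup>2)"
    by (rule Bochner_Integration.integrable_bound[OF L2_integrable[OF assms(1)]])
       (auto intro!: AE_I2 power_mono assms)
  thus ?thesis using assms by (simp add: L2_def)
qed

lemma normsq_mono:
  assumes "h \<in> L2" "g \<in> L2" "\<And>t. cmod (g t) \<le> cmod (h t)"
  shows "normsq g \<le> normsq h"
  unfolding normsq_def using assms
  by (intro integral_mono L2_integrable power_mono) auto

lemma L2_zero [simp]: "(\<lambda>_. 0) \<in> L2"
  by (simp add: L2_def)

lemma L2_scale: 
  assumes "g \<in> L2" shows "(\<lambda>t. c * g t) \<in> L2"
proof -
  note [measurable] = assms
  show ?thesis using L2_integrable[OF assms] by (simp add: L2_def norm_mult power_mult_distrib)
qed

lemma L2_add: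
  assumes "g \<in> L2" "h \<in> L2" shows "(\<lambda>t. g t + h t) \<in> L2"
proof -
  note [measurable] = assms
  have "integrable lborel (\<lambda>t. (cmod (g t + h t))\<^sup>2)"
  proof (rule Bochner_Integration.integrable_bound)
    show "integrable lborel (\<lambda>t. 2 * (cmod (g t))\<^sup>2 + 2 * (cmod (h t))\<^sup>2)"
      using assms by (intro Bochner_Integration.integrable_add integrable_mult_right L2_integrable)
    have "(cmod (g t + h t))\<^sup>2 \<le> 2 * (cmod (g t))\<^sup>2 + 2 * (cmod (h t))\<^sup>2" for t
    proof -
      have "(cmod (g t + h t))\<^sup>2 \<le> (cmod (g t) + cmod (h t))\<^sup>2"
        by (intro power_mono norm_triangle_ineq) auto
      also have "\<dots> \<le> 2 * (cmod (g t))\<^sup>2 + 2 * (cmod (h t))\<^sup>2"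
        using zero_le_power2[of "cmod (g t) - cmod (h t)"]
        by (simp add: power2_eq_square algebra_simps)
      finally show ?thesis .
    qed
    thus "AE t in lborel. norm ((cmod (g t + h t))\<^sup>2) \<le> norm (2 * (cmod (g t))\<^sup>2 + 2 * (cmod (h t))\<^sup>2)"
      by (intro AE_I2) simp
  qed simp
  thus ?thesis by (simp add: L2_def)
qed

lemma L2_diff: "g \<in> L2 \<Longrightarrow> h \<in> L2 \<Longrightarrow> (\<lambda>t. g t - h t) \<in> L2"
  using L2_add[of g "\<lambda>t. (-1) * h t"] L2_scale[of h "-1"] by simp

lemma L2_sum:
  fixes c :: "'i \<Rightarrow> complex"
  shows "(\<And>j. j \<in> J \<Longrightarrow> g j \<in> L2) \<Longrightarrow> (\<lambda>t. \<Sum>j\<in>J. c j * g j t) \<in> L2"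
  by (induction J rule: infinite_finite_induct) (auto intro!: L2_add L2_scale)

lemma inner2_sum_left:
  fixes c :: "'i \<Rightarrow> complex"
  assumes "\<And>j. j \<in> J \<Longrightarrow> g j \<in> L2" "h \<in> L2"
  shows "inner2 (\<lambda>t. \<Sum>j\<in>J. c j * g j t) h = (\<Sum>j\<in>J. c j * inner2 (g j) h)"
proof -
  have "inner2 (\<lambda>t. \<Sum>j\<in>J. c j * g j t) h = (\<integral>t. (\<Sum>j\<in>J. c j * (g j t * cnj (h t))) \<partial>lborel)"
    by (simp add: inner2_def sum_distrib_right mult.assoc)
  also have "\<dots> = (\<Sum>j\<in>J. c j * inner2 (g j) h)"
    using assms unfolding inner2_def
    by (subst Bochner_Integration.integral_sum) (auto intro!: integrable_mult_right L2_mult_integrable)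
  finally show ?thesis .
qed

lemma inner2_cnj: "cnj (inner2 g h) = inner2 h g"
  unfolding inner2_def by (simp add: mult.commute flip: Bochner_Integration.integral_cnj)

lemma inner2_sum_right:
  fixes c :: "'i \<Rightarrow> complex"
  assumes "\<And>j. j \<in> J \<Longrightarrow> g j \<in> L2" "h \<in> L2"
  shows "inner2 h (\<lambda>t. \<Sum>j\<in>J. c j * g j t) = (\<Sum>j\<in>J. cnj (c j) * inner2 h (g j))"
  using arg_cong[OF inner2_sum_left[OF assms, where c = c], where f = cnj] by (simp add: inner2_cnj)

lemma inner2_self: "inner2 h h = of_real (normsq h)"
proof -
  have "inner2 h h = (\<integral>t. of_real ((cmod (h t))\<^sup>2) \<partial>lborel)"
    unfolding inner2_def complex_norm_square ..
  thus ?thesis unfolding normsq_def by (simp only: integral_complex_of_real)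
qed

lemma inner2_diff_left:
  assumes "f \<in> L2" "g \<in> L2" "h \<in> L2"
  shows "inner2 (\<lambda>t. f t - g t) h = inner2 f h - inner2 g h"
  unfolding inner2_def left_diff_distrib
  using assms by (intro Bochner_Integration.integral_diff L2_mult_integrable)

lemma inner2_diff_right:
  assumes "f \<in> L2" "g \<in> L2" "h \<in> L2"
  shows "inner2 h (\<lambda>t. f t - g t) = inner2 h f - inner2 h g"
  using arg_cong[OF inner2_diff_left[OF assms], of cnj] by (simp add: inner2_cnj)

lemma inner2_scale_left: "inner2 (\<lambda>t. c * g t) h = c * inner2 g h"
  by (simp add: inner2_def mult.assoc)

lemma inner2_Cauchy_Schwarz:
  assumes "g \<in> L2" "h \<in> L2"
  shows "(cmod (inner2 g h))\<^sup>2 \<le> normsq g * normsq h"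
proof -
  let ?c = "cmod (inner2 g h)"
  note [measurable] = assms
  have *: "2 * ?c \<le> r * normsq g + normsq h / r" if r: "r > 0" for r
  proof -
    have "?c \<le> (\<integral>t. cmod (g t * cnj (h t)) \<partial>lborel)"
      unfolding inner2_def by (rule integral_norm_bound)
    also have "\<dots> \<le> (\<integral>t. (r/2) * (cmod (g t))\<^sup>2 + (1/(2*r)) * (cmod (h t))\<^sup>2 \<partial>lborel)"
    proof (rule integral_mono)
      show "integrable lborel (\<lambda>t. cmod (g t * cnj (h t)))"
        using L2_mult_integrable[OF assms] by (rule integrable_norm)
      show "integrable lborel (\<lambda>t. (r/2) * (cmod (g t))\<^sup>2 + (1/(2*r)) * (cmod (h t))\<^sup>2)"
        using assms by (intro Bochner_Integration.integrable_add integrable_mult_right L2_integrable)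
      show "cmod (g t * cnj (h t)) \<le> (r/2) * (cmod (g t))\<^sup>2 + (1/(2*r)) * (cmod (h t))\<^sup>2" for t
      proof -
        have "0 \<le> (r * cmod (g t) - cmod (h t))\<^sup>2 / (2*r)" using r by simp
        also have "\<dots> = (r/2) * (cmod (g t))\<^sup>2 + (1/(2*r)) * (cmod (h t))\<^sup>2 - cmod (g t) * cmod (h t)"
          using r by (simp add: power2_eq_square field_simps)
        finally show ?thesis by (simp add: norm_mult)
      qed
    qed
    also have "\<dots> = (r/2) * normsq g + (1/(2*r)) * normsq h"
      unfolding normsq_def using assms by (subst Bochner_Integration.integral_add) (auto intro!: L2_integrable)
    finally show ?thesis using r by (simp add: field_simps)
  qed
  have "?c * ?c \<le> normsq g * normsq h"
  proof (cases "normsq g = 0 \<or> ?c = 0")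
    case True
    have "?c = 0"
    proof (rule ccontr)
      assume c: "?c \<noteq> 0"
      hence g0: "normsq g = 0" using True by simp
      have "2 * ?c \<le> normsq h / ((normsq h + 1) / ?c)"
        using *[of "(normsq h + 1) / ?c"] c normsq_nonneg[of h] g0 by simp
      also have "\<dots> = ?c * (normsq h / (normsq h + 1))" by simp
      also have "\<dots> \<le> ?c * 1" using normsq_nonneg[of h]
        by (intro mult_left_mono) (auto simp: field_simps)
      finally show False using c by simp
    qed
    thus ?thesis using normsq_nonneg[of g] normsq_nonneg[of h] by simp
  next
    case False
    hence g: "normsq g > 0" and c: "?c > 0" using normsq_nonneg[of g] by (auto simp: less_le)
    have "2 * ?c \<le> ?c + normsq h * normsq g / ?c"
      using *[of "?c / normsq g"] g c by simp
    thus ?thesis using c by (simp add: field_simps)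
  qed
  thus ?thesis by (simp add: power2_eq_square)
qed

lemma normsq_diff:
  assumes "g \<in> L2" "h \<in> L2"
  shows "normsq (\<lambda>t. g t - h t) = normsq g + normsq h - 2 * Re (inner2 g h)"
proof -
  have "complex_of_real (normsq (\<lambda>t. g t - h t)) = inner2 (\<lambda>t. g t - h t) (\<lambda>t. g t - h t)"
    by (simp add: inner2_self)
  also have "\<dots> = inner2 g g - inner2 g h - (inner2 h g - inner2 h h)"
    using assms L2_diff[OF assms] by (simp add: inner2_diff_left inner2_diff_right)
  also have "Re \<dots> = normsq g + normsq h - 2 * Re (inner2 g h)"
    unfolding inner2_cnj[of g h, symmetric] by (simp add: inner2_self)
  finally show ?thesis by simp
qed

lemma L2_translate:
  assumes "h \<in> L2" shows "(\<lambda>t. h (t + s)) \<in> L2"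
proof -
  have "(\<lambda>t. h (t + s)) \<in> borel_measurable borel"
    by (rule measurable_compose[OF _ L2_D[OF assms]]) simp
  thus ?thesis using lborel_integrable_real_affine[OF L2_integrable[OF assms], of 1 s]
    by (simp add: L2_def add.commute)
qed

lemma lborel_integral_translate:
  fixes F :: "real \<Rightarrow> 'a :: {banach, second_countable_topology}"
  shows "(\<integral>t. F (t + s) \<partial>lborel) = (\<integral>t. F t \<partial>lborel)"
  using lborel_integral_real_affine[of 1 F s] by (simp add: add.commute)

lemma inner2_translate: "inner2 (\<lambda>t. g (t + s)) (\<lambda>t. h (t + s)) = inner2 g h"
  unfolding inner2_def by (rule lborel_integral_translate[of "\<lambda>t. g t * cnj (h t)"])

lemma normsq_translate: "normsq (\<lambda>t. h (t + s)) = normsq h"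
  unfolding normsq_def by (rule lborel_integral_translate[of "\<lambda>t. (cmod (h t))\<^sup>2"])

lemma normsq_eq_0_imp_zero:
  assumes "continuous_on UNIV h" "h \<in> L2" "normsq h = 0"
  shows "h t = 0"
proof (rule ccontr)
  assume "h t \<noteq> 0"
  have "open {t. h t \<noteq> 0}"
    using assms(1) by (intro open_Collect_neq) auto
  hence "\<not> negligible {t. h t \<noteq> 0}" using open_not_negligible \<open>h t \<noteq> 0\<close> by blast
  moreover have "AE t in lborel. (cmod (h t))\<^sup>2 = 0"
    using assms integral_nonneg_eq_0_iff_AE[OF L2_integrable[OF assms(2)]] by (simp add: normsq_def)
  hence "AE t in lborel. t \<notin> {t. h t \<noteq> 0}" by simp
  hence "{t. h t \<noteq> 0} \<in> null_sets lborel"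
    using \<open>open _\<close> by (subst AE_iff_null_sets) auto
  hence "negligible {t. h t \<noteq> 0}"
    by (simp add: negligible_iff_null_sets null_sets_completionI)
  ultimately show False by blast
qed

section \<open>Lines and rectangles in the half-plane\<close>

definition line :: "(complex \<Rightarrow> complex) \<Rightarrow> real \<Rightarrow> real \<Rightarrow> complex" where
  "line f x = (\<lambda>y. f (Complex x y))"

lemma open_right_half_plane: "open right_half_plane"
  unfolding right_half_plane_def by (rule open_halfspace_Re_gt)

lemma continuous_on_Complex [continuous_intros]:
  "continuous_on S u \<Longrightarrow> continuous_on S v \<Longrightarrow> continuous_on S (\<lambda>t. Complex (u t) (v t))"
  by (simp add: Complex_eq continuous_intros)

lemma continuous_on_line:
  assumes "continuous_on right_half_plane f" "x > 0"
  shows "continuous_on UNIV (line f x)"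
  unfolding line_def using assms
  by (intro continuous_on_compose2[OF assms(1)] continuous_intros) (auto simp: right_half_plane_def)

lemma hardy_space_D:
  assumes "f \<in> hardy_space"
  shows "f holomorphic_on right_half_plane" "\<And>w. w \<notin> right_half_plane \<Longrightarrow> f w = 0"
    "continuous_on right_half_plane f"
    "hardy_norm_sq f = ennreal ((hardy_norm f)\<^sup>2)"
  using assms by (auto simp: hardy_space_def hardy_norm_def less_top intro: holomorphic_on_imp_continuous_on)

lemma hardy_line:
  assumes f: "f \<in> hardy_space" and x: "x > 0"
  shows "line f x \<in> L2" "normsq (line f x) \<le> (hardy_norm f)\<^sup>2"
proof -
  have meas: "line f x \<in> borel_measurable borel"
    using hardy_space_D(3)[OF f] x by (intro borel_measurable_continuous_onI continuous_on_line)
  have le: "(\<integral>\<^sup>+ y. ennreal ((cmod (line f x y))\<^sup>2) \<partial>lborel) \<le> hardy_norm_sq f"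
    unfolding hardy_norm_sq_def line_def using x by (intro SUP_upper) auto
  show "line f x \<in> L2" "normsq (line f x) \<le> (hardy_norm f)\<^sup>2"
    using L2I_nn[OF meas le[unfolded hardy_space_D(4)[OF f]] zero_le_power2] by blast+
qed

lemma hardy_spaceI:
  assumes "f holomorphic_on right_half_plane" "\<And>w. w \<notin> right_half_plane \<Longrightarrow> f w = 0"
    and "\<And>x. x > 0 \<Longrightarrow> line f x \<in> L2" "\<And>x. x > 0 \<Longrightarrow> normsq (line f x) \<le> C\<^sup>2" "C \<ge> 0"
  shows "f \<in> hardy_space" "hardy_norm f \<le> C"
proof -
  have le: "hardy_norm_sq f \<le> ennreal (C\<^sup>2)"
    unfolding hardy_norm_sq_def
  proof (rule SUP_least)
    fix x :: real assume "x \<in> {0<..}"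
    hence "(\<integral>\<^sup>+ y. ennreal ((cmod (line f x y))\<^sup>2) \<partial>lborel) \<le> ennreal (C\<^sup>2)"
      using assms(3,4)[of x] by (subst nn_integral_normsq) (auto intro: ennreal_leI)
    thus "(\<integral>\<^sup>+ y. ennreal ((cmod (f (Complex x y)))\<^sup>2) \<partial>lborel) \<le> ennreal (C\<^sup>2)"
      by (simp add: line_def)
  qed
  hence fin: "hardy_norm_sq f < \<infinity>" by (auto simp: less_top[symmetric] top_unique)
  thus *: "f \<in> hardy_space" using assms(1,2) by (auto simp: hardy_space_def)
  have "(hardy_norm f)\<^sup>2 \<le> C\<^sup>2"
    using le hardy_space_D(4)[OF *] by simp
  thus "hardy_norm f \<le> C" using \<open>C \<ge> 0\<close> by (rule power2_le_imp_le)
qed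

lemma hardy_norm_nonneg: "0 \<le> hardy_norm f"
  by (simp add: hardy_norm_def)

lemma integral_eq_lborel:
  fixes h :: "real \<Rightarrow> complex"
  assumes "continuous_on {a..b} h"
  shows "integrable lborel (\<lambda>t. indicator {a..b} t *\<^sub>R h t)"
    "integral {a..b} h = (\<integral>t. indicator {a..b} t *\<^sub>R h t \<partial>lborel)"
proof -
  show *: "integrable lborel (\<lambda>t. indicator {a..b} t *\<^sub>R h t)"
    using borel_integrable_compact[OF _ assms] by (simp add: scaleR_conv_of_real)
  thus "integral {a..b} h = (\<integral>t. indicator {a..b} t *\<^sub>R h t \<partial>lborel)"
    using set_borel_integral_eq_integral(2)[of "{a..b}" h]
    by (simp add: set_integrable_def set_lebesgue_integral_def)
qed

lemma norm_integral_le_nn: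
  fixes h :: "real \<Rightarrow> complex"
  assumes "continuous_on {a..b} h"
  shows "ennreal (cmod (integral {a..b} h)) \<le> (\<integral>\<^sup>+t. indicator {a..b} t * ennreal (cmod (h t)) \<partial>lborel)"
proof -
  have "ennreal (cmod (integral {a..b} h)) \<le>
      (\<integral>\<^sup>+t. ennreal (norm (indicator {a..b} t *\<^sub>R h t)) \<partial>lborel)"
    unfolding integral_eq_lborel(2)[OF assms]
    by (rule integral_norm_bound_ennreal[OF integral_eq_lborel(1)[OF assms]])
  also have "\<dots> = (\<integral>\<^sup>+t. indicator {a..b} t * ennreal (cmod (h t)) \<partial>lborel)"
    by (intro nn_integral_cong) (auto simp: indicator_def)
  finally show ?thesis .
qed

lemma contour_integral_linepath_same_Im:
  assumes "a < b"
  shows "contour_integral (linepath (Complex a y) (Complex b y)) f = integral {a..b} (\<lambda>s. f (Complex s y))"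
proof -
  have "contour_integral (linepath (Complex a y) (Complex b y)) f
      = of_real (b - a) * integral {0..1} (\<lambda>t. f (Complex (a + (b - a) * t) y))"
  proof -
    have lp: "linepath (Complex a y) (Complex b y) t = Complex (a + (b - a) * t) y" for t
      by (simp add: linepath_def complex_eq_iff algebra_simps)
    have "contour_integral (linepath (Complex a y) (Complex b y)) f
        = (Complex b y - Complex a y) * integral {0..1} (\<lambda>t. f (linepath (Complex a y) (Complex b y) t))"
      by (simp add: contour_integral_integral)
    moreover have "Complex b y - Complex a y = of_real (b - a)" by (simp add: complex_eq_iff)
    moreover have "(\<lambda>t. f (linepath (Complex a y) (Complex b y) t)) = (\<lambda>t. f (Complex (a + (b - a) * t) y))"
      by (simp only: lp)
    ultimately show ?thesis by (simp only:)
  qed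
  also have "integral {0..1} (\<lambda>t. f (Complex (a + (b - a) * t) y))
      = integral ((\<lambda>t. t / (b - a)) ` {0..b - a}) (\<lambda>t. f (Complex (a + (b - a) * t) y))"
    using assms by simp
  also have "\<dots> = integral {a-a..b-a} (\<lambda>t. f (Complex (t + a) y)) / of_real (b - a)"
    using assms by (subst integral_stretch_real) (auto simp: scaleR_conv_of_real add_ac)
  also have "\<dots> = integral {a..b} (\<lambda>s. f (Complex s y)) / of_real (b - a)"
    by (subst integral_shift_real_ivl) (rule refl)
  finally show ?thesis using assms by simp
qed

lemma contour_integral_rectpath:
  fixes x X u v :: real
  assumes "x < X" "u < v" and cont: "continuous_on (path_image (rectpath (Complex x u) (Complex X v))) G"
  shows "contour_integral (rectpath (Complex x u) (Complex X v)) G =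
    integral {x..X} (\<lambda>s. G (Complex s u)) + \<i> * integral {u..v} (\<lambda>y. G (Complex X y))
    - integral {x..X} (\<lambda>s. G (Complex s v)) - \<i> * integral {u..v} (\<lambda>y. G (Complex x y))"
proof -
  let ?a = "Complex x u" and ?b = "Complex X u" and ?c = "Complex X v" and ?d = "Complex x v"
  have pi: "path_image (rectpath ?a ?c) = closed_segment ?a ?b \<union> closed_segment ?b ?c \<union>
      closed_segment ?c ?d \<union> closed_segment ?d ?a"
    by (auto simp: rectpath_def Let_def path_image_join)
  have c: "G contour_integrable_on linepath ?a ?b" "G contour_integrable_on linepath ?b ?c"
    "G contour_integrable_on linepath ?c ?d" "G contour_integrable_on linepath ?d ?a"
    using cont by (auto intro!: contour_integrable_continuous_linepath elim!: continuous_on_subset simp: pi)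
  have "contour_integral (rectpath ?a ?c) G = contour_integral (linepath ?a ?b) G
      + contour_integral (linepath ?b ?c) G + contour_integral (linepath ?c ?d) G + contour_integral (linepath ?d ?a) G"
    using c by (simp add: rectpath_def Let_def contour_integrable_joinI valid_path_join)
  also have "contour_integral (linepath ?c ?d) G = - contour_integral (linepath ?d ?c) G"
    by (rule contour_integral_reverse_linepath) (use cont in \<open>auto elim!: continuous_on_subset simp: pi\<close>)
  also have "contour_integral (linepath ?d ?a) G = - contour_integral (linepath ?a ?d) G"
    by (rule contour_integral_reverse_linepath) (use cont in \<open>auto elim!: continuous_on_subset simp: pi\<close>)
  finally show ?thesis using assms(1,2)
    by (simp add: contour_integral_linepath_same_Im contour_integral_linepath_same_Re[of _ X _ u v]
        contour_integral_linepath_same_Re[of _ x _ u v])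
qed

text \<open>By Fubini's theorem the integral of \<open>\<bar>g\<bar>\<close> over the strip is finite, so the horizontal
  cross-sections cannot all stay away from zero.\<close>

lemma exists_small_cross_sections:
  assumes g: "continuous_on right_half_plane g" and x: "0 < x" "x < X"
    and C: "\<And>s. x \<le> s \<Longrightarrow> s \<le> X \<Longrightarrow> (\<integral>\<^sup>+ y. ennreal (cmod (g (Complex s y))) \<partial>lborel) \<le> ennreal C"
    and \<delta>: "\<delta> > 0"
  shows "\<exists>Y\<ge>T. (\<integral>\<^sup>+ s. indicator {x..X} s * ennreal (cmod (g (Complex s Y))) \<partial>lborel) \<le> ennreal \<delta> \<and>
    (\<integral>\<^sup>+ s. indicator {x..X} s * ennreal (cmod (g (Complex s (- Y)))) \<partial>lborel) \<le> ennreal \<delta>"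
proof (rule ccontr)
  define H where "H Y = (\<integral>\<^sup>+ s. indicator {x..X} s * ennreal (cmod (g (Complex s Y))) \<partial>lborel)" for Y
  assume nex: "\<not> ?thesis"
  have big: "ennreal \<delta> \<le> H Y + H (-Y)" if "Y \<ge> T" for Y
  proof -
    have "ennreal \<delta> < H Y \<or> ennreal \<delta> < H (-Y)"
    proof (rule ccontr)
      assume "\<not> ?thesis"
      hence "H Y \<le> ennreal \<delta> \<and> H (-Y) \<le> ennreal \<delta>" by (simp add: not_less)
      thus False using nex that unfolding H_def by blast
    qed
    moreover have "H Y \<le> H Y + H (-Y)" "H (-Y) \<le> H Y + H (-Y)"
      by (auto intro: add_increasing add_increasing2)
    ultimately show ?thesis by (meson less_imp_le order_trans)
  qed
  have meas: "(\<lambda>p. indicator ({x..X} \<times> UNIV) p *\<^sub>R cmod (g (Complex (fst p) (snd p))))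
      \<in> borel_measurable (borel :: (real \<times> real) measure)"
  proof (rule borel_measurable_continuous_on_indicator)
    show "{x..X} \<times> (UNIV :: real set) \<in> sets borel"
      by (intro borel_closed closed_Times) auto
    show "continuous_on ({x..X} \<times> UNIV) (\<lambda>p. cmod (g (Complex (fst p) (snd p))))"
      using x by (intro continuous_on_norm continuous_on_compose2[OF g] continuous_intros)
        (auto simp: right_half_plane_def)
  qed
  hence meas': "(\<lambda>(s, y). indicator {x..X} s * ennreal (cmod (g (Complex s y))))
      \<in> borel_measurable (lborel \<Otimes>\<^sub>M lborel :: (real \<times> real) measure)"
  proof -
    have "(\<lambda>p. ennreal (indicator ({x..X} \<times> UNIV) p *\<^sub>R cmod (g (Complex (fst p) (snd p)))))
      \<in> borel_measurable (lborel \<Otimes>\<^sub>M lborel :: (real \<times> real) measure)"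
      using meas by (simp add: lborel_prod)
    also have "(\<lambda>p. ennreal (indicator ({x..X} \<times> UNIV) p *\<^sub>R cmod (g (Complex (fst p) (snd p)))))
       = (\<lambda>(s, y). indicator {x..X} s * ennreal (cmod (g (Complex s y))))"
      by (auto simp: fun_eq_iff indicator_def)
    finally show ?thesis .
  qed
  have Hmeas [measurable]: "H \<in> borel_measurable borel"
    unfolding H_def
    using lborel_pair.borel_measurable_nn_integral_fst lborel.borel_measurable_nn_integral[of "\<lambda>y s. indicator {x..X} s * ennreal (cmod (g (Complex s y)))" lborel] measurable_pair_swap[OF meas']
    by (simp add: case_prod_unfold)
  have "(\<integral>\<^sup>+ Y. H Y \<partial>lborel) =
      (\<integral>\<^sup>+ s. (\<integral>\<^sup>+ y. indicator {x..X} s * ennreal (cmod (g (Complex s y))) \<partial>lborel) \<partial>lborel)"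
    unfolding H_def by (rule lborel_pair.Fubini'[OF meas'])
  also have "\<dots> \<le> (\<integral>\<^sup>+ s. ennreal C * indicator {x..X} s \<partial>lborel)"
    by (rule nn_integral_mono) (use C in \<open>auto simp: indicator_def\<close>)
  also have "\<dots> = ennreal C * ennreal (X - x)"
    using x by (subst nn_integral_cmult_indicator) auto
  finally have fin: "(\<integral>\<^sup>+ Y. H Y \<partial>lborel) < \<infinity>"
    by (simp add: ennreal_mult_less_top le_less_trans)
  have "(\<integral>\<^sup>+ Y. H (-Y) \<partial>lborel) = (\<integral>\<^sup>+ Y. H Y \<partial>lborel)"
    using nn_integral_real_affine[OF Hmeas, of "-1" 0] by simp
  hence "(\<integral>\<^sup>+ Y. H Y + H (-Y) \<partial>lborel) < \<infinity>"
    using fin by (subst nn_integral_add) auto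
  moreover have "(\<integral>\<^sup>+ Y. ennreal \<delta> * indicator {T..} Y \<partial>lborel) \<le> (\<integral>\<^sup>+ Y. H Y + H (-Y) \<partial>lborel)"
    by (rule nn_integral_mono) (use big in \<open>auto simp: indicator_def\<close>)
  moreover have "(\<integral>\<^sup>+ Y. ennreal \<delta> * indicator {T..} Y \<partial>lborel) = \<infinity>"
  proof -
    have "\<not> emeasure lborel {T..} < \<infinity>"
    proof
      assume "emeasure lborel {T..} < \<infinity>"
      then obtain n :: nat where n: "emeasure lborel {T..} < of_nat n"
        using ennreal_Ex_less_of_nat by auto
      have "of_nat n = emeasure lborel {T..T + real n}"
        by (simp add: ennreal_of_nat_eq_real_of_nat)
      also have "\<dots> \<le> emeasure lborel {T..}"
        by (intro emeasure_mono) auto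
      finally show False using n by simp
    qed
    thus ?thesis using \<delta> by (subst nn_integral_cmult_indicator) (auto simp: less_top[symmetric] ennreal_mult_eq_top_iff)
  qed
  ultimately show False by simp
qed


section \<open>The Cauchy formula on a vertical line\<close>

lemma pole_L2:
  assumes "Re w \<noteq> x"
  shows "(\<lambda>y. 1 / (w - Complex x y)) \<in> L2" "normsq (\<lambda>y. 1 / (w - Complex x y)) = pi / \<bar>Re w - x\<bar>"
proof -
  define r where "r = Re w - x"
  have r: "r \<noteq> 0" using assms by (simp add: r_def)
  let ?g = "\<lambda>y. 1 / (w - Complex x y)"
  have nz: "w - Complex x y \<noteq> 0" for y
    using assms by (auto simp: complex_eq_iff)
  have sq: "(cmod (?g (Im w + r * u)))\<^sup>2 = (1 / r\<^sup>2) * inverse (1 + u\<^sup>2)" for u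
    using r by (simp add: norm_divide cmod_power2 power_divide r_def[symmetric] power_mult_distrib field_simps)
  have int: "integrable lborel (\<lambda>u::real. inverse (1 + u\<^sup>2))"
    using integrable_inverse_1_plus_square by (simp add: set_integrable_def)
  have "continuous_on UNIV ?g"
    using nz by (intro continuous_intros) auto
  hence "?g \<in> borel_measurable borel" by (rule borel_measurable_continuous_onI)
  moreover have "integrable lborel (\<lambda>y. (cmod (?g y))\<^sup>2)"
    using lborel_integrable_real_affine_iff[OF r, of "\<lambda>y. (cmod (?g y))\<^sup>2" "Im w"] int
    by (simp add: sq)
  ultimately show "?g \<in> L2" by (simp add: L2_def)
  have "normsq ?g = \<bar>r\<bar> * (1 / r\<^sup>2) * (\<integral>u. inverse (1 + u\<^sup>2) \<partial>lborel)"
    unfolding normsq_def using lborel_integral_real_affine[OF r, of "\<lambda>y. (cmod (?g y))\<^sup>2" "Im w"]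
    by (simp add: sq)
  also have "(\<integral>u. inverse (1 + (u::real)\<^sup>2) \<partial>lborel) = pi"
    using LBINT_inverse_1_plus_square by (simp add: interval_lebesgue_integral_def set_lebesgue_integral_def)
  also have "\<bar>r\<bar> * (1 / r\<^sup>2) * pi = pi / \<bar>r\<bar>"
    using r by (simp add: power2_eq_square abs_if)
  finally show "normsq ?g = pi / \<bar>Re w - x\<bar>" by (simp only: r_def)
qed

lemma integral_symmetric_interval_tendsto:
  fixes h :: "real \<Rightarrow> complex"
  assumes "integrable lborel h" "continuous_on UNIV h" "filterlim Y at_top sequentially"
  shows "(\<lambda>n. integral {- Y n..Y n} h) \<longlonglongrightarrow> (\<integral>t. h t \<partial>lborel)"
proof -
  have "(\<lambda>n. \<integral>t. indicator {- Y n..Y n} t *\<^sub>R h t \<partial>lborel) \<longlonglongrightarrow> (\<integral>t. h t \<partial>lborel)"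
  proof (rule integral_dominated_convergence)
    show "integrable lborel (\<lambda>t. norm (h t))" using assms(1) by simp
    show "h \<in> borel_measurable lborel" using assms(1) by auto
    show "(\<lambda>t. indicator {- Y n..Y n} t *\<^sub>R h t) \<in> borel_measurable lborel" for n
      using assms(1) by measurable
    show "AE t in lborel. norm (indicator {- Y n..Y n} t *\<^sub>R h t) \<le> norm (h t)" for n
      by (auto simp: indicator_def)
    show "AE t in lborel. (\<lambda>n. indicator {- Y n..Y n} t *\<^sub>R h t) \<longlonglongrightarrow> h t"
    proof (rule AE_I2)
      fix t
      have "eventually (\<lambda>n. Y n \<ge> \<bar>t\<bar>) sequentially"
        using assms(3) by (simp add: filterlim_at_top)
      hence "eventually (\<lambda>n. indicator {- Y n..Y n} t *\<^sub>R h t = h t) sequentially"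
        by eventually_elim (auto simp: indicator_def)
      thus "(\<lambda>n. indicator {- Y n..Y n} t *\<^sub>R h t) \<longlonglongrightarrow> h t"
        by (rule tendsto_eventually)
    qed
  qed
  thus ?thesis
    using integral_eq_lborel(2)[OF continuous_on_subset[OF assms(2)]] by simp
qed

lemma strip_contour_limit:
  fixes G :: "complex \<Rightarrow> complex"
  assumes "x < X"
    and cont: "\<And>Y. Y > Y0 \<Longrightarrow> continuous_on (path_image (rectpath (Complex x (-Y)) (Complex X Y))) G"
    and K: "\<And>Y. Y > Y0 \<Longrightarrow> contour_integral (rectpath (Complex x (-Y)) (Complex X Y)) G = K"
    and int: "integrable lborel (line G x)" "integrable lborel (line G X)"
      "continuous_on UNIV (line G x)" "continuous_on UNIV (line G X)"
    and edges: "\<And>T \<epsilon>. \<epsilon> > 0 \<Longrightarrow> \<exists>Y\<ge>T. cmod (integral {x..X} (\<lambda>s. G (Complex s Y))) \<le> \<epsilon> \<and>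
        cmod (integral {x..X} (\<lambda>s. G (Complex s (-Y)))) \<le> \<epsilon>"
  shows "\<i> * ((\<integral>y. line G X y \<partial>lborel) - (\<integral>y. line G x y \<partial>lborel)) = K"
proof -
  have "\<forall>n. \<exists>Y\<ge>max (real n) (\<bar>Y0\<bar> + 1). cmod (integral {x..X} (\<lambda>s. G (Complex s Y))) \<le> 1 / real (Suc n) \<and>
        cmod (integral {x..X} (\<lambda>s. G (Complex s (-Y)))) \<le> 1 / real (Suc n)"
    by (intro allI edges) simp
  then obtain Y where Y: "\<And>n. Y n \<ge> max (real n) (\<bar>Y0\<bar> + 1)"
    "\<And>n. cmod (integral {x..X} (\<lambda>s. G (Complex s (Y n)))) \<le> 1 / real (Suc n)"
    "\<And>n. cmod (integral {x..X} (\<lambda>s. G (Complex s (- Y n)))) \<le> 1 / real (Suc n)"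
    by metis
  have Ylim: "filterlim Y at_top sequentially"
    by (rule filterlim_at_top_mono[OF filterlim_real_sequentially]) (use Y(1) in auto)
  have lim0: "(\<lambda>n. 1 / real (Suc n)) \<longlonglongrightarrow> 0"
    using LIMSEQ_inverse_real_of_nat by (simp add: inverse_eq_divide)
  have e: "(\<lambda>n. integral {x..X} (\<lambda>s. G (Complex s (Y n)))) \<longlonglongrightarrow> 0"
      "(\<lambda>n. integral {x..X} (\<lambda>s. G (Complex s (- Y n)))) \<longlonglongrightarrow> 0"
    using Y(2,3) by (auto intro!: Lim_null_comparison[OF _ lim0])
  have v: "(\<lambda>n. integral {- Y n..Y n} (line G x)) \<longlonglongrightarrow> (\<integral>y. line G x y \<partial>lborel)"
    "(\<lambda>n. integral {- Y n..Y n} (line G X)) \<longlonglongrightarrow> (\<integral>y. line G X y \<partial>lborel)"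
    using int Ylim by (auto intro: integral_symmetric_interval_tendsto)
  have "(\<lambda>n. integral {x..X} (\<lambda>s. G (Complex s (- Y n))) + \<i> * integral {- Y n..Y n} (line G X)
     - integral {x..X} (\<lambda>s. G (Complex s (Y n))) - \<i> * integral {- Y n..Y n} (line G x))
     \<longlonglongrightarrow> 0 + \<i> * (\<integral>y. line G X y \<partial>lborel) - 0 - \<i> * (\<integral>y. line G x y \<partial>lborel)"
    by (intro tendsto_intros e v)
  moreover have "integral {x..X} (\<lambda>s. G (Complex s (- Y n))) + \<i> * integral {- Y n..Y n} (line G X)
     - integral {x..X} (\<lambda>s. G (Complex s (Y n))) - \<i> * integral {- Y n..Y n} (line G x) = K" for n
  proof -
    have "Y n > Y0" "- Y n < Y n" using Y(1)[of n] by auto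
    thus ?thesis
      using contour_integral_rectpath[OF \<open>x < X\<close> _ cont, of "Y n"] K[of "Y n"] by (simp add: line_def)
  qed
  ultimately have "(\<lambda>n. K) \<longlonglongrightarrow> 0 + \<i> * (\<integral>y. line G X y \<partial>lborel) - 0 - \<i> * (\<integral>y. line G x y \<partial>lborel)"
    by simp
  from LIMSEQ_unique[OF this tendsto_const] show ?thesis by (simp add: algebra_simps)
qed

text \<open>
  Cauchy's integral formula on tall rectangles: their horizontal edges disappear along a suitable
  sequence of heights, and the two vertical sides become the two line integrals.
\<close>

lemma cauchy_strip:
  fixes f :: "complex \<Rightarrow> complex"
  assumes f: "f \<in> hardy_space" and x: "0 < x" "x < Re w" "Re w < X"
  shows "(\<integral>y. f (Complex x y) / (w - Complex x y) \<partial>lborel)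
    = 2 * pi * f w + (\<integral>y. f (Complex X y) / (w - Complex X y) \<partial>lborel)"
proof -
  define G where "G z = f z / (z - w)" for z
  define S where "S = {z. x/2 < Re z}"
  note hol = hardy_space_D(1)[OF f] note cf = hardy_space_D(3)[OF f]
  have S: "convex S" "open S" "S \<subseteq> right_half_plane"
    unfolding S_def using x convex_halfspace_Re_gt[of "x/2"] open_halfspace_Re_gt[of "x/2"]
    by (simp_all only: right_half_plane_def) auto
  have Gcont: "continuous_on (right_half_plane - {w}) G"
    unfolding G_def by (intro continuous_intros continuous_on_subset[OF cf]) auto
  define Y0 where "Y0 = \<bar>Im w\<bar> + 1"
  have pi_sub: "path_image (rectpath (Complex x (-Y)) (Complex X Y)) \<subseteq> S - {w}"
    and wbox: "w \<in> box (Complex x (-Y)) (Complex X Y)" if "Y > Y0" for Y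
  proof -
    show "w \<in> box (Complex x (-Y)) (Complex X Y)"
      using that x by (auto simp: in_box_complex_iff Y0_def)
    thus "path_image (rectpath (Complex x (-Y)) (Complex X Y)) \<subseteq> S - {w}"
      using that x by (subst path_image_rectpath_cbox_minus_box)
        (auto simp: S_def in_cbox_complex_iff Y0_def)
  qed
  have L: "line G t \<in> borel_measurable borel" "integrable lborel (line G t)" "continuous_on UNIV (line G t)"
    if "t > 0" "t \<noteq> Re w" for t
  proof -
    show c: "continuous_on UNIV (line G t)"
      unfolding line_def using that
      by (intro continuous_on_compose2[OF Gcont] continuous_intros) (auto simp: right_half_plane_def)
    thus "line G t \<in> borel_measurable borel" by (rule borel_measurable_continuous_onI)
    have "integrable lborel (\<lambda>y. line f t y * cnj (- cnj (1 / (w - Complex t y))))"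
    proof (rule L2_mult_integrable)
      show "line f t \<in> L2" by (rule hardy_line[OF f \<open>t > 0\<close>])
      have *: "(\<lambda>y. 1 / (w - Complex t y)) \<in> L2" using that by (intro pole_L2) auto
      show "(\<lambda>y. - cnj (1 / (w - Complex t y))) \<in> L2"
      proof (rule L2_dominated[OF *])
        have "continuous_on UNIV (\<lambda>y. - cnj (1 / (w - Complex t y)))"
          using that by (intro continuous_intros) (auto simp: complex_eq_iff)
        thus "(\<lambda>y. - cnj (1 / (w - Complex t y))) \<in> borel_measurable borel"
          by (rule borel_measurable_continuous_onI)
      qed (simp only: norm_minus_cancel complex_mod_cnj order_refl)
    qed
    also have "(\<lambda>y. line f t y * cnj (- cnj (1 / (w - Complex t y)))) = line G t"
    proof
      fix y
      have "w - Complex t y \<noteq> 0" "Complex t y - w \<noteq> 0" using that by (auto simp: complex_eq_iff)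
      thus "line f t y * cnj (- cnj (1 / (w - Complex t y))) = line G t y"
        by (simp add: line_def G_def field_simps)
    qed
    finally show "integrable lborel (line G t)" .
  qed
  have "\<i> * ((\<integral>y. line G X y \<partial>lborel) - (\<integral>y. line G x y \<partial>lborel)) = 2 * of_real pi * \<i> * f w"
  proof (rule strip_contour_limit[where ?Y0.0 = Y0])
    show "x < X" using x by simp
    show "continuous_on (path_image (rectpath (Complex x (-Y)) (Complex X Y))) G" if "Y > Y0" for Y
      using pi_sub[OF that] S(3) by (intro continuous_on_subset[OF Gcont]) auto
    show "contour_integral (rectpath (Complex x (-Y)) (Complex X Y)) G = 2 * of_real pi * \<i> * f w" if "Y > Y0" for Y
    proof -
      have "((\<lambda>z. f z / (z - w)) has_contour_integral
          (2*pi * \<i> * winding_number (rectpath (Complex x (-Y)) (Complex X Y)) w * f w))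
          (rectpath (Complex x (-Y)) (Complex X Y))"
        using S x pi_sub[OF that] holomorphic_on_subset[OF hol S(3)]
        by (intro Cauchy_integral_formula_convex_simple[of S]) (auto simp: interior_open S_def)
      moreover have "winding_number (rectpath (Complex x (-Y)) (Complex X Y)) w = 1"
        using wbox[OF that] by (rule winding_number_rectpath)
      moreover have "G = (\<lambda>z. f z / (z - w))" by (simp add: G_def fun_eq_iff)
      ultimately show ?thesis by (simp add: contour_integral_unique)
    qed
    show "integrable lborel (line G x)" "integrable lborel (line G X)"
      "continuous_on UNIV (line G x)" "continuous_on UNIV (line G X)"
      using x by (auto intro: L)
    show "\<exists>Y\<ge>T. cmod (integral {x..X} (\<lambda>s. G (Complex s Y))) \<le> \<epsilon> \<and>
        cmod (integral {x..X} (\<lambda>s. G (Complex s (-Y)))) \<le> \<epsilon>" if "\<epsilon> > 0" for T \<epsilon>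
    proof -
      have "continuous_on right_half_plane (\<lambda>z. (f z)\<^sup>2)"
        by (intro continuous_intros cf)
      moreover have "(\<integral>\<^sup>+ y. ennreal (cmod ((f (Complex s y))\<^sup>2)) \<partial>lborel) \<le> ennreal ((hardy_norm f)\<^sup>2)"
        if "x \<le> s" "s \<le> X" for s
      proof -
        have "s > 0" using that x by simp
        from nn_integral_normsq[OF hardy_line(1)[OF f this]] hardy_line(2)[OF f this]
        show ?thesis by (simp add: norm_power line_def ennreal_leI)
      qed
      ultimately obtain Y where Y: "Y \<ge> max T (\<bar>Im w\<bar> + (X - x + 1) / \<epsilon>)"
        "(\<integral>\<^sup>+ s. indicator {x..X} s * ennreal (cmod ((f (Complex s Y))\<^sup>2)) \<partial>lborel) \<le> ennreal 1"
        "(\<integral>\<^sup>+ s. indicator {x..X} s * ennreal (cmod ((f (Complex s (-Y)))\<^sup>2)) \<partial>lborel) \<le> ennreal 1"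
        using exists_small_cross_sections[of "\<lambda>z. (f z)\<^sup>2" x X _ 1 "max T (\<bar>Im w\<bar> + (X - x + 1) / \<epsilon>)"] x
        by fastforce
      have pos: "(X - x + 1) / \<epsilon> > 0" using x that by simp
      \<comment> \<open>the bound \<open>\<bar>f\<bar> \<le> 1 + \<bar>f\<bar>\<^sup>2\<close> and the decay of the pole\<close>
      have edge: "cmod (integral {x..X} (\<lambda>s. G (Complex s v))) \<le> \<epsilon>"
        if v: "\<bar>v\<bar> = Y" and le: "(\<integral>\<^sup>+ s. indicator {x..X} s * ennreal (cmod ((f (Complex s v))\<^sup>2)) \<partial>lborel) \<le> ennreal 1" for v
      proof -
        define d where "d = \<epsilon> / (X - x + 1)"
        have d: "d > 0" using x \<open>\<epsilon> > 0\<close> by (simp add: d_def)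
        have far: "cmod (Complex s v - w) \<ge> 1 / d" for s
        proof -
          have "1 / d = (X - x + 1) / \<epsilon>" by (simp add: d_def)
          hence "1 / d \<le> \<bar>v - Im w\<bar>" using Y(1) v by linarith
          also have "\<dots> \<le> cmod (Complex s v - w)" using abs_Im_le_cmod[of "Complex s v - w"] by simp
          finally show ?thesis .
        qed
        have "continuous_on {x..X} (\<lambda>s. G (Complex s v))"
        proof (intro continuous_on_compose2[OF Gcont] continuous_intros image_subsetI)
          fix s assume "s \<in> {x..X}"
          hence "Complex s v \<in> right_half_plane" using x by (simp add: right_half_plane_def)
          moreover have "Complex s v \<noteq> w"
          proof
            assume "Complex s v = w"
            thus False using far[of s] d by simp
          qed
          ultimately show "Complex s v \<in> right_half_plane - {w}" by simp
        qed
        hence "ennreal (cmod (integral {x..X} (\<lambda>s. G (Complex s v)))) \<le>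
            (\<integral>\<^sup>+ s. indicator {x..X} s * ennreal (cmod (G (Complex s v))) \<partial>lborel)"
          by (rule norm_integral_le_nn)
        also have "\<dots> \<le> (\<integral>\<^sup>+ s. ennreal d * (indicator {x..X} s + indicator {x..X} s * ennreal (cmod ((f (Complex s v))\<^sup>2))) \<partial>lborel)"
        proof (rule nn_integral_mono)
          fix s
          have "cmod (G (Complex s v)) \<le> d * (1 + cmod ((f (Complex s v))\<^sup>2))"
          proof -
            have "cmod (f (Complex s v)) \<le> 1 + (cmod (f (Complex s v)))\<^sup>2"
            proof -
              have "2 * cmod (f (Complex s v)) \<le> 1 + (cmod (f (Complex s v)))\<^sup>2"
                using sum_squares_bound[of 1 "cmod (f (Complex s v))"] by simp
              thus ?thesis using norm_ge_zero[of "f (Complex s v)"] by linarith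
            qed
            moreover have "cmod (G (Complex s v)) = cmod (f (Complex s v)) * (1 / cmod (Complex s v - w))"
              by (simp add: G_def norm_divide)
            moreover have "1 / cmod (Complex s v - w) \<le> d"
              using le_imp_inverse_le[OF far[of s]] d by (simp add: inverse_eq_divide)
            ultimately have "cmod (G (Complex s v)) \<le> (1 + (cmod (f (Complex s v)))\<^sup>2) * d"
              by (simp only:) (intro mult_mono; simp)
            thus ?thesis by (simp add: norm_power mult.commute)
          qed
          then have "ennreal (cmod (G (Complex s v))) \<le> ennreal d * (1 + ennreal (cmod ((f (Complex s v))\<^sup>2)))"
          proof -
            have "ennreal (cmod (G (Complex s v))) \<le> ennreal (d * (1 + cmod ((f (Complex s v))\<^sup>2)))"
              by (rule ennreal_leI) fact
            also have "\<dots> = ennreal d * (1 + ennreal (cmod ((f (Complex s v))\<^sup>2)))"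
              using d by (subst ennreal_mult) (auto simp: ennreal_plus)
            finally show ?thesis .
          qed
          thus "indicator {x..X} s * ennreal (cmod (G (Complex s v))) \<le>
              ennreal d * (indicator {x..X} s + indicator {x..X} s * ennreal (cmod ((f (Complex s v))\<^sup>2)))"
            by (auto simp: indicator_def)
        qed
        also have "\<dots> = ennreal d * (ennreal (X - x) + (\<integral>\<^sup>+ s. indicator {x..X} s * ennreal (cmod ((f (Complex s v))\<^sup>2)) \<partial>lborel))"
        proof -
          have "continuous_on {x..X} (\<lambda>s. cmod ((f (Complex s v))\<^sup>2))"
            using x by (intro continuous_intros continuous_on_compose2[OF cf]) (auto simp: right_half_plane_def)
          hence "(\<lambda>s. indicator {x..X} s *\<^sub>R cmod ((f (Complex s v))\<^sup>2)) \<in> borel_measurable borel"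
            by (intro borel_measurable_continuous_on_indicator) auto
          hence "(\<lambda>s. ennreal (indicator {x..X} s *\<^sub>R cmod ((f (Complex s v))\<^sup>2))) \<in> borel_measurable borel"
            by simp
          also have "(\<lambda>s. ennreal (indicator {x..X} s *\<^sub>R cmod ((f (Complex s v))\<^sup>2)))
              = (\<lambda>s. indicator {x..X} s * ennreal (cmod ((f (Complex s v))\<^sup>2)))"
            by (auto simp: indicator_def)
          finally have [measurable]: "\<dots> \<in> borel_measurable borel" .
          show ?thesis using x by (subst nn_integral_cmult) (auto simp: nn_integral_add)
        qed
        also have "\<dots> \<le> ennreal d * (ennreal (X - x) + ennreal 1)"
          using le by (intro mult_left_mono add_left_mono) auto
        also have "\<dots> = ennreal (d * (X - x + 1))"
          using x d by (subst ennreal_plus[symmetric]) (auto simp: ennreal_mult)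
        also have "d * (X - x + 1) = \<epsilon>" using x by (simp add: d_def)
        finally show ?thesis using \<open>\<epsilon> > 0\<close> by simp
      qed
      have Y0: "Y \<ge> 0" "Y \<ge> T" using Y(1) pos by auto
      show ?thesis using edge[of Y] edge[of "-Y"] Y Y0 by (intro exI[of _ Y]) auto
    qed
  qed
  hence "(\<integral>y. line G X y \<partial>lborel) - (\<integral>y. line G x y \<partial>lborel) = 2 * of_real pi * f w" by simp
  moreover have "(\<integral>y. f (Complex t y) / (w - Complex t y) \<partial>lborel) = - (\<integral>y. line G t y \<partial>lborel)" for t
  proof -
    have "f (Complex t y) / (w - Complex t y) = - line G t y" for y
      unfolding line_def G_def by (metis minus_diff_eq divide_minus_right)
    thus ?thesis by simp
  qed
  ultimately show ?thesis by (simp add: algebra_simps)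
qed

text \<open>
  As the right-hand line moves to infinity, the Cauchy-Schwarz inequality makes its contribution
  vanish, because the pole has squared norm \<open>\<pi> / t\<close> on a line at distance \<open>t\<close> from it.
\<close>

theorem hardy_cauchy_formula:
  fixes f :: "complex \<Rightarrow> complex"
  assumes f: "f \<in> hardy_space" and x: "0 < x" "x < Re w"
  shows "(\<integral>y. f (Complex x y) / (w - Complex x y) \<partial>lborel) = 2 * pi * f w"
proof -
  define J where "J = (\<integral>y. f (Complex x y) / (w - Complex x y) \<partial>lborel) - 2 * pi * f w"
  have bound: "(cmod J)\<^sup>2 \<le> (hardy_norm f)\<^sup>2 * pi * (1 / t)" if "t > 0" for t
  proof -
    define X where "X = Re w + t"
    have X: "X > 0" "Re w < X" using x that by (auto simp: X_def)
    have P: "(\<lambda>y. 1 / (w - Complex X y)) \<in> L2" "normsq (\<lambda>y. 1 / (w - Complex X y)) = pi / t"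
      using pole_L2[of w X] X that by (auto simp: X_def)
    have Pc: "(\<lambda>y. cnj (1 / (w - Complex X y))) \<in> L2"
      using P(1) borel_measurable_cnj[OF L2_D[OF P(1)]] by (rule L2_dominated) (simp only: complex_mod_cnj order_refl)
    have "J = (\<integral>y. f (Complex X y) / (w - Complex X y) \<partial>lborel)"
      using cauchy_strip[OF f x X(2)] by (simp add: J_def)
    also have "\<dots> = inner2 (line f X) (\<lambda>y. cnj (1 / (w - Complex X y)))"
      by (simp add: inner2_def line_def)
    finally have "(cmod J)\<^sup>2 \<le> normsq (line f X) * normsq (\<lambda>y. cnj (1 / (w - Complex X y)))"
      using inner2_Cauchy_Schwarz[OF hardy_line(1)[OF f X(1)] Pc] by simp
    also have "normsq (\<lambda>y. cnj (1 / (w - Complex X y))) = pi / t"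
      using P(2) by (simp add: normsq_def norm_divide flip: complex_cnj_diff)
    also have "normsq (line f X) * (pi / t) \<le> (hardy_norm f)\<^sup>2 * (pi / t)"
      using hardy_line(2)[OF f X(1)] that by (intro mult_right_mono) auto
    finally show ?thesis by simp
  qed
  have lim: "((\<lambda>t. (hardy_norm f)\<^sup>2 * pi * (1 / t)) \<longlongrightarrow> (hardy_norm f)\<^sup>2 * pi * 0) at_top"
    by (intro tendsto_intros tendsto_divide_0[OF tendsto_const] filterlim_at_top_imp_at_infinity filterlim_ident)
  have "(cmod J)\<^sup>2 \<le> (hardy_norm f)\<^sup>2 * pi * 0"
    by (rule tendsto_lowerbound[OF lim eventually_mono[OF eventually_gt_at_top[of 0] bound]]) auto
  thus ?thesis by (simp add: J_def)
qed

section \<open>Sums of reproducing kernels\<close>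

text \<open>
  The kernel is kept as a rational function, so that it also has values on the imaginary axis;
  \<open>hkernel\<close> is its representative in \<open>hardy_space\<close>.
\<close>

definition kernel :: "complex \<Rightarrow> complex \<Rightarrow> complex" where
  "kernel l z = 1 / (z + cnj l)"

definition hkernel :: "complex \<Rightarrow> complex \<Rightarrow> complex" where
  "hkernel l z = (if z \<in> right_half_plane then kernel l z else 0)"

lemma line_kernel: "line (kernel l) x = line (kernel (l + of_real x)) 0"
  by (simp add: line_def kernel_def Complex_eq algebra_simps)

lemma cnj_kernel: "cnj (kernel l (Complex 0 y)) = 1 / (l - Complex 0 y)"
proof -
  have "cnj (Complex 0 y) = - Complex 0 y" by (simp add: complex_eq_iff)
  thus ?thesis by (simp add: kernel_def)
qed

lemma continuous_on_line_kernel: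
  assumes "Re l + x > 0" shows "continuous_on UNIV (line (kernel l) x)"
  unfolding line_def kernel_def using assms
  by (intro continuous_intros) (auto simp: complex_eq_iff)

lemma line_kernel_L2:
  assumes "Re l + x > 0"
  shows "line (kernel l) x \<in> L2" "normsq (line (kernel l) x) = pi / (Re l + x)"
proof -
  define m where "m = l + of_real x"
  have m: "Re m \<noteq> 0" "Re m > 0" "Re m = Re l + x" using assms by (auto simp: m_def)
  have eq: "cmod (line (kernel l) x y) = cmod (1 / (m - Complex 0 y))" for y
  proof -
    have "line (kernel l) x y = kernel m (Complex 0 y)"
      by (simp add: line_def kernel_def m_def Complex_eq algebra_simps)
    thus ?thesis by (simp only: cnj_kernel[symmetric] complex_mod_cnj)
  qed
  have P: "(\<lambda>y. 1 / (m - Complex 0 y)) \<in> L2" "normsq (\<lambda>y. 1 / (m - Complex 0 y)) = pi / Re m"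
    using pole_L2[OF m(1)] m by auto
  show "line (kernel l) x \<in> L2"
    by (rule L2_dominated[OF P(1)])
      (use assms eq in \<open>auto intro!: borel_measurable_continuous_onI continuous_on_line_kernel\<close>)
  show "normsq (line (kernel l) x) = pi / (Re l + x)"
    using P(2) by (simp add: normsq_def eq m)
qed

lemma hkernel_hardy_space:
  assumes "Re l > 0"
  shows "hkernel l \<in> hardy_space"
proof (rule hardy_spaceI)
  have "kernel l holomorphic_on right_half_plane"
    unfolding kernel_def using assms
    by (intro holomorphic_intros) (auto simp: right_half_plane_def complex_eq_iff)
  thus "hkernel l holomorphic_on right_half_plane"
    by (rule holomorphic_transform) (simp add: hkernel_def)
  show "hkernel l w = 0" if "w \<notin> right_half_plane" for w using that by (simp add: hkernel_def)
  have eq: "line (hkernel l) x = line (kernel l) x" if "x > 0" for x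
    using that by (simp add: line_def hkernel_def right_half_plane_def)
  show "line (hkernel l) x \<in> L2" if "x > 0" for x
    using that assms by (simp add: eq line_kernel_L2)
  show "normsq (line (hkernel l) x) \<le> (sqrt (pi / Re l))\<^sup>2" if "x > 0" for x
    using that assms by (simp add: eq line_kernel_L2 field_simps)
qed (use assms in simp)

lemma inner2_line_kernel:
  fixes f :: "complex \<Rightarrow> complex"
  assumes f: "f \<in> hardy_space" and x: "x > 0" and l: "Re l > 0"
  shows "inner2 (line f x) (line (kernel l) 0) = 2 * pi * f (of_real x + l)"
proof -
  have shift: "of_real x + l - Complex x y = l - Complex 0 y" for y
    by (simp add: complex_eq_iff)
  have "inner2 (line f x) (line (kernel l) 0) =
      (\<integral>y. f (Complex x y) / (of_real x + l - Complex x y) \<partial>lborel)"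
    unfolding inner2_def line_def cnj_kernel shift by simp
  also have "\<dots> = 2 * pi * f (of_real x + l)"
    using f x l by (intro hardy_cauchy_formula) auto
  finally show ?thesis .
qed

text \<open>
  A kernel extends across the imaginary axis, so the reproducing formula persists on the line
  \<open>x = 0\<close>: translate the kernel to the right by half the distance of its pole.
\<close>

lemma inner2_kernel_kernel:
  assumes x: "x \<ge> 0" and m: "Re m > 0" and l: "Re l > 0"
  shows "inner2 (line (kernel m) x) (line (kernel l) 0) = 2 * pi * kernel m (of_real x + l)"
proof -
  define r where "r = Re m / 2"
  have r: "r > 0" "Re (m - of_real r) > 0" using m by (auto simp: r_def)
  have "line (hkernel (m - of_real r)) (x + r) = line (kernel m) x"
    using x r by (auto simp: line_def hkernel_def right_half_plane_def kernel_def Complex_eq fun_eq_iff)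
  moreover have "hkernel (m - of_real r) (of_real (x + r) + l) = kernel m (of_real x + l)"
    using x r l by (simp add: hkernel_def right_half_plane_def kernel_def)
  ultimately show ?thesis
    using inner2_line_kernel[OF hkernel_hardy_space[OF r(2)], of "x + r" l] x r l by simp
qed

definition ksum :: "('i \<Rightarrow> complex) \<Rightarrow> ('i \<Rightarrow> complex) \<Rightarrow> 'i set \<Rightarrow> complex \<Rightarrow> complex" where
  "ksum a l J z = (\<Sum>j\<in>J. a j * kernel (l j) z)"

lemma line_ksum: "line (ksum a l J) x = (\<lambda>y. \<Sum>j\<in>J. a j * line (kernel (l j)) x y)"
  by (simp add: line_def ksum_def)

context
  fixes a l :: "'i \<Rightarrow> complex" and J :: "'i set"
  assumes l: "\<And>j. j \<in> J \<Longrightarrow> Re (l j) > 0"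
begin

lemma ksum_L2: "x \<ge> 0 \<Longrightarrow> line (ksum a l J) x \<in> L2"
  unfolding line_ksum using l by (intro L2_sum line_kernel_L2) (auto intro: add_pos_nonneg)

lemma inner2_ksum_kernel:
  assumes "x \<ge> 0" "Re m > 0"
  shows "inner2 (line (ksum a l J) x) (line (kernel m) 0) = 2 * pi * ksum a l J (of_real x + m)"
proof -
  have "inner2 (line (ksum a l J) x) (line (kernel m) 0)
      = (\<Sum>j\<in>J. a j * inner2 (line (kernel (l j)) x) (line (kernel m) 0))"
    unfolding line_ksum using assms l by (intro inner2_sum_left line_kernel_L2) (auto intro: add_pos_nonneg)
  also have "\<dots> = (\<Sum>j\<in>J. a j * (2 * pi * kernel (l j) (of_real x + m)))"
    using assms l by (intro sum.cong refl) (simp add: inner2_kernel_kernel)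
  finally show ?thesis by (simp add: ksum_def sum_distrib_left mult_ac)
qed

lemma inner2_ksum_right:
  assumes "g \<in> L2"
  shows "inner2 g (line (ksum a l J) 0) = (\<Sum>j\<in>J. cnj (a j) * inner2 g (line (kernel (l j)) 0))"
  unfolding line_ksum using assms l by (intro inner2_sum_right line_kernel_L2) auto

lemma inner2_hardy_ksum:
  fixes f :: "complex \<Rightarrow> complex"
  assumes "f \<in> hardy_space" "x > 0"
  shows "inner2 (line f x) (line (ksum a l J) 0) = 2 * pi * (\<Sum>j\<in>J. cnj (a j) * f (of_real x + l j))"
proof -
  have "inner2 (line f x) (line (ksum a l J) 0) = (\<Sum>j\<in>J. cnj (a j) * inner2 (line f x) (line (kernel (l j)) 0))"
    using assms by (intro inner2_ksum_right hardy_line)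
  also have "\<dots> = (\<Sum>j\<in>J. cnj (a j) * (2 * pi * f (of_real x + l j)))"
    using assms l by (intro sum.cong refl) (simp add: inner2_line_kernel)
  finally show ?thesis by (simp add: sum_distrib_left mult_ac)
qed

text \<open>
  Translation to the right by \<open>x\<close> is a symmetric operator on sums of kernels; moving one of the two
  translations in the squared norm to the other side doubles it.
\<close>

lemma normsq_ksum_doubling:
  assumes x: "x \<ge> 0"
  shows "of_real (normsq (line (ksum a l J) x)) = inner2 (line (ksum a l J) (2 * x)) (line (ksum a l J) 0)"
proof -
  have "inner2 (line (ksum a l J) x) (line (ksum a l J) x)
      = (\<Sum>j\<in>J. cnj (a j) * inner2 (line (ksum a l J) x) (line (kernel (l j)) x))"
    using x l ksum_L2[OF x]
    by (subst (2) line_ksum, intro inner2_sum_right line_kernel_L2) (auto intro: add_pos_nonneg)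
  also have "\<dots> = (\<Sum>j\<in>J. cnj (a j) * inner2 (line (ksum a l J) (2 * x)) (line (kernel (l j)) 0))"
  proof (intro sum.cong refl arg_cong2[of _ _ _ _ "(*)"])
    fix j assume j: "j \<in> J"
    show "inner2 (line (ksum a l J) x) (line (kernel (l j)) x) = inner2 (line (ksum a l J) (2 * x)) (line (kernel (l j)) 0)"
      unfolding line_kernel[of "l j" x] using x l[OF j]
      by (simp add: inner2_ksum_kernel algebra_simps del: mult_cancel_left)
  qed
  also have "\<dots> = inner2 (line (ksum a l J) (2 * x)) (line (ksum a l J) 0)"
    using x by (intro inner2_ksum_right[symmetric] ksum_L2) auto
  finally show ?thesis by (simp add: inner2_self)
qed

lemma normsq_ksum_bdd: "\<exists>M. \<forall>x\<ge>0. normsq (line (ksum a l J) x) \<le> M"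
proof -
  define g where "g = (\<lambda>y. \<Sum>j\<in>J. of_real (cmod (a j)) * complex_of_real (cmod (line (kernel (l j)) 0 y)))"
  have g: "g \<in> L2"
    unfolding g_def
  proof (rule L2_sum)
    fix j assume j: "j \<in> J"
    have "line (kernel (l j)) 0 \<in> L2" using l[OF j] by (intro line_kernel_L2) auto
    note [measurable] = L2_D[OF this]
    show "(\<lambda>y. complex_of_real (cmod (line (kernel (l j)) 0 y))) \<in> L2"
    proof (rule L2_dominated)
      show "line (kernel (l j)) 0 \<in> L2" by fact
      show "(\<lambda>y. complex_of_real (cmod (line (kernel (l j)) 0 y))) \<in> borel_measurable borel"
        by measurable
    qed (simp only: norm_of_real abs_norm_cancel order_refl)
  qed
  have "cmod (line (ksum a l J) x y) \<le> cmod (g y)" if x: "x \<ge> 0" for x y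
  proof -
    have k: "cmod (line (kernel (l j)) x y) \<le> cmod (line (kernel (l j)) 0 y)" if j: "j \<in> J" for j
    proof -
      have "cmod (Complex 0 y + cnj (l j)) \<le> cmod (Complex x y + cnj (l j))"
        using l[OF j] x by (simp add: cmod_def power_mono)
      moreover have "cmod (Complex 0 y + cnj (l j)) > 0"
        using l[OF j] by (auto simp: complex_eq_iff)
      moreover from calculation have "cmod (Complex x y + cnj (l j)) > 0" by linarith
      ultimately show ?thesis
        unfolding line_def kernel_def norm_divide by (intro divide_left_mono mult_pos_pos) auto
    qed
    have "cmod (line (ksum a l J) x y) \<le> (\<Sum>j\<in>J. cmod (a j * line (kernel (l j)) x y))"
      unfolding line_ksum by (rule norm_sum)
    also have "\<dots> \<le> (\<Sum>j\<in>J. cmod (a j) * cmod (line (kernel (l j)) 0 y))"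
      using k by (intro sum_mono) (auto simp: norm_mult intro: mult_left_mono)
    also have "\<dots> = Re (g y)" by (simp add: g_def)
    also have "\<dots> \<le> cmod (g y)" by (rule complex_Re_le_cmod)
    finally show ?thesis .
  qed
  thus ?thesis using g by (intro exI[of _ "normsq g"] allI impI normsq_mono ksum_L2) auto
qed

text \<open>
  Let \<open>M\<close> be the supremum of the squared norms over all lines. The doubling identity and the
  Cauchy-Schwarz inequality give \<open>n(x)\<^sup>2 \<le> n(2 x) n(0) \<le> M n(0)\<close> for every \<open>x\<close>, hence
  \<open>M\<^sup>2 \<le> M n(0)\<close>.
\<close>

lemma normsq_ksum_le:
  assumes x: "x \<ge> 0"
  shows "normsq (line (ksum a l J) x) \<le> normsq (line (ksum a l J) 0)"
proof -
  let ?n = "\<lambda>x. normsq (line (ksum a l J) x)"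
  define M where "M = (SUP x\<in>{0..}. ?n x)"
  have bdd: "bdd_above (?n ` {0..})"
    using normsq_ksum_bdd by (auto simp: bdd_above_def)
  have le: "?n x \<le> M" if "x \<ge> 0" for x
    unfolding M_def using that by (intro cSUP_upper bdd) auto
  have M0: "M \<ge> 0" using le[of 0] normsq_nonneg[of "line (ksum a l J) 0"] by simp
  have "?n x \<le> sqrt (M * ?n 0)" if x: "x \<ge> 0" for x
  proof (rule real_le_rsqrt)
    have "(?n x)\<^sup>2 = (cmod (inner2 (line (ksum a l J) (2 * x)) (line (ksum a l J) 0)))\<^sup>2"
      using normsq_ksum_doubling[OF x, symmetric] by simp
    also have "\<dots> \<le> ?n (2 * x) * ?n 0"
      using x by (intro inner2_Cauchy_Schwarz ksum_L2) auto
    also have "\<dots> \<le> M * ?n 0"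
      using x by (intro mult_right_mono le normsq_nonneg) auto
    finally show "(?n x)\<^sup>2 \<le> M * ?n 0" .
  qed
  hence "M \<le> sqrt (M * ?n 0)"
    unfolding M_def by (intro cSUP_least) (auto simp: M_def)
  hence "M\<^sup>2 \<le> (sqrt (M * ?n 0))\<^sup>2" using M0 by (intro power_mono) auto
  hence "M * M \<le> M * ?n 0"
    using M0 normsq_nonneg[of "line (ksum a l J) 0"] by (simp add: power2_eq_square)
  hence "M \<le> ?n 0"
    using M0 normsq_nonneg[of "line (ksum a l J) 0"] by (cases "M = 0") (auto simp: mult_le_cancel_left)
  thus ?thesis using le[OF x] by simp
qed

lemma ksum_pointwise:
  assumes w: "Re w > 0"
  shows "(cmod (ksum a l J w))\<^sup>2 \<le> normsq (line (ksum a l J) 0) / (4 * pi * Re w)"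
proof -
  have "(cmod (2 * pi * ksum a l J w))\<^sup>2 \<le> normsq (line (ksum a l J) 0) * (pi / Re w)"
    using inner2_Cauchy_Schwarz[of "line (ksum a l J) 0" "line (kernel w) 0"] ksum_L2[of 0]
      line_kernel_L2[of w 0] inner2_ksum_kernel[of 0 w] w by simp
  thus ?thesis using w by (simp add: norm_mult power_mult_distrib field_simps power2_eq_square)
qed

end


section \<open>Finite Blaschke products and partial fractions\<close>

definition blaschke :: "(nat \<Rightarrow> complex) \<Rightarrow> nat \<Rightarrow> complex \<Rightarrow> complex" where
  "blaschke l n z = (\<Prod>j<n. (z - l j) / (z + cnj (l j)))"

text \<open>
  Multiplying a kernel by a Blaschke factor with zero \<open>l\<close> only adds a multiple of the kernel at
  \<open>l\<close>, by a partial fraction decomposition. The factor \<open>cnj (blaschke l n w)\<close> normalises the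
  coefficient of the kernel at \<open>w\<close>. The identity serves twice: with \<open>w\<close> the next node it provides
  Newton-type interpolation functions, and with \<open>w\<close> fixed it shows how far \<open>k\<^sub>w\<close> is from the span.
\<close>

lemma blaschke_kernel_partial_fractions:
  assumes l: "\<And>j. j < n \<Longrightarrow> Re (l j) > 0" and inj: "inj_on l {..<n}"
    and w: "Re w > 0" "w \<notin> l ` {..<n}"
  shows "\<exists>e. \<forall>z. Re z \<ge> 0 \<longrightarrow>
     cnj (blaschke l n w) * blaschke l n z * kernel w z = kernel w z + ksum e l {..<n} z"
  using l inj w(2)
proof (induction n)
  case 0
  thus ?case by (auto simp: blaschke_def ksum_def)
next
  case (Suc n)
  then obtain e where e: "\<And>z. Re z \<ge> 0 \<Longrightarrow>
      cnj (blaschke l n w) * blaschke l n z * kernel w z = kernel w z + ksum e l {..<n} z"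
    by (force simp: inj_on_def lessThan_Suc)
  let ?p = "l n"
  have p: "Re ?p > 0" using Suc.prems by simp
  define \<beta> where "\<beta> \<mu> = (cnj \<mu> + ?p) / (cnj \<mu> - cnj ?p)" for \<mu>
  define \<gamma> where "\<gamma> \<mu> = - (cnj ?p + ?p) / (cnj \<mu> - cnj ?p)" for \<mu>
  have pf: "(z - ?p) / (z + cnj ?p) * kernel \<mu> z = \<beta> \<mu> * kernel \<mu> z + \<gamma> \<mu> * kernel ?p z"
    if "Re z \<ge> 0" "Re \<mu> > 0" "\<mu> \<noteq> ?p" for z \<mu>
  proof -
    have nz: "z + cnj ?p \<noteq> 0" "z + cnj \<mu> \<noteq> 0" "cnj \<mu> - cnj ?p \<noteq> 0"
      using that p by (auto simp: complex_eq_iff)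
    have "(cnj \<mu> + ?p) * (z + cnj ?p) - (cnj ?p + ?p) * (z + cnj \<mu>) = (z - ?p) * (cnj \<mu> - cnj ?p)"
      by (simp add: algebra_simps)
    hence "((cnj \<mu> + ?p) * (z + cnj ?p) - (cnj ?p + ?p) * (z + cnj \<mu>)) / ((cnj \<mu> - cnj ?p) * (z + cnj ?p) * (z + cnj \<mu>))
      = (z - ?p) * (cnj \<mu> - cnj ?p) / ((cnj \<mu> - cnj ?p) * (z + cnj ?p) * (z + cnj \<mu>))" by simp
    thus ?thesis using nz unfolding \<beta>_def \<gamma>_def kernel_def
      by (simp add: divide_simps) (simp add: algebra_simps)?
  qed
  define q where "q = cnj ((w - ?p) / (w + cnj ?p))"
  have wp: "w \<noteq> ?p" using Suc.prems(3) by auto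
  have "cnj w + ?p \<noteq> 0" "cnj w - cnj ?p \<noteq> 0" using w p wp by (auto simp: complex_eq_iff)
  hence q\<beta>: "q * \<beta> w = 1" by (simp add: q_def \<beta>_def)
  define e' where "e' j = (if j < n then q * e j * \<beta> (l j) else q * (\<gamma> w + (\<Sum>j<n. e j * \<gamma> (l j))))" for j
  have "cnj (blaschke l (Suc n) w) * blaschke l (Suc n) z * kernel w z = kernel w z + ksum e' l {..<Suc n} z"
    if z: "Re z \<ge> 0" for z
  proof -
    define b where "b = (z - ?p) / (z + cnj ?p)"
    have "cnj (blaschke l (Suc n) w) * blaschke l (Suc n) z * kernel w z
        = q * b * (cnj (blaschke l n w) * blaschke l n z * kernel w z)"
      by (simp add: blaschke_def q_def b_def)
    also have "\<dots> = q * (b * kernel w z) + q * (\<Sum>j<n. e j * (b * kernel (l j) z))"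
      unfolding e[OF z] by (simp add: ksum_def algebra_simps sum_distrib_left)
    also have "(\<Sum>j<n. e j * (b * kernel (l j) z)) = (\<Sum>j<n. e j * (\<beta> (l j) * kernel (l j) z + \<gamma> (l j) * kernel ?p z))"
    proof (unfold b_def, intro sum.cong refl arg_cong2[of _ _ _ _ "(*)"] pf)
      fix j assume "j \<in> {..<n}"
      thus "Re (l j) > 0" "l j \<noteq> ?p" using Suc.prems(1,2) by (auto simp: inj_on_def lessThan_Suc)
    qed (use z in auto)
    also have "b * kernel w z = \<beta> w * kernel w z + \<gamma> w * kernel ?p z"
      unfolding b_def using z w wp by (intro pf) auto
    also have "q * (\<beta> w * kernel w z + \<gamma> w * kernel ?p z) + q * (\<Sum>j<n. e j * (\<beta> (l j) * kernel (l j) z + \<gamma> (l j) * kernel ?p z))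
       = (q * \<beta> w) * kernel w z + ((\<Sum>j<n. q * e j * \<beta> (l j) * kernel (l j) z) + q * (\<gamma> w + (\<Sum>j<n. e j * \<gamma> (l j))) * kernel ?p z)"
      by (simp add: algebra_simps sum.distrib sum_distrib_left sum_distrib_right)
    also have "(\<Sum>j<n. q * e j * \<beta> (l j) * kernel (l j) z) + q * (\<gamma> w + (\<Sum>j<n. e j * \<gamma> (l j))) * kernel ?p z = ksum e' l {..<Suc n} z"
      by (simp add: ksum_def e'_def)
    finally show ?thesis by (simp add: q\<beta>)
  qed
  thus ?case by blast
qed

lemma norm_blaschke_le_1:
  assumes "\<And>j. j < n \<Longrightarrow> Re (l j) > 0" "Re z \<ge> 0"
  shows "cmod (blaschke l n z) \<le> 1"
  unfolding blaschke_def prod_norm[symmetric]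
proof (rule prod_le_1)
  fix j assume "j \<in> {..<n}"
  hence "Re (l j) > 0" using assms by simp
  hence "cmod (z - l j) \<le> cmod (z + cnj (l j))"
    using assms(2) by (simp add: cmod_def abs_le_square_iff[symmetric])
  thus "0 \<le> cmod ((z - l j) / (z + cnj (l j))) \<and> cmod ((z - l j) / (z + cnj (l j))) \<le> 1"
    by (simp add: norm_divide divide_le_eq_1)
qed

section \<open>Approximation in the Hardy space\<close>

lemma sum_fun_apply: "(sum F J) w = (\<Sum>j\<in>J. F j w)"
  by (induction J rule: infinite_finite_induct) auto

lemma hardy_norm_add_le:
  assumes f: "f \<in> hardy_space" and g: "g \<in> hardy_space"
  shows "hardy_norm (f + g) \<le> 2 * (hardy_norm f + hardy_norm g)"
proof (rule power2_le_imp_le)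
  have fg: "f + g \<in> hardy_space" by (rule cfun.subspace_add[OF subspace_hardy_space f g])
  have "ennreal ((hardy_norm (f + g))\<^sup>2) \<le> 2 * ennreal ((hardy_norm f)\<^sup>2) + 2 * ennreal ((hardy_norm g)\<^sup>2)"
    using hardy_norm_sq_add_le[OF hardy_space_D(1)[OF f] hardy_space_D(1)[OF g]]
    by (simp add: hardy_space_D(4) f g fg)
  also have "\<dots> = ennreal (2 * (hardy_norm f)\<^sup>2 + 2 * (hardy_norm g)\<^sup>2)"
    by (simp add: ennreal_plus ennreal_mult)
  finally have "(hardy_norm (f + g))\<^sup>2 \<le> 2 * (hardy_norm f)\<^sup>2 + 2 * (hardy_norm g)\<^sup>2"
    by (subst (asm) ennreal_le_iff) auto
  also have "\<dots> \<le> (2 * (hardy_norm f + hardy_norm g))\<^sup>2"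
    using mult_nonneg_nonneg[OF hardy_norm_nonneg[of f] hardy_norm_nonneg[of g]]
    by (simp add: power2_eq_square algebra_simps)
  finally show "(hardy_norm (f + g))\<^sup>2 \<le> (2 * (hardy_norm f + hardy_norm g))\<^sup>2" .
qed (simp add: hardy_norm_nonneg)

lemma hardy_norm_scale_le:
  assumes f: "f \<in> hardy_space"
  shows "hardy_norm (fun_scale c f) \<le> cmod c * hardy_norm f"
proof (rule power2_le_imp_le)
  have cf: "fun_scale c f \<in> hardy_space" by (rule cfun.subspace_scale[OF subspace_hardy_space f])
  have "ennreal ((hardy_norm (fun_scale c f))\<^sup>2) \<le> ennreal ((cmod c)\<^sup>2) * ennreal ((hardy_norm f)\<^sup>2)"
    using hardy_norm_sq_scale[OF hardy_space_D(1)[OF f], of c] by (simp add: hardy_space_D(4) f cf)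
  thus "(hardy_norm (fun_scale c f))\<^sup>2 \<le> (cmod c * hardy_norm f)\<^sup>2"
    by (simp add: ennreal_mult[symmetric] power_mult_distrib)
qed (simp add: hardy_norm_nonneg)

lemma hardy_space_diff: "f \<in> hardy_space \<Longrightarrow> g \<in> hardy_space \<Longrightarrow> f - g \<in> hardy_space"
  by (rule cfun.subspace_diff[OF subspace_hardy_space])

definition hclosure :: "(complex \<Rightarrow> complex) set \<Rightarrow> (complex \<Rightarrow> complex) set" where
  "hclosure X = {g \<in> hardy_space. \<forall>\<epsilon>>0. \<exists>h\<in>cfun.span X. hardy_norm (g - h) < \<epsilon>}"

lemma span_hardy: "X \<subseteq> hardy_space \<Longrightarrow> cfun.span X \<subseteq> hardy_space"
  by (rule cfun.span_minimal[OF _ subspace_hardy_space])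

lemma span_subset_hclosure:
  assumes "X \<subseteq> hardy_space" shows "cfun.span X \<subseteq> hclosure X"
proof
  fix g assume g: "g \<in> cfun.span X"
  have "hardy_norm (g - g) = 0"
    by (simp add: hardy_norm_def hardy_norm_sq_def zero_fun_def)
  thus "g \<in> hclosure X" using g span_hardy[OF assms] by (force simp: hclosure_def)
qed

lemma hclosure_mono: "X \<subseteq> cfun.span Y \<Longrightarrow> hclosure X \<subseteq> hclosure Y"
  unfolding hclosure_def using cfun.span_minimal[OF _ cfun.subspace_span] by blast

lemma subspace_hclosure:
  assumes X: "X \<subseteq> hardy_space" shows "cfun.subspace (hclosure X)"
proof (rule cfun.subspaceI)
  show "0 \<in> hclosure X" using span_subset_hclosure[OF X] cfun.span_zero by auto
next
  fix f g assume fg: "f \<in> hclosure X" "g \<in> hclosure X"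
  hence H: "f \<in> hardy_space" "g \<in> hardy_space" by (auto simp: hclosure_def)
  have "\<exists>h\<in>cfun.span X. hardy_norm (f + g - h) < \<epsilon>" if "\<epsilon> > 0" for \<epsilon>
  proof -
    have e: "\<epsilon> / 4 > 0" using that by simp
    obtain u where u: "u \<in> cfun.span X" "hardy_norm (f - u) < \<epsilon> / 4"
      using fg(1) e unfolding hclosure_def by blast
    obtain v where v: "v \<in> cfun.span X" "hardy_norm (g - v) < \<epsilon> / 4"
      using fg(2) e unfolding hclosure_def by blast
    note uv = u(1) v(1) u(2) v(2)
    have split: "f + g - (u + v) = (f - u) + (g - v)" by (simp add: fun_eq_iff)
    have "hardy_norm (f + g - (u + v)) \<le> 2 * (hardy_norm (f - u) + hardy_norm (g - v))"
      unfolding split using H uv span_hardy[OF X] by (intro hardy_norm_add_le hardy_space_diff) auto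
    also have "\<dots> < \<epsilon>" using uv by simp
    finally show ?thesis using cfun.span_add[OF uv(1,2)] by blast
  qed
  thus "f + g \<in> hclosure X"
    using cfun.subspace_add[OF subspace_hardy_space H] by (simp add: hclosure_def)
next
  fix c f assume f: "f \<in> hclosure X"
  hence H: "f \<in> hardy_space" by (auto simp: hclosure_def)
  have "\<exists>h\<in>cfun.span X. hardy_norm (fun_scale c f - h) < \<epsilon>" if "\<epsilon> > 0" for \<epsilon>
  proof -
    have "\<epsilon> / (cmod c + 1) > 0" using that by (intro divide_pos_pos add_nonneg_pos) auto
    then obtain u where u: "u \<in> cfun.span X" "hardy_norm (f - u) < \<epsilon> / (cmod c + 1)"
      using f unfolding hclosure_def by auto
    have "fun_scale c f - fun_scale c u = fun_scale c (f - u)"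
      by (simp add: fun_eq_iff fun_scale_def algebra_simps)
    hence "hardy_norm (fun_scale c f - fun_scale c u) \<le> cmod c * hardy_norm (f - u)"
      using H u span_hardy[OF X] by (auto intro!: hardy_norm_scale_le hardy_space_diff)
    also have "\<dots> \<le> (cmod c + 1) * hardy_norm (f - u)"
      by (intro mult_right_mono hardy_norm_nonneg) auto
    also have "\<dots> < \<epsilon>"
      using u(2) add_nonneg_pos[OF norm_ge_zero[of c] zero_less_one] by (simp add: pos_less_divide_eq mult.commute)
    finally show ?thesis using cfun.span_scale[OF u(1)] by blast
  qed
  thus "fun_scale c f \<in> hclosure X"
    using cfun.subspace_scale[OF subspace_hardy_space H] by (simp add: hclosure_def)
qed

lemma hclosure_idem:
  assumes X: "X \<subseteq> hardy_space" and Y: "Y \<subseteq> hclosure X"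
  shows "hclosure Y \<subseteq> hclosure X"
proof
  fix g assume g: "g \<in> hclosure Y"
  hence H: "g \<in> hardy_space" by (simp add: hclosure_def)
  have "\<exists>h\<in>cfun.span X. hardy_norm (g - h) < \<epsilon>" if "\<epsilon> > 0" for \<epsilon>
  proof -
    have e: "\<epsilon> / 4 > 0" using that by simp
    obtain u where u: "u \<in> cfun.span Y" "hardy_norm (g - u) < \<epsilon> / 4"
      using g e unfolding hclosure_def by blast
    have "u \<in> hclosure X" using u(1) cfun.span_minimal[OF Y subspace_hclosure[OF X]] by blast
    then obtain v where v: "v \<in> cfun.span X" "hardy_norm (u - v) < \<epsilon> / 4" and uH: "u \<in> hardy_space"
      using e unfolding hclosure_def by blast
    have split: "g - v = (g - u) + (u - v)" by (simp add: fun_eq_iff)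
    have "hardy_norm (g - v) \<le> 2 * (hardy_norm (g - u) + hardy_norm (u - v))"
      unfolding split using H uH v span_hardy[OF X] by (intro hardy_norm_add_le hardy_space_diff) auto
    also have "\<dots> < \<epsilon>" using u v by simp
    finally show ?thesis using v(1) by blast
  qed
  thus "g \<in> hclosure X" using H by (simp add: hclosure_def)
qed

lemma cyclic_iff_hclosure:
  "cyclic_on_hardy T \<longleftrightarrow> (\<exists>f\<in>hardy_space. hardy_space \<subseteq> hclosure (orbit T f))"
  unfolding cyclic_on_hardy_def hclosure_def by blast

section \<open>Density of reproducing kernels\<close>

text \<open>
  Newton interpolation: the Blaschke product with the first \<open>N\<close> nodes as zeros times the kernel at
  the next node is a sum of kernels that vanishes exactly at the old nodes among the first \<open>N + 1\<close>.
\<close>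

lemma ksum_interpolation:
  fixes f :: "complex \<Rightarrow> complex"
  assumes l: "\<And>j. Re (l j) > 0" and inj: "inj (l :: nat \<Rightarrow> complex)"
  shows "\<exists>a. \<forall>j<N. ksum a l {..<N} (l j) = f (l j)"
proof (induction N)
  case (Suc N)
  then obtain a where a: "\<And>j. j < N \<Longrightarrow> ksum a l {..<N} (l j) = f (l j)" by blast
  have notin: "l N \<notin> l ` {..<N}" using inj by (auto simp: inj_def)
  obtain e where e: "\<And>z. Re z \<ge> 0 \<Longrightarrow>
     cnj (blaschke l N (l N)) * blaschke l N z * kernel (l N) z = kernel (l N) z + ksum e l {..<N} z"
    using blaschke_kernel_partial_fractions[of N l "l N"] l inj notin by (auto intro: inj_on_subset)
  define E where "E z = kernel (l N) z + ksum e l {..<N} z" for z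
  have E0: "E (l j) = 0" if "j < N" for j
  proof -
    have "blaschke l N (l j) = 0" using that by (auto simp: blaschke_def)
    thus ?thesis using e[of "l j"] l[of j] by (simp add: E_def)
  qed
  have "l N + cnj (l j) \<noteq> 0" for j
    using l[of N] l[of j] by (auto simp: complex_eq_iff)
  hence "blaschke l N (l N) \<noteq> 0"
    using notin by (auto simp: blaschke_def)
  moreover have "kernel (l N) (l N) \<noteq> 0" using \<open>\<And>j. l N + cnj (l j) \<noteq> 0\<close> by (simp add: kernel_def)
  ultimately have EN: "E (l N) \<noteq> 0" using e[of "l N"] l[of N] by (auto simp: E_def)
  define c where "c = (f (l N) - ksum a l {..<N} (l N)) / E (l N)"
  define a' where "a' j = (if j < N then a j + c * e j else c)" for j
  have "ksum a' l {..<Suc N} z = ksum a l {..<N} z + c * E z" for z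
    by (simp add: ksum_def a'_def E_def algebra_simps sum.distrib sum_distrib_left)
  hence "ksum a' l {..<Suc N} (l j) = f (l j)" if "j < Suc N" for j
    using that a[of j] E0[of j] EN by (cases "j = N") (auto simp: c_def)
  thus ?case by blast
qed simp

text \<open>
  The sum of kernels \<open>S N\<close> interpolating \<open>f\<close> at the first \<open>N\<close> nodes is the orthogonal projection of
  \<open>f\<close>, so the squared norms \<open>s N\<close> increase, stay below that of \<open>f\<close>, and control the differences
  \<open>S M - S N\<close>. Hence \<open>S N\<close> converges locally uniformly to a holomorphic function that agrees with \<open>f\<close>
  at all nodes, and the identity theorem identifies it with \<open>f\<close>.
\<close>

theorem kernels_dense:
  assumes l: "\<And>j. Re (l j) > 0" and inj: "inj (l :: nat \<Rightarrow> complex)"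
    and lim: "l \<longlonglongrightarrow> L" "\<And>j. l j \<noteq> L" "Re L > 0"
  shows "hardy_space \<subseteq> hclosure (range (\<lambda>n. hkernel (l n)))"
proof
  fix f assume f: "f \<in> hardy_space"
  obtain A where A: "\<And>N j. j < N \<Longrightarrow> ksum (A N) l {..<N} (l j) = f (l j)"
    using ksum_interpolation[OF l inj, of _ f] by metis
  define S where "S N = ksum (A N) l {..<N}" for N
  define s where "s N = normsq (line (S N) 0)" for N
  have SL: "line (S N) 0 \<in> L2" for N unfolding S_def using l by (intro ksum_L2) auto
  have ipS: "inner2 (line (S M) 0) (line (S N) 0) = of_real (s N)" if "N \<le> M" for M N
  proof -
    have *: "inner2 (line (S M) 0) (line (S N) 0) = 2 * pi * (\<Sum>j<N. cnj (A N j) * f (l j))" if "N \<le> M" for M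
    proof -
      have "inner2 (line (S M) 0) (line (S N) 0) = (\<Sum>j<N. cnj (A N j) * inner2 (line (S M) 0) (line (kernel (l j)) 0))"
        unfolding S_def[of N] using l SL by (intro inner2_ksum_right) auto
      also have "\<dots> = (\<Sum>j<N. cnj (A N j) * (2 * pi * f (l j)))"
        using that l A unfolding S_def by (intro sum.cong refl) (simp add: inner2_ksum_kernel)
      finally show ?thesis by (simp add: sum_distrib_left mult_ac)
    qed
    show ?thesis using *[OF that] *[of N] inner2_self[of "line (S N) 0"] by (simp add: s_def)
  qed
  have s_le: "s N \<le> (hardy_norm f)\<^sup>2" for N
  proof -
    let ?g = "\<lambda>x::real. 2 * pi * (\<Sum>j<N. cnj (A N j) * f (of_real x + l j))"
    have "(?g \<longlongrightarrow> 2 * pi * (\<Sum>j<N. cnj (A N j) * f (of_real 0 + l j))) (at_right 0)"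
    proof (intro tendsto_intros)
      fix j
      have "isCont f (l j)"
        using hardy_space_D(3)[OF f] l open_right_half_plane
        by (auto simp: continuous_on_eq_continuous_at right_half_plane_def)
      moreover have "((\<lambda>x::real. of_real x + l j) \<longlongrightarrow> of_real 0 + l j) (at_right 0)"
        by (intro tendsto_intros)
      ultimately show "((\<lambda>x::real. f (of_real x + l j)) \<longlongrightarrow> f (of_real 0 + l j)) (at_right 0)"
        by (intro isCont_tendsto_compose[of _ f]) auto
    qed
    also have "2 * pi * (\<Sum>j<N. cnj (A N j) * f (of_real 0 + l j)) = inner2 (line (S N) 0) (line (S N) 0)"
    proof -
      have "inner2 (line (S N) 0) (line (S N) 0) = (\<Sum>j<N. cnj (A N j) * inner2 (line (S N) 0) (line (kernel (l j)) 0))"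
        unfolding S_def using l SL[of N, unfolded S_def] by (intro inner2_ksum_right) auto
      also have "\<dots> = (\<Sum>j<N. cnj (A N j) * (2 * pi * f (l j)))"
        using l A unfolding S_def by (intro sum.cong refl) (simp add: inner2_ksum_kernel)
      finally show ?thesis by (simp add: sum_distrib_left mult_ac)
    qed
    also have "\<dots> = of_real (s N)" by (simp add: ipS)
    finally have "((\<lambda>x. (cmod (?g x))\<^sup>2) \<longlongrightarrow> (cmod (of_real (s N)))\<^sup>2) (at_right 0)"
      by (intro tendsto_intros)
    moreover have "eventually (\<lambda>x::real. (cmod (?g x))\<^sup>2 \<le> (hardy_norm f)\<^sup>2 * s N) (at_right 0)"
    proof (rule eventually_at_right_less[THEN eventually_mono])
      fix x :: real assume x: "0 < x"
      have "(cmod (?g x))\<^sup>2 \<le> normsq (line f x) * s N"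
        using inner2_Cauchy_Schwarz[OF hardy_line(1)[OF f x] SL[of N]] inner2_hardy_ksum[of "{..<N}" l f x "A N", OF l f x] unfolding S_def s_def by simp
      also have "\<dots> \<le> (hardy_norm f)\<^sup>2 * s N"
        using hardy_line(2)[OF f x] by (intro mult_right_mono) (auto simp: s_def normsq_nonneg)
      finally show "(cmod (?g x))\<^sup>2 \<le> (hardy_norm f)\<^sup>2 * s N" .
    qed
    ultimately have "(cmod (of_real (s N)))\<^sup>2 \<le> (hardy_norm f)\<^sup>2 * s N"
      by (rule tendsto_upperbound) simp
    thus ?thesis
      using normsq_nonneg[of "line (S N) 0"] by (cases "s N = 0") (auto simp: s_def power2_eq_square)
  qed
  define D where "D N M = ksum (\<lambda>j. A M j - (if j < N then A N j else 0)) l {..<M}" for N M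
  have D: "D N M z = S M z - S N z" if "N \<le> M" for N M z
  proof -
    have "(\<Sum>j<M. (if j < N then A N j else 0) * kernel (l j) z) = (\<Sum>j<N. A N j * kernel (l j) z)"
      using that by (intro sum.mono_neutral_cong_right) auto
    thus ?thesis by (simp add: D_def S_def ksum_def left_diff_distrib sum_subtractf)
  qed
  have nD: "normsq (line (D N M) 0) = s M - s N" if "N \<le> M" for N M
  proof -
    have "line (D N M) 0 = (\<lambda>y. line (S M) 0 y - line (S N) 0 y)"
      using D[OF that] by (simp add: line_def)
    thus ?thesis using normsq_diff[OF SL SL, of M N] ipS[OF that] by (simp add: s_def)
  qed
  have mono: "incseq s"
    unfolding incseq_def by (metis nD normsq_nonneg diff_ge_0_iff_ge)
  obtain \<sigma> where \<sigma>: "s \<longlonglongrightarrow> \<sigma>" "\<And>n. s n \<le> \<sigma>"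
    using incseq_convergent[OF mono, of "(hardy_norm f)\<^sup>2"] s_le by blast
  have pt: "(cmod (S M w - S N w))\<^sup>2 \<le> (\<sigma> - s N) / (4 * pi * Re w)" if "N \<le> M" "Re w > 0" for M N w
  proof -
    have "(cmod (D N M w))\<^sup>2 \<le> normsq (line (D N M) 0) / (4 * pi * Re w)"
      unfolding D_def using l that by (intro ksum_pointwise) auto
    also have "\<dots> \<le> (\<sigma> - s N) / (4 * pi * Re w)"
      using that \<sigma>(2) by (intro divide_right_mono) (auto simp: nD)
    finally show ?thesis using D that by simp
  qed
  have small: "\<exists>N0. \<forall>N\<ge>N0. \<sigma> - s N < \<epsilon>" if "\<epsilon> > 0" for \<epsilon>
    using order_tendstoD(1)[OF \<sigma>(1), of "\<sigma> - \<epsilon>"] that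
    by (auto simp: eventually_sequentially algebra_simps)
  define g where "g w = lim (\<lambda>n. S n w)" for w
  have glim: "(\<lambda>n. S n w) \<longlonglongrightarrow> g w" if w: "Re w > 0" for w
  proof -
    have "Cauchy (\<lambda>n. S n w)"
    proof (rule CauchyI')
      fix e :: real assume e: "e > 0"
      obtain N0 where N0: "\<And>N. N \<ge> N0 \<Longrightarrow> \<sigma> - s N < e\<^sup>2 * (4 * pi * Re w)"
        using small[of "e\<^sup>2 * (4 * pi * Re w)"] w e by auto
      have "dist (S m w) (S n w) < e" if "m \<ge> N0" "n > m" for m n
      proof -
        have "(cmod (S n w - S m w))\<^sup>2 \<le> (\<sigma> - s m) / (4 * pi * Re w)" using that w by (intro pt) auto
        also have "\<dots> < e\<^sup>2" using N0[OF that(1)] w by (simp add: pos_divide_less_eq)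
        finally have "cmod (S n w - S m w) < e" using e by (simp add: power_less_imp_less_base)
        thus ?thesis by (simp add: dist_norm norm_minus_commute)
      qed
      thus "\<exists>M. \<forall>m\<ge>M. \<forall>n>m. dist (S m w) (S n w) < e" by blast
    qed
    thus ?thesis unfolding g_def by (simp add: Cauchy_convergent_iff convergent_LIMSEQ_iff)
  qed
  have gpt: "(cmod (g w - S N w))\<^sup>2 \<le> (\<sigma> - s N) / (4 * pi * Re w)" if "Re w > 0" for N w
  proof (rule tendsto_upperbound)
    show "(\<lambda>M. (cmod (S M w - S N w))\<^sup>2) \<longlonglongrightarrow> (cmod (g w - S N w))\<^sup>2"
      by (intro tendsto_intros glim that)
    show "eventually (\<lambda>M. (cmod (S M w - S N w))\<^sup>2 \<le> (\<sigma> - s N) / (4 * pi * Re w)) sequentially"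
      using eventually_ge_at_top[of N] by eventually_elim (use that in \<open>auto intro: pt\<close>)
  qed simp
  have ghol: "g holomorphic_on right_half_plane"
  proof (rule holomorphic_uniform_sequence[OF open_right_half_plane])
    show "S n holomorphic_on right_half_plane" for n
      unfolding S_def ksum_def kernel_def
      by (intro holomorphic_intros) (use l in \<open>auto simp: right_half_plane_def complex_eq_iff add_pos_pos less_imp_neq[THEN not_sym]\<close>)
    fix w assume "w \<in> right_half_plane"
    hence w: "Re w > 0" by (simp add: right_half_plane_def)
    define d where "d = Re w / 2"
    have d: "d > 0" using w by (simp add: d_def)
    have sub: "Re z \<ge> d" if "z \<in> cball w d" for z
      using that abs_Re_le_cmod[of "w - z"] by (simp add: dist_norm d_def)
    have "uniform_limit (cball w d) S g sequentially"
    proof (rule uniform_limitI)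
      fix e :: real assume e: "e > 0"
      obtain N0 where N0: "\<And>N. N \<ge> N0 \<Longrightarrow> \<sigma> - s N < e\<^sup>2 * (4 * pi * d)"
        using small[of "e\<^sup>2 * (4 * pi * d)"] d e by auto
      have "dist (S N z) (g z) < e" if "N \<ge> N0" "z \<in> cball w d" for N z
      proof -
        have z: "Re z \<ge> d" "Re z > 0" using sub[OF that(2)] d by auto
        have "(cmod (g z - S N z))\<^sup>2 \<le> (\<sigma> - s N) / (4 * pi * Re z)" by (intro gpt z)
        also have "\<dots> \<le> (\<sigma> - s N) / (4 * pi * d)"
          using z d \<sigma>(2)[of N] by (intro divide_left_mono mult_pos_pos) auto
        also have "\<dots> < e\<^sup>2" using N0[OF that(1)] d by (simp add: pos_divide_less_eq)
        finally have "cmod (g z - S N z) < e" using e by (simp add: power_less_imp_less_base)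
        thus ?thesis by (simp add: dist_norm norm_minus_commute)
      qed
      thus "\<forall>\<^sub>F n in sequentially. \<forall>z\<in>cball w d. dist (S n z) (g z) < e"
        unfolding eventually_sequentially by blast
    qed
    moreover have "cball w d \<subseteq> right_half_plane"
      using sub d by (force simp: right_half_plane_def)
    ultimately show "\<exists>d>0. cball w d \<subseteq> right_half_plane \<and> uniform_limit (cball w d) S g sequentially"
      using d by blast
  qed
  have fg: "f w = g w" if w: "Re w > 0" for w
  proof -
    have "f w - g w = 0"
    proof (rule analytic_continuation[of "\<lambda>z. f z - g z" right_half_plane "range l" L])
      show "(\<lambda>z. f z - g z) holomorphic_on right_half_plane"
        by (intro holomorphic_intros hardy_space_D f ghol)
      show "connected right_half_plane"
        unfolding right_half_plane_def by (intro convex_connected convex_halfspace_Re_gt)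
      show "L islimpt range l" unfolding islimpt_sequential using lim by (intro exI[of _ l]) auto
      fix z assume "z \<in> range l"
      then obtain j where j: "z = l j" by auto
      have "eventually (\<lambda>N. S N (l j) = f (l j)) sequentially"
        using eventually_gt_at_top[of j] by eventually_elim (auto simp: S_def A)
      hence "(\<lambda>N. S N (l j)) \<longlonglongrightarrow> f (l j)" by (rule tendsto_eventually)
      from LIMSEQ_unique[OF this glim[OF l]] show "f z - g z = 0" by (simp add: j)
    next
      show "open right_half_plane" by (rule open_right_half_plane)
      show "range l \<subseteq> right_half_plane" using l by (auto simp: right_half_plane_def)
      show "L \<in> right_half_plane" "w \<in> right_half_plane"
        using lim(3) w by (simp_all add: right_half_plane_def)
    qed
    thus ?thesis by simp
  qed
  \<comment> \<open>Fatou's lemma bounds the distance on each line\<close>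
  define h where "h N = (\<Sum>j<N. fun_scale (A N j) (hkernel (l j)))" for N
  have hS: "h N z = S N z" if "Re z > 0" for N z
    using that by (simp add: h_def sum_fun_apply fun_scale_def S_def ksum_def hkernel_def right_half_plane_def)
  have hspan: "h N \<in> cfun.span (range (\<lambda>n. hkernel (l n)))" for N
    unfolding h_def by (intro cfun.span_sum cfun.span_scale cfun.span_base) auto
  have XH: "range (\<lambda>n. hkernel (l n)) \<subseteq> hardy_space" using l by (auto intro: hkernel_hardy_space)
  have hH: "f - h N \<in> hardy_space" for N
    using f hspan[of N] span_hardy[OF XH] by (intro hardy_space_diff) auto
  have dist: "hardy_norm (f - h N) \<le> sqrt (\<sigma> - s N)" for N
  proof (rule hardy_spaceI(2))
    fix x :: real assume x: "x > 0"
    show "line (f - h N) x \<in> L2" by (rule hardy_line[OF hH x])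
    have "(\<integral>\<^sup>+ y. ennreal ((cmod (line (f - h N) x y))\<^sup>2) \<partial>lborel)
        = (\<integral>\<^sup>+ y. liminf (\<lambda>M. ennreal ((cmod (line (D N (N + M)) x y))\<^sup>2)) \<partial>lborel)"
    proof (rule nn_integral_cong)
      fix y
      have "(\<lambda>M. S (M + N) (Complex x y)) \<longlonglongrightarrow> f (Complex x y)"
        using glim[of "Complex x y"] x fg by (intro LIMSEQ_ignore_initial_segment) auto
      hence "(\<lambda>M. ennreal ((cmod (S (M + N) (Complex x y) - S N (Complex x y)))\<^sup>2)) \<longlonglongrightarrow>
          ennreal ((cmod (f (Complex x y) - S N (Complex x y)))\<^sup>2)"
        by (intro tendsto_intros)
      from lim_imp_Liminf[OF sequentially_bot this] show "ennreal ((cmod (line (f - h N) x y))\<^sup>2) = liminf (\<lambda>M. ennreal ((cmod (line (D N (N + M)) x y))\<^sup>2))"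
        using x by (simp add: line_def D hS add.commute)
    qed
    also have "\<dots> \<le> liminf (\<lambda>M. \<integral>\<^sup>+ y. ennreal ((cmod (line (D N (N + M)) x y))\<^sup>2) \<partial>lborel)"
    proof (rule nn_integral_liminf)
      fix M
      have "line (D N (N + M)) x \<in> L2" unfolding D_def using l x by (intro ksum_L2) auto
      from L2_D[OF this] show "(\<lambda>y. ennreal ((cmod (line (D N (N + M)) x y))\<^sup>2)) \<in> borel_measurable lborel"
        by simp
    qed
    also have "\<dots> \<le> liminf (\<lambda>M. ennreal (\<sigma> - s N))"
    proof (intro Liminf_mono always_eventually allI)
      fix M
      have "normsq (line (D N (N + M)) x) \<le> normsq (line (D N (N + M)) 0)"
        unfolding D_def using l x by (intro normsq_ksum_le) auto
      also have "\<dots> \<le> \<sigma> - s N" using \<sigma>(2) by (simp add: nD)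
      finally show "(\<integral>\<^sup>+ y. ennreal ((cmod (line (D N (N + M)) x y))\<^sup>2) \<partial>lborel) \<le> ennreal (\<sigma> - s N)"
        using l x unfolding D_def by (subst nn_integral_normsq) (auto intro!: ksum_L2 ennreal_leI)
    qed
    also have "\<dots> = ennreal ((sqrt (\<sigma> - s N))\<^sup>2)"
      using \<sigma>(2)[of N] by (simp add: Liminf_const)
    finally show "normsq (line (f - h N) x) \<le> (sqrt (\<sigma> - s N))\<^sup>2"
      using \<sigma>(2)[of N] by (subst (asm) nn_integral_normsq[OF hardy_line(1)[OF hH x]]) simp
  qed (use \<sigma>(2)[of N] hardy_space_D[OF hH] in auto)
  have "\<exists>h\<in>cfun.span (range (\<lambda>n. hkernel (l n))). hardy_norm (f - h) < \<epsilon>" if "\<epsilon> > 0" for \<epsilon>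
  proof -
    have "\<epsilon>\<^sup>2 > 0" using that by simp
    then obtain N where "\<sigma> - s N < \<epsilon>\<^sup>2" using small by blast
    hence "sqrt (\<sigma> - s N) < \<epsilon>" using that by (simp add: real_less_lsqrt)
    thus ?thesis using dist[of N] hspan[of N] by (intro bexI[of _ "h N"]) auto
  qed
  thus "f \<in> hclosure (range (\<lambda>n. hkernel (l n)))" using f by (simp add: hclosure_def)
qed

section \<open>The cyclic cases\<close>

lemma norm_sq_blaschke_factor:
  assumes "Re w > 0" "Re p > 0"
  shows "(cmod ((w - p) / (w + cnj p)))\<^sup>2 = 1 - 4 * Re w * Re p / (cmod (w + cnj p))\<^sup>2"
proof -
  have "(cmod (w + cnj p))\<^sup>2 \<noteq> 0" using assms by (auto simp: complex_eq_iff)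
  moreover have "(cmod (w - p))\<^sup>2 = (cmod (w + cnj p))\<^sup>2 - 4 * Re w * Re p"
    unfolding cmod_power2 by (simp add: power2_eq_square algebra_simps)
  ultimately show ?thesis unfolding norm_divide power_divide by (simp add: diff_divide_distrib)
qed

text \<open>
  The squared modulus of the \<open>j\<close>-th factor is at most \<open>1 - c / (j + 1) \<le> exp (- c / (j + 1))\<close>, and
  the harmonic series diverges.
\<close>

lemma blaschke_tendsto_0:
  assumes l: "\<And>j. Re (l j) > 0" and w: "Re w > 0" and c: "c > 0"
    and le: "\<And>j. c / real (Suc j) \<le> 4 * Re w * Re (l j) / (cmod (w + cnj (l j)))\<^sup>2"
  shows "(\<lambda>n. blaschke l n w) \<longlonglongrightarrow> 0"
proof -
  have bound: "(cmod (blaschke l n w))\<^sup>2 \<le> real (Suc n) powr (- c)" for n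
  proof -
    have "(cmod (blaschke l n w))\<^sup>2 = (\<Prod>j<n. (cmod ((w - l j) / (w + cnj (l j))))\<^sup>2)"
      by (simp add: blaschke_def prod_norm[symmetric] prod_power_distrib)
    also have "\<dots> \<le> (\<Prod>j<n. exp (- (c / real (Suc j))))"
    proof (intro prod_mono conjI zero_le_power2)
      fix j
      have "(cmod ((w - l j) / (w + cnj (l j))))\<^sup>2 \<le> 1 - c / real (Suc j)"
        unfolding norm_sq_blaschke_factor[OF w l] using le[of j] by simp
      also have "\<dots> \<le> exp (- (c / real (Suc j)))"
        using exp_ge_add_one_self[of "- (c / real (Suc j))"] by simp
      finally show "(cmod ((w - l j) / (w + cnj (l j))))\<^sup>2 \<le> exp (- (c / real (Suc j)))" .
    qed
    also have "\<dots> = exp (\<Sum>j<n. - (c / real (Suc j)))"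
      by (rule exp_sum[symmetric]) simp
    also have "(\<Sum>j<n. - (c / real (Suc j))) = - c * harm n"
      unfolding harm_altdef sum_distrib_left by (simp only: divide_inverse mult_minus_left)
    also have "exp (- c * harm n) \<le> exp (- c * ln (real n + 1))"
      using ln_le_harm[of n] c by simp
    also have "\<dots> = real (Suc n) powr (- c)" by (simp add: powr_def add.commute)
    finally show ?thesis .
  qed
  have "(\<lambda>n. real (Suc n) powr (- c)) \<longlonglongrightarrow> 0"
    using c by (intro tendsto_neg_powr filterlim_compose[OF filterlim_real_sequentially filterlim_Suc]) auto
  hence "(\<lambda>n. (cmod (blaschke l n w))\<^sup>2) \<longlonglongrightarrow> 0"
    by (rule tendsto_sandwich[OF _ _ tendsto_const, rotated -1]) (use bound in auto)
  hence "(\<lambda>n. sqrt ((cmod (blaschke l n w))\<^sup>2)) \<longlonglongrightarrow> sqrt 0"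
    by (intro tendsto_intros)
  thus ?thesis by (simp add: tendsto_norm_zero_iff)
qed

text \<open>
  The partial fraction identity exhibits \<open>cnj (B\<^sub>n(w)) B\<^sub>n k\<^sub>w\<close> as the difference of \<open>k\<^sub>w\<close> and an element
  of the span. Since \<open>\<bar>B\<^sub>n\<bar> \<le> 1\<close> in the half-plane, its norm is at most \<open>\<bar>B\<^sub>n(w)\<bar>\<close> times that of
  \<open>k\<^sub>w\<close>.
\<close>

lemma hkernel_in_hclosure:
  assumes l: "\<And>j. Re (l j) > 0" and inj: "inj (l :: nat \<Rightarrow> complex)" and w: "Re w > 0"
    and lim: "(\<lambda>n. blaschke l n w) \<longlonglongrightarrow> 0"
  shows "hkernel w \<in> hclosure (range (\<lambda>n. hkernel (l n)))"
proof (cases "w \<in> range l")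
  case True
  then obtain n where "w = l n" by auto
  hence "hkernel w \<in> cfun.span (range (\<lambda>n. hkernel (l n)))" by (intro cfun.span_base) auto
  moreover have "range (\<lambda>n. hkernel (l n)) \<subseteq> hardy_space" using l by (auto intro: hkernel_hardy_space)
  ultimately show ?thesis using span_subset_hclosure by (meson subsetD)
next
  case False
  let ?X = "range (\<lambda>n. hkernel (l n))"
  have XH: "?X \<subseteq> hardy_space" using l by (auto intro: hkernel_hardy_space)
  have "\<exists>h\<in>cfun.span ?X. hardy_norm (hkernel w - h) < \<epsilon>" if \<epsilon>: "\<epsilon> > 0" for \<epsilon>
  proof -
    define K where "K = sqrt (pi / Re w)"
    have K: "K > 0" using w by (simp add: K_def)
    have "eventually (\<lambda>n. dist (blaschke l n w) 0 < \<epsilon> / K) sequentially"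
      by (rule tendstoD[OF lim]) (use \<epsilon> K in simp)
    then obtain n where n: "cmod (blaschke l n w) < \<epsilon> / K"
      by (auto simp: eventually_sequentially)
    obtain e where e: "\<And>z. Re z \<ge> 0 \<Longrightarrow>
       cnj (blaschke l n w) * blaschke l n z * kernel w z = kernel w z + ksum e l {..<n} z"
      using blaschke_kernel_partial_fractions[of n l w] l w inj False by (auto intro: inj_on_subset)
    define h where "h = (\<Sum>j<n. fun_scale (- e j) (hkernel (l j)))"
    have hs: "h \<in> cfun.span ?X"
      unfolding h_def by (intro cfun.span_sum cfun.span_scale cfun.span_base) auto
    have H: "hkernel w - h \<in> hardy_space"
      using hs span_hardy[OF XH] w by (intro hardy_space_diff hkernel_hardy_space) auto
    have val: "(hkernel w - h) z = cnj (blaschke l n w) * blaschke l n z * kernel w z" if "Re z > 0" for z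
      using that e[of z] by (simp add: h_def sum_fun_apply fun_scale_def ksum_def hkernel_def right_half_plane_def sum_negf)
    have "hardy_norm (hkernel w - h) \<le> cmod (blaschke l n w) * K"
    proof (rule hardy_spaceI(2))
      fix x :: real assume x: "x > 0"
      show L: "line (hkernel w - h) x \<in> L2" by (rule hardy_line[OF H x])
      have k: "line (kernel w) x \<in> L2" "normsq (line (kernel w) x) = pi / (Re w + x)"
        using line_kernel_L2[of w x] w x by auto
      have "normsq (line (hkernel w - h) x) \<le> normsq (\<lambda>y. blaschke l n w * line (kernel w) x y)"
      proof (rule normsq_mono[OF L2_scale[OF k(1)] L])
        fix y
        have "cmod (line (hkernel w - h) x y) = cmod (blaschke l n w) * cmod (kernel w (Complex x y)) * cmod (blaschke l n (Complex x y))"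
          using x by (simp add: line_def val norm_mult del: minus_apply fun_diff_def)
        also have "\<dots> \<le> cmod (blaschke l n w) * cmod (kernel w (Complex x y)) * 1"
          using l x by (intro mult_left_mono norm_blaschke_le_1) auto
        finally show "cmod (line (hkernel w - h) x y) \<le> cmod (blaschke l n w * line (kernel w) x y)"
          by (simp add: line_def norm_mult)
      qed
      also have "\<dots> = (cmod (blaschke l n w))\<^sup>2 * (pi / (Re w + x))"
        using k(2) by (simp add: normsq_def norm_mult power_mult_distrib)
      also have "\<dots> \<le> (cmod (blaschke l n w))\<^sup>2 * (pi / Re w)"
        using w x by (intro mult_left_mono divide_left_mono) auto
      also have "\<dots> = (cmod (blaschke l n w) * K)\<^sup>2"
        using w by (simp add: K_def power_mult_distrib)
      finally show "normsq (line (hkernel w - h) x) \<le> (cmod (blaschke l n w) * K)\<^sup>2" .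
    qed (use hardy_space_D[OF H] K in auto)
    also have "\<dots> < \<epsilon>" using n K by (simp add: pos_less_divide_eq)
    finally show ?thesis using hs by blast
  qed
  thus ?thesis using w by (simp add: hclosure_def hkernel_hardy_space)
qed

lemma comp_op_hkernel:
  assumes a: "a > 0" and b: "Re b \<ge> 0"
  shows "comp_op (\<lambda>w. of_real a * w + b) (hkernel m) = fun_scale (1 / of_real a) (hkernel ((m + cnj b) / of_real a))"
proof
  fix w
  show "comp_op (\<lambda>w. of_real a * w + b) (hkernel m) w = fun_scale (1 / of_real a) (hkernel ((m + cnj b) / of_real a)) w"
  proof (cases "w \<in> right_half_plane")
    case True
    hence "of_real a * w + b \<in> right_half_plane"
      using a b by (auto simp: right_half_plane_def intro!: add_pos_nonneg)
    moreover have "of_real a * (w + cnj ((m + cnj b) / of_real a)) = of_real a * w + b + cnj m"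
      using a by (simp add: field_simps)
    ultimately show ?thesis using True
      by (simp add: comp_op_def fun_scale_def hkernel_def kernel_def divide_divide_eq_left' mult.commute)
  qed (simp add: comp_op_def fun_scale_def hkernel_def)
qed

lemma comp_op_scale: "comp_op \<phi> (fun_scale c f) = fun_scale c (comp_op \<phi> f)"
  by (auto simp: comp_op_def fun_scale_def fun_eq_iff)

lemma cyclic_if_kernel_orbit_dense:
  assumes a: "a > 0" and b: "Re b \<ge> 0" and l0: "Re (l 0) > 0"
    and l: "\<And>n. l (Suc n) = (l n + cnj b) / of_real a"
    and dense: "hardy_space \<subseteq> hclosure (range (\<lambda>n. hkernel (l n)))"
  shows "cyclic_on_hardy (comp_op (\<lambda>w. of_real a * w + b))"
proof -
  let ?T = "comp_op (\<lambda>w. of_real a * w + b)"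
  have it: "(?T ^^ n) (hkernel (l 0)) = fun_scale (1 / of_real a ^ n) (hkernel (l n))" for n
  proof (induction n)
    case (Suc n)
    show ?case
      unfolding funpow.simps o_apply Suc.IH comp_op_scale comp_op_hkernel[OF a b] l[symmetric]
      by (simp add: fun_scale_def fun_eq_iff)
  qed (simp add: fun_scale_def)
  have "hkernel (l n) \<in> cfun.span (orbit ?T (hkernel (l 0)))" for n
  proof -
    have "fun_scale (of_real a ^ n) ((?T ^^ n) (hkernel (l 0))) \<in> cfun.span (orbit ?T (hkernel (l 0)))"
      by (intro cfun.span_scale cfun.span_base) (auto simp: orbit_def)
    also have "fun_scale (of_real a ^ n) ((?T ^^ n) (hkernel (l 0))) = hkernel (l n)"
      using a by (simp add: it fun_scale_def)
    finally show ?thesis .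
  qed
  hence "hclosure (range (\<lambda>n. hkernel (l n))) \<subseteq> hclosure (orbit ?T (hkernel (l 0)))"
    by (intro hclosure_mono) auto
  thus ?thesis using dense hkernel_hardy_space[OF l0] by (auto simp: cyclic_iff_hclosure)
qed

text \<open>
  The kernel orbit starting at twice the limit point \<open>L = cnj b / (a - 1)\<close> runs through the points
  \<open>L (1 + a\<^bsup>-n\<^esup>)\<close>.
\<close>

theorem cyclic_type_II:
  assumes a: "a > 1" and b: "Re b > 0"
  shows "cyclic_on_hardy (comp_op (\<lambda>w. of_real a * w + b))"
proof -
  define L where "L = cnj b / (of_real a - 1)"
  define l where "l n = L * of_real (1 + (1 / a) ^ n)" for n
  have ReL: "Re L > 0" "L \<noteq> 0"
  proof -
    have "L = cnj b / of_real (a - 1)" by (simp add: L_def)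
    thus "Re L > 0" using a b by simp
    thus "L \<noteq> 0" by auto
  qed
  have rl: "Re (l n) > 0" for n
    using ReL a by (simp add: l_def mult_pos_pos add_pos_pos del: of_real_add of_real_power)
  have "(\<lambda>n. (1 / a) ^ n) \<longlonglongrightarrow> 0" using a by (intro LIMSEQ_realpow_zero) auto
  hence "l \<longlonglongrightarrow> L * of_real (1 + 0)"
    unfolding l_def by (intro tendsto_mult tendsto_of_real tendsto_add tendsto_const)
  hence lim: "l \<longlonglongrightarrow> L" by simp
  have "inj l"
  proof (rule injI)
    fix m n assume "l m = l n"
    hence "(1 / a) ^ m = (1 / a) ^ n" using ReL by (simp add: l_def del: of_real_add of_real_power)
    thus "m = n" using a by (simp add: power_one_over power_inject_exp)
  qed
  have ne: "l n \<noteq> L" for n using ReL a by (simp add: l_def)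
  have step: "l (Suc n) = (l n + cnj b) / of_real a" for n
  proof -
    define q where "q = complex_of_real ((1 / a) ^ n)"
    have "l (Suc n) = L * (1 + q / of_real a)" by (simp add: l_def q_def)
    moreover have "l n + cnj b = L * (1 + q) + L * (of_real a - 1)"
      using a by (simp add: l_def q_def L_def)
    ultimately show ?thesis using a by (simp add: field_simps)
  qed
  show ?thesis
    using a b rl[of 0] step kernels_dense[OF rl \<open>inj l\<close> lim ne ReL(1)]
    by (intro cyclic_if_kernel_orbit_dense[of a b l]) auto
qed

text \<open>
  The kernel orbit starting at \<open>cnj b\<close> runs through the positive integer multiples of \<open>cnj b\<close>. It has
  no limit point in the half-plane, but it violates the Blaschke condition at a harmonic rate.
\<close>

theorem cyclic_parabolic:
  assumes b: "Re b > 0"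
  shows "cyclic_on_hardy (comp_op (\<lambda>w. of_real 1 * w + b))"
proof -
  define l where "l n = of_nat (Suc n) * cnj b" for n
  have b0: "b \<noteq> 0" using b by auto
  have rl: "Re (l n) > 0" for n unfolding l_def using b by (simp del: of_nat_Suc)
  have injl: "inj l" using b0 by (auto simp: l_def inj_def simp del: of_nat_Suc)
  have X: "range (\<lambda>n. hkernel (l n)) \<subseteq> hardy_space" using rl by (auto intro: hkernel_hardy_space)
  have mem: "hkernel w \<in> hclosure (range (\<lambda>n. hkernel (l n)))" if w: "Re w > 0" for w
  proof (rule hkernel_in_hclosure[OF rl injl w])
    define K where "K = cmod w + cmod b"
    have K: "K > 0" unfolding K_def using b0 by (simp add: add_nonneg_pos)
    show "(\<lambda>n. blaschke l n w) \<longlonglongrightarrow> 0"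
    proof (rule blaschke_tendsto_0[OF rl w])
      show "4 * Re w * Re b / K\<^sup>2 > 0" using w b K by simp
      fix j
      have "cmod (w + cnj (l j)) \<le> cmod w + real (Suc j) * cmod b"
        using norm_triangle_ineq[of w "cnj (l j)"] by (simp add: l_def norm_mult del: of_nat_Suc)
      also have "\<dots> \<le> real (Suc j) * K"
        by (simp add: K_def algebra_simps)
      finally have "(cmod (w + cnj (l j)))\<^sup>2 \<le> (real (Suc j) * K)\<^sup>2"
        by (intro power_mono) auto
      moreover have "0 < (cmod (w + cnj (l j)))\<^sup>2"
        using w rl[of j] by (auto simp: complex_eq_iff)
      ultimately have "4 * Re w * Re (l j) / (real (Suc j) * K)\<^sup>2 \<le> 4 * Re w * Re (l j) / (cmod (w + cnj (l j)))\<^sup>2"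
        using w rl[of j] K by (intro divide_left_mono mult_pos_pos) auto
      moreover have "4 * Re w * Re (l j) / (real (Suc j) * K)\<^sup>2 = 4 * Re w * Re b / K\<^sup>2 / real (Suc j)"
        using K by (simp add: l_def power2_eq_square field_simps del: of_nat_Suc)
      ultimately show "4 * Re w * Re b / K\<^sup>2 / real (Suc j) \<le> 4 * Re w * Re (l j) / (cmod (w + cnj (l j)))\<^sup>2"
        by simp
    qed
  qed
  \<comment> \<open>any sequence of distinct points with an interior limit will do here\<close>
  define m where "m n = (1 + 1 / of_nat (Suc n) :: complex)" for n
  have rm: "Re (m n) > 0" for n
  proof -
    have "m n = of_real (1 + 1 / real (Suc n))" by (simp add: m_def)
    thus ?thesis by (simp add: add_pos_pos del: of_real_add)
  qed
  have "(\<lambda>n. 1 / of_nat (Suc n) :: complex) \<longlonglongrightarrow> 0"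
    using LIMSEQ_Suc[OF lim_1_over_n] by simp
  hence "m \<longlonglongrightarrow> 1 + 0" unfolding m_def by (intro tendsto_intros)
  hence "hardy_space \<subseteq> hclosure (range (\<lambda>n. hkernel (m n)))"
    by (intro kernels_dense[of m 1] rm) (auto simp: m_def inj_def simp del: of_nat_Suc)
  also have "\<dots> \<subseteq> hclosure (range (\<lambda>n. hkernel (l n)))"
    using mem rm by (intro hclosure_idem[OF X]) auto
  finally show ?thesis
    using b rl[of 0] by (intro cyclic_if_kernel_orbit_dense[of 1 b l]) (auto simp: l_def algebra_simps)
qed

section \<open>Dilations towards an interior fixed point\<close>

lemma hardy_pointwise:
  assumes f: "f \<in> hardy_space" and w: "Re w > 0"
  shows "cmod (f w) \<le> hardy_norm f / sqrt (Re w)"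
proof -
  define x where "x = Re w / 2"
  have x: "x > 0" "Re (w - of_real x) > 0" "Re (w - of_real x) = x" using w by (auto simp: x_def)
  have "(cmod (2 * pi * f w))\<^sup>2 \<le> normsq (line f x) * normsq (line (kernel (w - of_real x)) 0)"
    using inner2_Cauchy_Schwarz[OF hardy_line(1)[OF f x(1)] line_kernel_L2(1)[of "w - of_real x" 0]]
      inner2_line_kernel[OF f x(1,2)] x by simp
  also have "normsq (line (kernel (w - of_real x)) 0) = pi / x"
    using line_kernel_L2(2)[of "w - of_real x" 0] x by simp
  also have "normsq (line f x) * (pi / x) \<le> (hardy_norm f)\<^sup>2 * (pi / x)"
    using hardy_line(2)[OF f x(1)] x by (intro mult_right_mono) auto
  finally have "4 * pi\<^sup>2 * (cmod (f w))\<^sup>2 \<le> 2 * pi * (hardy_norm f)\<^sup>2 / Re w"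
    by (simp add: norm_mult power_mult_distrib x_def mult_ac)
  hence "2 * pi * (cmod (f w))\<^sup>2 \<le> (hardy_norm f)\<^sup>2 / Re w"
    using w by (simp add: power2_eq_square field_simps)
  moreover have "1 * (cmod (f w))\<^sup>2 \<le> 2 * pi * (cmod (f w))\<^sup>2"
    using pi_gt3 by (intro mult_right_mono) auto
  ultimately have "(cmod (f w))\<^sup>2 \<le> (hardy_norm f / sqrt (Re w))\<^sup>2"
    using w by (simp add: power_divide)
  thus ?thesis
    by (rule power2_le_imp_le) (use w in \<open>simp add: hardy_norm_nonneg\<close>)
qed

text \<open>
  The power \<open>u\<^bsup>\<nu>-1\<^esup>\<close> cut off to \<open>u > 0\<close>, so that integrals over the half-line become integrals over
  \<open>\<real>\<close>.
\<close>

definition cutpow :: "complex \<Rightarrow> real \<Rightarrow> complex" where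
  "cutpow \<nu> u = indicator {0<..} u *\<^sub>R (of_real u powr (\<nu> - 1))"

lemma cutpow_measurable:
  assumes "continuous_on {0<..} h"
  shows "(\<lambda>u. cutpow \<nu> u * h u) \<in> borel_measurable borel"
proof -
  have "(\<lambda>u. indicator {0<..} u *\<^sub>R (complex_of_real u powr (\<nu> - 1) * h u)) \<in> borel_measurable borel"
    using assms by (intro borel_measurable_continuous_on_indicator continuous_intros) auto
  thus ?thesis by (simp add: cutpow_def)
qed

lemma norm_cutpow: "cmod (cutpow \<nu> u) = indicator {0<..} u * u powr (Re \<nu> - 1)"
  by (auto simp: cutpow_def indicator_def norm_powr_real_powr)

lemma cutpow_mult:
  assumes "t > 0" shows "cutpow \<nu> (t * u) = of_real t powr (\<nu> - 1) * cutpow \<nu> u"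
  using assms by (auto simp: cutpow_def indicator_def zero_less_mult_iff powr_times_real)

lemma cutpow_gamma_integral:
  assumes \<nu>: "Re \<nu> > 0" and t: "t > 0"
  shows "integrable lborel (\<lambda>u. cutpow \<nu> u * of_real (exp (- (t * u))))"
    "(\<integral>u. cutpow \<nu> u * of_real (exp (- (t * u))) \<partial>lborel) = Gamma \<nu> * of_real t powr (- \<nu>)"
proof -
  have int: "integrable lborel (\<lambda>u. cutpow \<nu> u * of_real (exp (- (t * u))))" if t: "t > 0" for t
  proof -
    have meas: "(\<lambda>u. cutpow \<nu> u * of_real (exp (- (t * u)))) \<in> borel_measurable lborel"
      using cutpow_measurable[of "\<lambda>u. of_real (exp (- (t * u)))" \<nu>] by (simp add: continuous_intros)
    have "integrable lebesgue (\<lambda>u. cutpow \<nu> u * of_real (exp (- (t * u))))"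
      using absolutely_integrable_Gamma_integral[OF \<nu> t]
      by (simp add: set_integrable_def cutpow_def exp_minus divide_inverse of_real_exp)
    thus ?thesis using integrable_completion[OF meas] by simp
  qed
  show "integrable lborel (\<lambda>u. cutpow \<nu> u * of_real (exp (- (t * u))))" by (rule int[OF t])
  have "Gamma \<nu> = (\<integral>u. cutpow \<nu> u * of_real (exp (- u)) \<partial>lborel)"
  proof -
    have "set_integrable lborel {0<..} (\<lambda>t. complex_of_real t powr (\<nu> - 1) / of_real (exp t))"
      using int[of 1] by (simp add: set_integrable_def cutpow_def exp_minus divide_inverse of_real_exp)
    from set_borel_integral_eq_integral(2)[OF this] integral_unique[OF Gamma_integral_complex'[OF \<nu>]]
    show ?thesis by (simp add: set_lebesgue_integral_def cutpow_def exp_minus divide_inverse of_real_exp)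
  qed
  also have "\<dots> = t *\<^sub>R (\<integral>u. cutpow \<nu> (t * u) * of_real (exp (- (t * u))) \<partial>lborel)"
    using lborel_integral_real_affine[of t "\<lambda>u. cutpow \<nu> u * of_real (exp (- u))" 0] t by simp
  also have "\<dots> = (of_real t * of_real t powr (\<nu> - 1)) * (\<integral>u. cutpow \<nu> u * of_real (exp (- (t * u))) \<partial>lborel)"
    using t by (simp add: cutpow_mult scaleR_conv_of_real mult.assoc)
  also have "of_real t * complex_of_real t powr (\<nu> - 1) = of_real t powr \<nu>"
    using t by (simp add: powr_diff)
  finally show "(\<integral>u. cutpow \<nu> u * of_real (exp (- (t * u))) \<partial>lborel) = Gamma \<nu> * of_real t powr (- \<nu>)"
    using t by (simp add: powr_minus field_simps)
qed

text \<open>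
  Up to a constant an integrable majorant of \<open>u\<^bsup>-3/4\<^esup> / sqrt (r + u)\<close> on the half-line.
\<close>

definition powmaj :: "real \<Rightarrow> real" where
  "powmaj u = indicator {0..1} u * u powr (-3/4) + indicator {1..} u * u powr (-5/4)"

lemma integrable_powmaj: "integrable lborel powmaj"
proof -
  have A: "integrable lborel (\<lambda>u::real. indicator S u * u powr e)"
    if "(\<lambda>u::real. u powr e) integrable_on S" "S \<in> sets borel" for S e
  proof -
    have "(\<lambda>u::real. u powr e) absolutely_integrable_on S"
      using that by (intro nonnegative_absolutely_integrable_1) auto
    moreover have "(\<lambda>u::real. indicator S u * u powr e) \<in> borel_measurable lborel"
      using that(2) by measurable
    ultimately show ?thesis using integrable_completion[of "\<lambda>u. indicator S u * u powr e" lborel]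
      by (simp add: set_integrable_def)
  qed
  have "(\<lambda>u::real. u powr (-3/4)) integrable_on {0..1}"
    by (rule integrable_on_powr_from_0) auto
  moreover have "(\<lambda>u::real. u powr (-5/4)) integrable_on {1..}"
    using has_integral_powr_to_inf[of "-5/4" 1] by (auto simp: integrable_on_def)
  ultimately show ?thesis unfolding powmaj_def by (intro Bochner_Integration.integrable_add A) auto
qed

text \<open>
  With \<open>Re \<nu> = 1/4\<close> the integrand is of size \<open>u\<^bsup>-3/4\<^esup>\<close> near \<open>0\<close> and \<open>u\<^bsup>-5/4\<^esup>\<close> near infinity. Any real
  part strictly between \<open>0\<close> and \<open>1/2\<close> would serve the same purpose.
\<close>

lemma cutpow_integrable:
  assumes \<nu>: "Re \<nu> = 1/4" and h: "continuous_on {0<..} h" and r: "r > 0"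
    and le: "\<And>u. u > 0 \<Longrightarrow> cmod (h u) \<le> C / sqrt (r + u)" and C: "C \<ge> 0"
  shows "integrable lborel (\<lambda>u. cutpow \<nu> u * h u)"
    "cmod (\<integral>u. cutpow \<nu> u * h u \<partial>lborel) \<le> C * ((1 + 1 / sqrt r) * (\<integral>u. powmaj u \<partial>lborel))"
proof -
  let ?K = "C * (1 + 1 / sqrt r)"
  have K: "?K \<ge> 0" "1 + 1 / sqrt r \<ge> 0" using C r by auto
  have bound: "cmod (cutpow \<nu> u * h u) \<le> ?K * powmaj u" for u
  proof (cases "u > 0")
    case True
    have p: "cmod (cutpow \<nu> u) = u powr (-3/4)" 
    proof -
      have "Re \<nu> - 1 = -3/4" using \<nu> by simp
      thus ?thesis using True unfolding norm_cutpow by simp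
    qed
    have hu: "cmod (h u) \<le> C * (1 / sqrt (r + u))" using le[OF True] by simp
    have "cmod (cutpow \<nu> u * h u) \<le> C * (u powr (-3/4) * (1 / sqrt (r + u)))"
      unfolding norm_mult p using mult_left_mono[OF hu, of "u powr (-3/4)"] by (simp add: mult_ac)
    also have "u powr (-3/4) * (1 / sqrt (r + u)) \<le> (1 + 1 / sqrt r) * powmaj u"
    proof (cases "u \<le> 1")
      case True
      have "1 / sqrt (r + u) \<le> 1 / sqrt r" using r \<open>u > 0\<close> by (intro divide_left_mono mult_pos_pos) auto
      hence "u powr (-3/4) * (1 / sqrt (r + u)) \<le> u powr (-3/4) * (1 + 1 / sqrt r)"
        by (intro mult_left_mono) auto
      also have "\<dots> \<le> powmaj u * (1 + 1 / sqrt r)"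
        using True \<open>u > 0\<close> r by (intro mult_right_mono) (auto simp: powmaj_def indicator_def)
      finally show ?thesis by (simp add: mult.commute)
    next
      case False
      have "1 / sqrt (r + u) \<le> 1 / sqrt u" using r \<open>u > 0\<close> by (intro divide_left_mono mult_pos_pos) auto
      also have "1 / sqrt u = u powr (-1/2)"
        using \<open>u > 0\<close> by (simp add: powr_half_sqrt[symmetric] powr_minus_divide)
      finally have "u powr (-3/4) * (1 / sqrt (r + u)) \<le> u powr (-3/4) * u powr (-1/2)"
        by (intro mult_left_mono) auto
      also have "\<dots> = powmaj u" using False by (simp add: powmaj_def powr_add[symmetric])
      also have "\<dots> \<le> (1 + 1 / sqrt r) * powmaj u"
        using r by (simp add: powmaj_def algebra_simps)
      finally show ?thesis .
    qed
    finally show ?thesis using C by (simp add: mult.assoc mult_left_mono)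
  next
    case False
    hence "cutpow \<nu> u = 0" by (simp add: cutpow_def)
    moreover have "powmaj u \<ge> 0" by (simp add: powmaj_def)
    ultimately show ?thesis using K by simp
  qed
  show int: "integrable lborel (\<lambda>u. cutpow \<nu> u * h u)"
  proof (rule Bochner_Integration.integrable_bound)
    show "integrable lborel (\<lambda>u. ?K * powmaj u)" using integrable_powmaj by simp
    show "(\<lambda>u. cutpow \<nu> u * h u) \<in> borel_measurable lborel" using cutpow_measurable[OF h] by simp
    show "AE u in lborel. norm (cutpow \<nu> u * h u) \<le> norm (?K * powmaj u)"
      unfolding real_norm_def by (intro AE_I2 order_trans[OF bound abs_ge_self])
  qed
  have "cmod (\<integral>u. cutpow \<nu> u * h u \<partial>lborel) \<le> (\<integral>u. cmod (cutpow \<nu> u * h u) \<partial>lborel)"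
    by (rule integral_norm_bound)
  also have "\<dots> \<le> (\<integral>u. ?K * powmaj u \<partial>lborel)"
    using int integrable_powmaj bound by (intro integral_mono) auto
  finally show "cmod (\<integral>u. cutpow \<nu> u * h u \<partial>lborel) \<le> C * ((1 + 1 / sqrt r) * (\<integral>u. powmaj u \<partial>lborel))"
    by (simp add: mult.assoc)
qed

text \<open>
  Write \<open>1 / (u + d)\<close> as the integral of \<open>exp (- (u + d) t)\<close> over \<open>t > 0\<close> and exchange the
  integrations; both inner integrals are then Gamma integrals. The point is that the value is
  nonzero.
\<close>

lemma stieltjes_power:
  assumes \<nu>: "Re \<nu> = 1/4" and d: "d > 0"
  shows "(\<integral>u. cutpow \<nu> u * (1 / of_real (u + d)) \<partial>lborel) = Gamma \<nu> * Gamma (1 - \<nu>) * of_real d powr (\<nu> - 1)"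
proof -
  define E where "E u t = cutpow 1 t * complex_of_real (exp (- ((u + d) * t)))" for u t
  have Eint: "integrable lborel (E u)" "(\<integral>t. E u t \<partial>lborel) = 1 / of_real (u + d)" if "u > 0" for u
    using cutpow_gamma_integral[of 1 "u + d"] that d
    by (auto simp: E_def[abs_def] powr_minus_divide simp del: of_real_add)
  have Enorm: "complex_of_real (cmod (E u t)) = E u t" for u t
    by (auto simp: E_def cutpow_def indicator_def norm_mult)
  have stint: "integrable lborel (\<lambda>u. cutpow \<nu> u * (1 / of_real (u + d)))"
  proof (rule cutpow_integrable(1)[OF \<nu> _ d])
    show "continuous_on {0<..} (\<lambda>u. 1 / complex_of_real (u + d))"
      using d by (intro continuous_intros) (auto simp del: of_real_add)
    fix u :: real assume u: "u > 0"
    have "sqrt d * sqrt (d + u) \<le> sqrt (d + u) * sqrt (d + u)"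
      using d u by (intro mult_right_mono) auto
    also have "\<dots> = d + u" using d u by simp
    finally show "cmod (1 / complex_of_real (u + d)) \<le> 1 / sqrt d / sqrt (d + u)"
      using d u by (simp add: norm_divide field_simps del: of_real_add)
  qed (use d in auto)
  define K where "K u t = cutpow \<nu> u * E u t" for u t
  have Kint: "integrable (lborel \<Otimes>\<^sub>M lborel) (\<lambda>(u, t). K u t)"
  proof (rule lborel_pair.Fubini_integrable)
    have "continuous_on ({0<..} \<times> {0<..}) (\<lambda>p. complex_of_real (fst p) powr (\<nu> - 1) * (of_real (snd p) powr (1 - 1) *
        complex_of_real (exp (- ((fst p + d) * snd p)))))"
      by (intro continuous_intros) auto
    hence "(\<lambda>p. indicator ({0<..} \<times> {0<..}) p *\<^sub>R (complex_of_real (fst p) powr (\<nu> - 1) * (of_real (snd p) powr (1 - 1) *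
        complex_of_real (exp (- ((fst p + d) * snd p)))))) \<in> borel_measurable borel"
      by (intro borel_measurable_continuous_on_indicator borel_open open_Times) auto
    also have "(\<lambda>p. indicator ({0<..} \<times> {0<..}) p *\<^sub>R (complex_of_real (fst p) powr (\<nu> - 1) * (of_real (snd p) powr (1 - 1) *
        complex_of_real (exp (- ((fst p + d) * snd p)))))) = (\<lambda>(u, t). K u t)"
      by (auto simp: K_def E_def cutpow_def indicator_def fun_eq_iff)
    finally show "(\<lambda>(u, t). K u t) \<in> borel_measurable (lborel \<Otimes>\<^sub>M lborel)"
      by (simp add: lborel_prod)
    have "(\<integral>t. cmod (K u t) \<partial>lborel) = cmod (cutpow \<nu> u * (1 / of_real (u + d)))" for u
    proof (cases "u > 0")
      case True
      have "complex_of_real (\<integral>t. cmod (E u t) \<partial>lborel) = (\<integral>t. E u t \<partial>lborel)"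
        by (simp only: integral_complex_of_real[symmetric] Enorm)
      also have "\<dots> = of_real (1 / (u + d))" using Eint[OF True] by simp
      finally have "(\<integral>t. cmod (E u t) \<partial>lborel) = 1 / (u + d)" by (simp only: of_real_eq_iff)
      thus ?thesis using True d by (simp add: K_def norm_mult norm_divide del: of_real_add)
    qed (simp add: K_def cutpow_def)
    thus "integrable lborel (\<lambda>u. \<integral>t. norm (case (u, t) of (u, t) \<Rightarrow> K u t) \<partial>lborel)"
      using integrable_norm[OF stint] by simp
    show "AE u in lborel. integrable lborel (\<lambda>t. case (u, t) of (u, t) \<Rightarrow> K u t)"
    proof (rule AE_I2)
      fix u show "integrable lborel (\<lambda>t. case (u, t) of (u, t) \<Rightarrow> K u t)"
        using Eint(1)[of u] by (cases "u > 0") (auto simp: K_def cutpow_def)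
    qed
  qed
  have "(\<integral>u. cutpow \<nu> u * (1 / of_real (u + d)) \<partial>lborel) = (\<integral>u. (\<integral>t. K u t \<partial>lborel) \<partial>lborel)"
  proof (rule Bochner_Integration.integral_cong[OF refl])
    fix u show "cutpow \<nu> u * (1 / of_real (u + d)) = (\<integral>t. K u t \<partial>lborel)"
      using Eint(2)[of u] by (cases "u > 0") (auto simp: K_def cutpow_def)
  qed
  also have "\<dots> = (\<integral>t. (\<integral>u. K u t \<partial>lborel) \<partial>lborel)"
    using lborel_pair.Fubini_integral[OF Kint] by simp
  also have "\<dots> = (\<integral>t. Gamma \<nu> * (cutpow (1 - \<nu>) t * of_real (exp (- (d * t)))) \<partial>lborel)"
  proof (rule Bochner_Integration.integral_cong[OF refl])
    fix t show "(\<integral>u. K u t \<partial>lborel) = Gamma \<nu> * (cutpow (1 - \<nu>) t * of_real (exp (- (d * t))))"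
    proof (cases "t > 0")
      case True
      have "K u t = of_real (exp (- (d * t))) * (cutpow \<nu> u * of_real (exp (- (t * u))))" for u
      proof -
        have "exp (- ((u + d) * t)) = exp (- (d * t)) * exp (- (t * u))"
          by (simp add: exp_add[symmetric] algebra_simps)
        thus ?thesis using True by (simp only: K_def E_def) (simp add: cutpow_def)
      qed
      hence "(\<integral>u. K u t \<partial>lborel) = of_real (exp (- (d * t))) * (Gamma \<nu> * of_real t powr (- \<nu>))"
        using cutpow_gamma_integral[of \<nu> t] \<nu> True by simp
      thus ?thesis using True by (simp add: cutpow_def)
    qed (simp add: K_def E_def cutpow_def)
  qed
  also have "\<dots> = Gamma \<nu> * (Gamma (1 - \<nu>) * of_real d powr (- (1 - \<nu>)))"
    using cutpow_gamma_integral[of "1 - \<nu>" d] \<nu> d by simp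
  finally show ?thesis by simp
qed

text \<open>
  The Mellin transform of \<open>f\<close> along the horizontal ray from \<open>p\<close>; up to a Gamma factor,
  the integral of \<open>f\<close> of fractional order \<open>\<nu>\<close> from \<open>p\<close> to infinity.
\<close>

definition mellin :: "complex \<Rightarrow> complex \<Rightarrow> (complex \<Rightarrow> complex) \<Rightarrow> complex" where
  "mellin p \<nu> f = (\<integral>u. cutpow \<nu> u * f (p + of_real u) \<partial>lborel)"

context
  fixes p \<nu> :: complex
  assumes p: "Re p > 0" and \<nu>: "Re \<nu> = 1/4"
begin

lemma mellin_bound:
  assumes f: "f \<in> hardy_space"
  shows "integrable lborel (\<lambda>u. cutpow \<nu> u * f (p + of_real u))"
    "cmod (mellin p \<nu> f) \<le> hardy_norm f * ((1 + 1 / sqrt (Re p)) * (\<integral>u. powmaj u \<partial>lborel))"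
proof -
  have c: "continuous_on {0<..} (\<lambda>u. f (p + of_real u))"
    using p by (intro continuous_on_compose2[OF hardy_space_D(3)[OF f]] continuous_intros)
      (auto simp: right_half_plane_def)
  have le: "cmod (f (p + of_real u)) \<le> hardy_norm f / sqrt (Re p + u)" if "u > 0" for u
    using hardy_pointwise[OF f, of "p + of_real u"] p that by simp
  show "integrable lborel (\<lambda>u. cutpow \<nu> u * f (p + of_real u))"
    by (rule cutpow_integrable(1)[OF \<nu> c p le hardy_norm_nonneg])
  show "cmod (mellin p \<nu> f) \<le> hardy_norm f * ((1 + 1 / sqrt (Re p)) * (\<integral>u. powmaj u \<partial>lborel))"
    unfolding mellin_def by (rule cutpow_integrable(2)[OF \<nu> c p le hardy_norm_nonneg])
qed

lemma mellin_add:
  "f \<in> hardy_space \<Longrightarrow> g \<in> hardy_space \<Longrightarrow> mellin p \<nu> (f + g) = mellin p \<nu> f + mellin p \<nu> g"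
  using mellin_bound(1) by (simp add: mellin_def distrib_left)

lemma mellin_scale: "mellin p \<nu> (fun_scale c f) = c * mellin p \<nu> f"
  by (simp add: mellin_def fun_scale_def mult.left_commute)

text \<open>
  On the ray from the fixed point the symbol is the dilation \<open>u \<mapsto> a u\<close>, so this is a change of
  variables.
\<close>

lemma mellin_comp_op:
  assumes a: "a > 0" and pfix: "of_real a * p + b = p"
  shows "mellin p \<nu> (comp_op (\<lambda>w. of_real a * w + b) f) = of_real a powr (- \<nu>) * mellin p \<nu> f"
proof -
  have "mellin p \<nu> f = a *\<^sub>R (\<integral>u. cutpow \<nu> (a * u) * f (p + of_real (a * u)) \<partial>lborel)"
    unfolding mellin_def using a lborel_integral_real_affine[of a "\<lambda>u. cutpow \<nu> u * f (p + of_real u)" 0] by simp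
  also have "\<dots> = of_real a * (\<integral>u. of_real a powr (\<nu> - 1) * (cutpow \<nu> u * comp_op (\<lambda>w. of_real a * w + b) f (p + of_real u)) \<partial>lborel)"
    unfolding scaleR_conv_of_real
  proof (rule arg_cong[where f = "\<lambda>z. of_real a * z"], rule Bochner_Integration.integral_cong[OF refl])
    fix u
    show "cutpow \<nu> (a * u) * f (p + of_real (a * u)) =
        of_real a powr (\<nu> - 1) * (cutpow \<nu> u * comp_op (\<lambda>w. of_real a * w + b) f (p + of_real u))"
    proof (cases "u > 0")
      case True
      have "of_real a * (p + of_real u) + b = (of_real a * p + b) + of_real (a * u)"
        by (simp add: algebra_simps)
      hence "of_real a * (p + of_real u) + b = p + of_real (a * u)" using pfix by simp
      thus ?thesis using True p by (simp add: cutpow_mult[OF a] comp_op_def right_half_plane_def)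
    qed (use a in \<open>simp add: cutpow_def zero_less_mult_iff\<close>)
  qed
  also have "\<dots> = (of_real a * of_real a powr (\<nu> - 1)) * mellin p \<nu> (comp_op (\<lambda>w. of_real a * w + b) f)"
    by (simp add: mellin_def)
  also have "of_real a * complex_of_real a powr (\<nu> - 1) = of_real a powr \<nu>"
    using a by (simp add: powr_diff)
  finally show ?thesis using a by (simp add: powr_minus field_simps)
qed

lemma mellin_hkernel:
  assumes d: "d > Re p"
  shows "mellin p \<nu> (hkernel (cnj (of_real d - p))) = Gamma \<nu> * Gamma (1 - \<nu>) * of_real d powr (\<nu> - 1)"
proof -
  have "mellin p \<nu> (hkernel (cnj (of_real d - p))) = (\<integral>u. cutpow \<nu> u * (1 / of_real (u + d)) \<partial>lborel)"
    unfolding mellin_def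
  proof (rule Bochner_Integration.integral_cong[OF refl])
    fix u
    show "cutpow \<nu> u * hkernel (cnj (of_real d - p)) (p + of_real u) = cutpow \<nu> u * (1 / of_real (u + d))"
      using p by (cases "u > 0") (auto simp: hkernel_def kernel_def right_half_plane_def cutpow_def)
  qed
  also have "\<dots> = Gamma \<nu> * Gamma (1 - \<nu>) * of_real d powr (\<nu> - 1)"
    using p d by (intro stieltjes_power[OF \<nu>]) auto
  finally show ?thesis .
qed

end

text \<open>
  The exponents \<open>\<mu> = 1/4\<close> and \<open>\<nu> = 1/4 + 2 \<pi> \<i> / ln a\<close> give eigenfunctionals with the same
  eigenvalue. They are linearly independent because on kernels their quotient is a constant times
  \<open>cis (\<tau> ln d)\<close>, which changes sign when \<open>d\<close> is multiplied by \<open>a\<^bsup>-1/2\<^esup>\<close>.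
\<close>

theorem not_cyclic_type_I:
  assumes a: "0 < a" "a < 1" and b: "Re b > 0"
  shows "\<not> cyclic_on_hardy (comp_op (\<lambda>w. of_real a * w + b))"
proof
  let ?T = "comp_op (\<lambda>w. of_real a * w + b)"
  assume "cyclic_on_hardy ?T"
  then obtain f where f: "f \<in> hardy_space" and dense: "hardy_space \<subseteq> hclosure (orbit ?T f)"
    by (auto simp: cyclic_iff_hclosure)
  define p where "p = b / of_real (1 - a)"
  have p: "Re p > 0" using a b by (simp add: p_def del: of_real_diff)
  have pfix: "of_real a * p + b = p"
    using a by (simp add: p_def field_simps)
  define \<tau> where "\<tau> = 2 * pi / ln a"
  have lna: "ln a < 0" using a by simp
  define \<nu> where "\<nu> = Complex (1/4) \<tau>"
  define \<mu> where "\<mu> = Complex (1/4) 0"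
  have re: "Re \<nu> = 1/4" "Re \<mu> = 1/4" by (simp_all add: \<nu>_def \<mu>_def)
  have osc: "of_real d powr (\<nu> - 1) = of_real d powr (\<mu> - 1) * cis (\<tau> * ln d)" if "d > 0" for d
  proof -
    have "\<nu> - 1 = (\<mu> - 1) + \<i> * of_real \<tau>" by (simp add: \<nu>_def \<mu>_def complex_eq_iff)
    hence "of_real d powr (\<nu> - 1) = of_real d powr (\<mu> - 1) * of_real d powr (\<i> * of_real \<tau>)"
      by (simp only: powr_add)
    also have "complex_of_real d powr (\<i> * of_real \<tau>) = cis (\<tau> * ln d)"
      using that by (simp add: powr_def cis_conv_exp Ln_of_real mult_ac)
    finally show ?thesis .
  qed
  have eig: "of_real a powr (- \<nu>) = complex_of_real a powr (- \<mu>)"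
  proof -
    have "\<tau> * ln a = 2 * pi" using lna by (simp add: \<tau>_def)
    hence "of_real a powr (\<nu> - 1) = complex_of_real a powr (\<mu> - 1)" using osc[OF a(1)] by simp
    hence "of_real a powr \<nu> = complex_of_real a powr \<mu>" using a by (simp add: powr_diff)
    thus ?thesis by (simp add: powr_minus)
  qed
  obtain \<alpha> \<beta> where ab: "\<alpha> \<noteq> 0 \<or> \<beta> \<noteq> 0" "\<alpha> * mellin p \<mu> f + \<beta> * mellin p \<nu> f = 0"
  proof (cases "mellin p \<mu> f = 0")
    case True
    thus ?thesis using that[of 1 0] by simp
  next
    case False
    thus ?thesis using that[of "- mellin p \<nu> f" "mellin p \<mu> f"] by simp
  qed
  define M where "M g = \<alpha> * mellin p \<mu> g + \<beta> * mellin p \<nu> g" for g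
  have M_scale: "M (fun_scale c g) = c * M g" for c g
    by (simp add: M_def mellin_scale[OF p] re algebra_simps)
  have M_add: "M (g + h) = M g + M h" if "g \<in> hardy_space" "h \<in> hardy_space" for g h
    using that by (simp add: M_def mellin_add[OF p] re algebra_simps)
  have iter: "(?T ^^ n) f \<in> hardy_space" "M ((?T ^^ n) f) = 0" for n
  proof (induction n)
    case (Suc n)
    show "(?T ^^ Suc n) f \<in> hardy_space"
      using comp_op_hardy_space[of a b "(?T ^^ n) f"] Suc(1) a b by simp
    have "M (?T g) = of_real a powr (- \<mu>) * M g" for g
      unfolding M_def mellin_comp_op[OF p re(1) a(1) pfix] mellin_comp_op[OF p re(2) a(1) pfix] eig
      by (simp add: algebra_simps)
    thus "M ((?T ^^ Suc n) f) = 0" using Suc(2) by simp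
  qed (use f ab in \<open>auto simp: M_def\<close>)
  have X: "orbit ?T f \<subseteq> hardy_space" using iter by (auto simp: orbit_def)
  have "cfun.subspace {g \<in> hardy_space. M g = 0}"
  proof (rule cfun.subspaceI)
    have "M 0 = 0" by (simp add: M_def mellin_def)
    thus "0 \<in> {g \<in> hardy_space. M g = 0}" using cfun.subspace_0[OF subspace_hardy_space] by simp
  qed (auto simp: M_add M_scale intro: cfun.subspace_add[OF subspace_hardy_space] cfun.subspace_scale[OF subspace_hardy_space])
  hence span0: "cfun.span (orbit ?T f) \<subseteq> {g \<in> hardy_space. M g = 0}"
    using iter by (intro cfun.span_minimal) (auto simp: orbit_def)
  define C0 where "C0 = (1 + 1 / sqrt (Re p)) * (\<integral>u. powmaj u \<partial>lborel)"
  define C where "C = (cmod \<alpha> + cmod \<beta>) * C0"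
  have Mbound: "cmod (M g) \<le> C * hardy_norm g" if "g \<in> hardy_space" for g
  proof -
    have "cmod (M g) \<le> cmod \<alpha> * cmod (mellin p \<mu> g) + cmod \<beta> * cmod (mellin p \<nu> g)"
      unfolding M_def by (metis norm_triangle_ineq norm_mult)
    also have "\<dots> \<le> cmod \<alpha> * (hardy_norm g * C0) + cmod \<beta> * (hardy_norm g * C0)"
      unfolding C0_def by (intro add_mono mult_left_mono mellin_bound(2) p re that) auto
    finally show ?thesis by (simp add: C_def algebra_simps)
  qed
  have M0: "M g = 0" if g: "g \<in> hardy_space" for g
  proof (rule ccontr)
    assume nz: "M g \<noteq> 0"
    have "\<bar>C\<bar> + 1 > 0" by simp
    hence "cmod (M g) / (\<bar>C\<bar> + 1) > 0" using nz by simp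
    then obtain h where h: "h \<in> cfun.span (orbit ?T f)" "hardy_norm (g - h) < cmod (M g) / (\<bar>C\<bar> + 1)"
      using dense g unfolding hclosure_def by blast
    have hH: "h \<in> hardy_space" "M h = 0" using h(1) span0 by auto
    have ghH: "g - h \<in> hardy_space" by (rule hardy_space_diff[OF g hH(1)])
    have "M g = M ((g - h) + h)" by simp
    also have "\<dots> = M (g - h)" using M_add[OF ghH hH(1)] hH(2) by simp
    finally have "cmod (M g) \<le> C * hardy_norm (g - h)" using Mbound[OF ghH] by simp
    also have "\<dots> \<le> (\<bar>C\<bar> + 1) * hardy_norm (g - h)"
      by (intro mult_right_mono hardy_norm_nonneg) auto
    also have "\<dots> < cmod (M g)" using h(2) by (simp add: pos_less_divide_eq mult.commute)
    finally show False by simp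
  qed
  define c where "c \<nu> = Gamma \<nu> * Gamma (1 - \<nu> :: complex)" for \<nu>
  have "Gamma z \<noteq> 0" if "Re z > 0" for z :: complex
    using that by (auto simp: Gamma_eq_zero_iff elim!: nonpos_Ints_cases)
  hence c: "c \<mu> \<noteq> 0" "c \<nu> \<noteq> 0"
    using re by (simp_all add: c_def)
  have rel: "\<alpha> * c \<mu> + \<beta> * c \<nu> * cis (\<tau> * ln d) = 0" if d: "d > Re p" for d
  proof -
    have d0: "d > 0" using d p by simp
    have "hkernel (cnj (of_real d - p)) \<in> hardy_space" using d by (intro hkernel_hardy_space) simp
    from M0[OF this] have "(\<alpha> * c \<mu> + \<beta> * c \<nu> * cis (\<tau> * ln d)) * of_real d powr (\<mu> - 1) = 0"
      unfolding M_def mellin_hkernel[OF p re(1) d] mellin_hkernel[OF p re(2) d] osc[OF d0]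
      by (simp add: c_def algebra_simps)
    thus ?thesis using d p by simp
  qed
  define d where "d = Re p + 1"
  have d: "d > 0" "d > Re p" "d * a powr (- 1/2) > Re p"
  proof -
    show "d > 0" "d > Re p" using p by (auto simp: d_def)
    have "1 \<le> a powr (- 1/2)" using a lna by (simp add: powr_def)
    hence "d * 1 \<le> d * a powr (- 1/2)" using \<open>d > 0\<close> by (intro mult_left_mono) auto
    thus "d * a powr (- 1/2) > Re p" using \<open>d > Re p\<close> by simp
  qed
  have "\<tau> * ln (d * a powr (- 1/2)) = \<tau> * ln d - pi"
    using d a lna by (simp add: ln_mult ln_powr \<tau>_def field_simps)
  hence "cis (\<tau> * ln (d * a powr (- 1/2))) = - cis (\<tau> * ln d)"
    by (simp add: cis_divide[symmetric])
  hence "\<alpha> * c \<mu> + \<beta> * c \<nu> * cis (\<tau> * ln d) = 0" "\<alpha> * c \<mu> - \<beta> * c \<nu> * cis (\<tau> * ln d) = 0"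
    using rel[OF d(2)] rel[OF d(3)] by simp_all
  hence "\<alpha> * c \<mu> = 0" "\<beta> * c \<nu> * cis (\<tau> * ln d) = 0" by (auto simp: algebra_simps)
  thus False using c ab by simp
qed

section \<open>Translations on the real line and an oscillating factor\<close>

text \<open>
  Combinations of translations are normal operators, so they have the same norm on \<open>h\<close> as their
  adjoints.
\<close>

lemma normsq_conj_translates:
  fixes c :: "'i \<Rightarrow> complex"
  assumes h: "h \<in> L2"
  shows "normsq (\<lambda>t. \<Sum>j\<in>J. c j * h (t + q j)) = normsq (\<lambda>t. \<Sum>j\<in>J. cnj (c j) * h (t - q j))"
proof -
  have L: "(\<lambda>t. h (t + s)) \<in> L2" "(\<lambda>t. h (t - s)) \<in> L2" for s
    using L2_translate[OF h, of s] L2_translate[OF h, of "-s"] by simp_all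
  have "complex_of_real (normsq (\<lambda>t. \<Sum>j\<in>J. c j * h (t + q j)))
      = (\<Sum>j\<in>J. c j * (\<Sum>k\<in>J. cnj (c k) * inner2 (\<lambda>t. h (t + q j)) (\<lambda>t. h (t + q k))))"
    unfolding inner2_self[symmetric] by (simp add: inner2_sum_left inner2_sum_right L L2_sum)
  also have "\<dots> = (\<Sum>j\<in>J. \<Sum>k\<in>J. c j * cnj (c k) * inner2 (\<lambda>t. h (t + q j)) (\<lambda>t. h (t + q k)))"
    by (simp add: sum_distrib_left mult.assoc)
  also have "\<dots> = (\<Sum>k\<in>J. \<Sum>j\<in>J. c j * cnj (c k) * inner2 (\<lambda>t. h (t + q j)) (\<lambda>t. h (t + q k)))"
    by (rule sum.swap)
  also have "\<dots> = (\<Sum>k\<in>J. \<Sum>j\<in>J. cnj (c k) * c j * inner2 (\<lambda>t. h (t - q k)) (\<lambda>t. h (t - q j)))"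
  proof (intro sum.cong refl)
    fix j k
    have "inner2 (\<lambda>t. h (t + q j)) (\<lambda>t. h (t + q k)) = inner2 (\<lambda>t. h (t - q k)) (\<lambda>t. h (t - q j))"
      using inner2_translate[of "\<lambda>t. h (t - q k)" "q j + q k" "\<lambda>t. h (t - q j)"] by (simp add: algebra_simps)
    thus "c j * cnj (c k) * inner2 (\<lambda>t. h (t + q j)) (\<lambda>t. h (t + q k))
        = cnj (c k) * c j * inner2 (\<lambda>t. h (t - q k)) (\<lambda>t. h (t - q j))" by simp
  qed
  also have "\<dots> = (\<Sum>j\<in>J. cnj (c j) * (\<Sum>k\<in>J. cnj (cnj (c k)) * inner2 (\<lambda>t. h (t - q j)) (\<lambda>t. h (t - q k))))"
    by (simp add: sum_distrib_left mult.assoc)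
  also have "\<dots> = complex_of_real (normsq (\<lambda>t. \<Sum>j\<in>J. cnj (c j) * h (t - q j)))"
    unfolding inner2_self[symmetric] by (simp add: inner2_sum_left inner2_sum_right L L2_sum)
  finally show ?thesis by (simp only: of_real_eq_iff)
qed

lemma L2_cis_mult: 
  assumes "h \<in> L2" shows "(\<lambda>t. cis (\<tau> * t) * h t) \<in> L2" "normsq (\<lambda>t. cis (\<tau> * t) * h t) = normsq h"
proof -
  have "(\<lambda>t. cis (\<tau> * t)) \<in> borel_measurable borel"
    by (intro borel_measurable_continuous_onI continuous_intros)
  note [measurable] = this L2_D[OF assms]
  show "(\<lambda>t. cis (\<tau> * t) * h t) \<in> L2"
    by (rule L2_dominated[OF assms]) (measurable, simp add: norm_mult)
  show "normsq (\<lambda>t. cis (\<tau> * t) * h t) = normsq h" by (simp add: normsq_def norm_mult)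
qed

text \<open>
  Let \<open>U\<close>, \<open>A\<close> be the translations by \<open>\<beta>\<close> and \<open>s\<close>, and \<open>E\<close> the multiplication by \<open>cis (\<tau> t)\<close>, which
  commutes with \<open>U\<close> while \<open>A E = cis (\<tau> s) E A\<close>. If polynomials \<open>p(U) h\<close> approximate \<open>A h\<close>, then by
  normality the adjoints \<open>p(U)\<^sup>*\<close> approximate \<open>A\<^sup>*\<close> on every \<open>U\<^sup>k h\<close>. Comparing both approximations
  inside \<open>\<langle>E p(U) h, U\<^sup>k h\<rangle> = \<langle>E h, p(U)\<^sup>* U\<^sup>k h\<rangle>\<close> yields \<open>\<langle>E A h, U\<^sup>k h\<rangle> = cis (\<tau> s) \<langle>E A h, U\<^sup>k h\<rangle>\<close>. So
  \<open>E A h\<close> is orthogonal to all \<open>U\<^sup>k h\<close> with \<open>k \<ge> 0\<close>, and as it also lies in their closed span, it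
  vanishes.
\<close>

lemma translates_commutator:
  fixes h :: "real \<Rightarrow> complex" and N :: "'i \<Rightarrow> nat"
  assumes h: "h \<in> L2" and \<tau>\<beta>: "cis (\<tau> * \<beta>) = 1" and \<tau>s: "cis (\<tau> * s) \<noteq> 1"
    and A: "\<And>\<epsilon>. \<epsilon> > 0 \<Longrightarrow> \<exists>(J :: 'i set) c N. finite J \<and>
        normsq (\<lambda>t. h (t + s) - (\<Sum>j\<in>J. c j * h (t + real (N j) * \<beta>))) < \<epsilon>"
    and B: "\<And>\<epsilon>. \<epsilon> > 0 \<Longrightarrow> \<exists>(J :: 'i set) c N. finite J \<and>
        normsq (\<lambda>t. cis (\<tau> * t) * h (t + s) - (\<Sum>j\<in>J. c j * h (t + real (N j) * \<beta>))) < \<epsilon>"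
  shows "normsq h = 0"
proof -
  let ?e = "\<lambda>t. cis (\<tau> * t)"
  have L: "(\<lambda>t. h (t + q)) \<in> L2" "(\<lambda>t. h (t - q)) \<in> L2" for q
    using L2_translate[OF h, of q] L2_translate[OF h, of "-q"] by simp_all
  have eper: "cis (\<tau> * (t + real n * \<beta>)) = cis (\<tau> * t)" for t n
  proof -
    have "cis (\<tau> * (t + real n * \<beta>)) = cis (\<tau> * t) * cis (\<tau> * \<beta>) ^ n"
    proof -
      have "\<tau> * (t + real n * \<beta>) = \<tau> * t + real n * (\<tau> * \<beta>)" by (simp add: algebra_simps)
      hence "cis (\<tau> * (t + real n * \<beta>)) = cis (\<tau> * t) * cis (real n * (\<tau> * \<beta>))"
        by (simp only: cis_mult)
      thus ?thesis by (simp only: Complex.DeMoivre)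
    qed
    thus ?thesis by (simp add: \<tau>\<beta>)
  qed
  have eh: "(\<lambda>t. ?e t * h t) \<in> L2" "normsq (\<lambda>t. ?e t * h t) = normsq h"
    using L2_cis_mult[OF h] by auto
  define g where "g t = ?e t * h (t + s)" for t
  have g: "g \<in> L2" "normsq g = normsq h"
    using L2_cis_mult[OF L(1)[of s], of \<tau>] by (auto simp: g_def[abs_def] normsq_translate)
  have orth: "inner2 g (\<lambda>t. h (t + real k * \<beta>)) = 0" for k
  proof -
    let ?I = "inner2 g (\<lambda>t. h (t + real k * \<beta>))"
    have small: "cmod ((1 - cis (\<tau> * s)) * ?I) \<le> 2 * sqrt (\<epsilon> * normsq h)" if "\<epsilon> > 0" for \<epsilon>
    proof -
      obtain J c N where J: "finite (J :: 'i set)"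
        and n: "normsq (\<lambda>t. h (t + s) - (\<Sum>j\<in>J. c j * h (t + real (N j) * \<beta>))) < \<epsilon>"
        using A[OF \<open>\<epsilon> > 0\<close>] by blast
      define n where "n t = h (t + s) - (\<Sum>j\<in>J. c j * h (t + real (N j) * \<beta>))" for t
      define n' where "n' t = h (t - s) - (\<Sum>j\<in>J. cnj (c j) * h (t - real (N j) * \<beta>))" for t
      have nL: "n \<in> L2" "n' \<in> L2"
        unfolding n_def[abs_def] n'_def[abs_def] by (intro L2_diff L2_sum L)+
      have nn': "normsq n' = normsq n"
      proof -
        define d where "d = (\<lambda>i. case i of None \<Rightarrow> 1 | Some j \<Rightarrow> - c j)"
        define q where "q = (\<lambda>i. case i of None \<Rightarrow> s | Some j \<Rightarrow> real (N j) * \<beta>)"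
        have "n = (\<lambda>t. \<Sum>i\<in>insert None (Some ` J). d i * h (t + q i))"
          using J by (simp add: n_def fun_eq_iff d_def q_def sum.reindex sum_negf)
        moreover have "n' = (\<lambda>t. \<Sum>i\<in>insert None (Some ` J). cnj (d i) * h (t - q i))"
          using J by (simp add: n'_def fun_eq_iff d_def q_def sum.reindex sum_negf)
        ultimately show ?thesis
          using normsq_conj_translates[OF h, where J = "insert None (Some ` J)" and c = d and q = q] by (simp only:)
      qed
      define P where "P = inner2 (\<lambda>t. ?e t * h t) (\<lambda>t. \<Sum>j\<in>J. cnj (c j) * h (t + (real k * \<beta> - real (N j) * \<beta>)))"
      have 1: "?I - P = inner2 (\<lambda>t. ?e t * n t) (\<lambda>t. h (t + real k * \<beta>))"
      proof -
        have "inner2 (\<lambda>t. ?e t * n t) (\<lambda>t. h (t + real k * \<beta>)) =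
            inner2 (\<lambda>t. g t - (\<Sum>j\<in>J. c j * (?e t * h (t + real (N j) * \<beta>)))) (\<lambda>t. h (t + real k * \<beta>))"
          by (simp add: n_def g_def right_diff_distrib sum_distrib_left mult.left_commute)
        also have "\<dots> = ?I - inner2 (\<lambda>t. \<Sum>j\<in>J. c j * (?e t * h (t + real (N j) * \<beta>))) (\<lambda>t. h (t + real k * \<beta>))"
          by (intro inner2_diff_left g L L2_sum L2_cis_mult)
        also have "inner2 (\<lambda>t. \<Sum>j\<in>J. c j * (?e t * h (t + real (N j) * \<beta>))) (\<lambda>t. h (t + real k * \<beta>))
            = (\<Sum>j\<in>J. c j * inner2 (\<lambda>t. ?e t * h (t + real (N j) * \<beta>)) (\<lambda>t. h (t + real k * \<beta>)))"
          by (intro inner2_sum_left L L2_cis_mult)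
        also have "(\<Sum>j\<in>J. c j * inner2 (\<lambda>t. ?e t * h (t + real (N j) * \<beta>)) (\<lambda>t. h (t + real k * \<beta>)))
            = (\<Sum>j\<in>J. c j * inner2 (\<lambda>t. ?e t * h t) (\<lambda>t. h (t + (real k * \<beta> - real (N j) * \<beta>))))"
        proof (intro sum.cong refl arg_cong2[of _ _ _ _ "(*)"])
          fix j
          show "inner2 (\<lambda>t. ?e t * h (t + real (N j) * \<beta>)) (\<lambda>t. h (t + real k * \<beta>))
             = inner2 (\<lambda>t. ?e t * h t) (\<lambda>t. h (t + (real k * \<beta> - real (N j) * \<beta>)))"
            using inner2_translate[of "\<lambda>t. ?e t * h t" "real (N j) * \<beta>" "\<lambda>t. h (t + (real k * \<beta> - real (N j) * \<beta>))"]
            by (simp only: eper) (simp add: add.assoc)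
        qed
        also have "\<dots> = P"
          unfolding P_def by (subst inner2_sum_right) (auto intro: L eh)
        finally show ?thesis ..
      qed
      have 2: "cis (\<tau> * s) * ?I - P = inner2 (\<lambda>t. ?e t * h t) (\<lambda>t. n' (t + real k * \<beta>))"
      proof -
        have "inner2 (\<lambda>t. ?e t * h t) (\<lambda>t. n' (t + real k * \<beta>))
          = inner2 (\<lambda>t. ?e t * h t) (\<lambda>t. h (t + (real k * \<beta> - s)) - (\<Sum>j\<in>J. cnj (c j) * h (t + (real k * \<beta> - real (N j) * \<beta>))))"
          by (simp add: n'_def algebra_simps)
        also have "\<dots> = inner2 (\<lambda>t. ?e t * h t) (\<lambda>t. h (t + (real k * \<beta> - s))) - P"
          unfolding P_def by (subst inner2_diff_right) (auto intro!: eh L L2_sum)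
        also have "inner2 (\<lambda>t. ?e t * h t) (\<lambda>t. h (t + (real k * \<beta> - s)))
            = inner2 (\<lambda>t. cis (\<tau> * s) * g t) (\<lambda>t. h (t + real k * \<beta>))"
          using inner2_translate[of "\<lambda>t. ?e t * h t" s "\<lambda>t. h (t + (real k * \<beta> - s))"]
          by (simp add: g_def distrib_left cis_mult[symmetric] mult_ac)
        finally show ?thesis by (simp add: inner2_scale_left)
      qed
      have b1: "cmod (?I - P) \<le> sqrt (\<epsilon> * normsq h)"
      proof (rule real_le_rsqrt)
        have "(cmod (?I - P))\<^sup>2 \<le> normsq n * normsq h"
          unfolding 1 using inner2_Cauchy_Schwarz[OF L2_cis_mult(1)[OF nL(1)] L(1)] L2_cis_mult(2)[OF nL(1)]
          by (simp add: normsq_translate)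
        also have "\<dots> \<le> \<epsilon> * normsq h"
          using n by (intro mult_right_mono normsq_nonneg) (simp add: n_def[abs_def])
        finally show "(cmod (?I - P))\<^sup>2 \<le> \<epsilon> * normsq h" .
      qed
      have b2: "cmod (cis (\<tau> * s) * ?I - P) \<le> sqrt (\<epsilon> * normsq h)"
      proof (rule real_le_rsqrt)
        have "(cmod (cis (\<tau> * s) * ?I - P))\<^sup>2 \<le> normsq h * normsq n"
          unfolding 2 using inner2_Cauchy_Schwarz[OF eh(1) L2_translate[OF nL(2)]] eh(2)
          by (simp add: normsq_translate nn')
        also have "\<dots> \<le> normsq h * \<epsilon>"
          using n by (intro mult_left_mono normsq_nonneg) (simp add: n_def[abs_def])
        finally show "(cmod (cis (\<tau> * s) * ?I - P))\<^sup>2 \<le> \<epsilon> * normsq h" by (simp add: mult.commute)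
      qed
      have "(1 - cis (\<tau> * s)) * ?I = (?I - P) - (cis (\<tau> * s) * ?I - P)" by (simp add: algebra_simps)
      thus ?thesis using norm_triangle_ineq4[of "?I - P" "cis (\<tau> * s) * ?I - P"] b1 b2 by simp
    qed
    have "((\<lambda>\<epsilon>. 2 * sqrt (\<epsilon> * normsq h)) \<longlongrightarrow> 2 * sqrt (0 * normsq h)) (at_right 0)"
      by (intro tendsto_intros)
    hence "cmod ((1 - cis (\<tau> * s)) * ?I) \<le> 2 * sqrt (0 * normsq h)"
      by (rule tendsto_lowerbound[OF _ eventually_mono[OF eventually_at_right_less small]]) auto
    thus ?thesis using \<tau>s by simp
  qed
  have "normsq g < \<epsilon>" if \<epsilon>: "\<epsilon> > 0" for \<epsilon>
  proof -
    obtain J c N where J: "finite (J :: 'i set)"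
      and n: "normsq (\<lambda>t. g t - (\<Sum>j\<in>J. c j * h (t + real (N j) * \<beta>))) < \<epsilon>"
      using B[OF \<epsilon>] unfolding g_def by blast
    define v where "v = (\<lambda>t. \<Sum>j\<in>J. c j * h (t + real (N j) * \<beta>))"
    have v: "v \<in> L2" unfolding v_def by (intro L2_sum L)
    have "inner2 g v = 0"
      unfolding v_def by (subst inner2_sum_right) (auto intro: L g simp: orth)
    hence "normsq (\<lambda>t. g t - v t) = normsq g + normsq v" using normsq_diff[OF g(1) v] by simp
    thus ?thesis using n normsq_nonneg[of v] by (simp add: v_def)
  qed
  from this[of "normsq g"] have "normsq g = 0" using normsq_nonneg[of g] by (cases "normsq g > 0") auto
  thus ?thesis using g by simp
qed

text \<open>
  The map \<open>\<rho>\<close> restricts a function to the curve \<open>\<gamma>\<close> with weight \<open>m\<close> and turns \<open>T\<close> into a translation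
  up to the scalar \<open>\<kappa>\<close>. The commutation argument takes place in \<open>L\<^sup>2(\<real>)\<close>, but the functions
  \<open>A h\<close> and \<open>E A h\<close> must come from \<open>H\<^sup>2\<close> to be approximable; this is what the conditions on \<open>k\<close> and
  \<open>k'\<close> express.
\<close>

theorem not_cyclic_if_translation:
  fixes m :: "real \<Rightarrow> complex" and \<gamma> :: "real \<Rightarrow> complex"
  defines "\<rho> \<equiv> \<lambda>f t. m t * f (\<gamma> t)"
  assumes T: "\<And>f. f \<in> hardy_space \<Longrightarrow> T f \<in> hardy_space"
    and L: "\<And>f. f \<in> hardy_space \<Longrightarrow> \<rho> f \<in> L2"
    and C: "\<And>f. f \<in> hardy_space \<Longrightarrow> normsq (\<rho> f) \<le> C * (hardy_norm f)\<^sup>2"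
    and trans: "\<And>f t. f \<in> hardy_space \<Longrightarrow> \<rho> (T f) t = \<kappa> * \<rho> f (t + \<beta>)"
    and U: "\<And>f. f \<in> hardy_space \<Longrightarrow> \<exists>g\<in>hardy_space. \<forall>t. \<rho> g t = k * \<rho> f (t + s)" "k \<noteq> 0"
    and V: "\<And>f. f \<in> hardy_space \<Longrightarrow> \<exists>g\<in>hardy_space. \<forall>t. \<rho> g t = k' * (cis (\<tau> * t) * \<rho> f (t + s))" "k' \<noteq> 0"
    and \<tau>: "cis (\<tau> * \<beta>) = 1" "cis (\<tau> * s) \<noteq> 1"
    and nontriv: "\<exists>f\<in>hardy_space. normsq (\<rho> f) \<noteq> 0"
  shows "\<not> cyclic_on_hardy T"
proof
  assume "cyclic_on_hardy T"
  then obtain f where f: "f \<in> hardy_space" and dense: "hardy_space \<subseteq> hclosure (orbit T f)"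
    by (auto simp: cyclic_iff_hclosure)
  define h where "h = \<rho> f"
  have hL: "h \<in> L2" unfolding h_def by (rule L[OF f])
  have iterH: "(T ^^ n) f \<in> hardy_space" for n
    by (induction n) (use f T in auto)
  have iter: "\<rho> ((T ^^ n) f) t = \<kappa> ^ n * h (t + real n * \<beta>)" for n t
  proof (induction n arbitrary: t)
    case (Suc n)
    show ?case
      using trans[OF iterH, of n t] Suc.IH[of "t + \<beta>"] by (simp add: algebra_simps)
  qed (simp add: h_def)
  have X: "orbit T f \<subseteq> hardy_space" using iterH by (auto simp: orbit_def)
  have approx: "\<exists>(J :: (complex \<Rightarrow> complex) set) c N. finite J \<and>
        normsq (\<lambda>t. G t - (\<Sum>j\<in>J. c j * h (t + real (N j) * \<beta>))) < \<epsilon>"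
    if g: "g \<in> hardy_space" and eq: "\<And>t. \<rho> g t = z * G t" and z: "z \<noteq> 0" and \<epsilon>: "\<epsilon> > 0" for g G z \<epsilon>
  proof -
    define \<delta> where "\<delta> = sqrt (\<epsilon> * (cmod z)\<^sup>2 / (\<bar>C\<bar> + 1))"
    have \<delta>: "\<delta> > 0" using \<epsilon> z by (simp add: \<delta>_def)
    obtain u where u: "u \<in> cfun.span (orbit T f)" "hardy_norm (g - u) < \<delta>"
      using dense g \<delta> unfolding hclosure_def by blast
    obtain J r where J: "finite J" "J \<subseteq> orbit T f" "u = (\<Sum>a\<in>J. fun_scale (r a) a)"
      using u(1) unfolding cfun.span_explicit by blast
    have "\<forall>a\<in>J. \<exists>n. a = (T ^^ n) f" using J(2) by (auto simp: orbit_def)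
    then obtain N where N: "\<And>a. a \<in> J \<Longrightarrow> a = (T ^^ N a) f" by metis
    have uH: "u \<in> hardy_space" using u(1) span_hardy[OF X] by blast
    have \<rho>u: "\<rho> u t = (\<Sum>a\<in>J. r a * \<kappa> ^ N a * h (t + real (N a) * \<beta>))" for t
    proof -
      have "\<rho> u t = (\<Sum>a\<in>J. r a * \<rho> a t)"
        unfolding J(3) \<rho>_def by (simp add: sum_fun_apply fun_scale_def sum_distrib_left mult_ac)
      also have "\<dots> = (\<Sum>a\<in>J. r a * \<kappa> ^ N a * h (t + real (N a) * \<beta>))"
      proof (intro sum.cong refl)
        fix a assume "a \<in> J"
        hence "\<rho> a t = \<kappa> ^ N a * h (t + real (N a) * \<beta>)" using N iter by metis
        thus "r a * \<rho> a t = r a * \<kappa> ^ N a * h (t + real (N a) * \<beta>)" by simp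
      qed
      finally show ?thesis .
    qed
    have gu: "\<rho> (g - u) t = z * (G t - (\<Sum>a\<in>J. (r a * \<kappa> ^ N a / z) * h (t + real (N a) * \<beta>)))" for t
    proof -
      have "\<rho> (g - u) t = \<rho> g t - \<rho> u t" by (simp add: \<rho>_def algebra_simps)
      also have "\<rho> u t = z * (\<Sum>a\<in>J. (r a * \<kappa> ^ N a / z) * h (t + real (N a) * \<beta>))"
        unfolding \<rho>u sum_distrib_left using z by (intro sum.cong refl) simp
      finally show ?thesis by (simp only: eq right_diff_distrib)
    qed
    let ?n = "normsq (\<lambda>t. G t - (\<Sum>a\<in>J. (r a * \<kappa> ^ N a / z) * h (t + real (N a) * \<beta>)))"
    have "(cmod z)\<^sup>2 * ?n = normsq (\<rho> (g - u))"
      unfolding normsq_def gu by (simp add: norm_mult power_mult_distrib)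
    also have "\<dots> \<le> C * (hardy_norm (g - u))\<^sup>2"
      by (rule C[OF hardy_space_diff[OF g uH]])
    also have "\<dots> \<le> (\<bar>C\<bar> + 1) * (hardy_norm (g - u))\<^sup>2"
      by (intro mult_right_mono) auto
    also have "\<dots> < (\<bar>C\<bar> + 1) * \<delta>\<^sup>2"
      using u(2) hardy_norm_nonneg[of "g - u"] by (intro mult_strict_left_mono power_strict_mono) auto
    also have "\<dots> = (cmod z)\<^sup>2 * \<epsilon>" using \<epsilon> z by (simp add: \<delta>_def)
    finally have "?n < \<epsilon>" using z by simp
    thus ?thesis using J(1) by (intro exI[of _ J] exI[of _ "\<lambda>a. r a * \<kappa> ^ N a / z"] exI[of _ N]) simp
  qed
  obtain g1 where g1: "g1 \<in> hardy_space" "\<And>t. \<rho> g1 t = k * h (t + s)" using U(1)[OF f] by (auto simp: h_def)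
  obtain g2 where g2: "g2 \<in> hardy_space" "\<And>t. \<rho> g2 t = k' * (cis (\<tau> * t) * h (t + s))"
    using V(1)[OF f] by (auto simp: h_def)
  have h0: "normsq h = 0"
    by (rule translates_commutator[OF hL \<tau> approx[OF g1 U(2)] approx[OF g2 V(2)]])
  obtain q where q: "q \<in> hardy_space" "normsq (\<rho> q) \<noteq> 0" using nontriv by blast
  hence pos: "normsq (\<rho> q) > 0" using normsq_nonneg[of "\<rho> q"] by simp
  have "\<rho> q t = 1 * \<rho> q t" for t by simp
  from approx[OF q(1) this one_neq_zero pos] obtain J c N where J: "finite (J :: (complex \<Rightarrow> complex) set)"
      "normsq (\<lambda>t. \<rho> q t - (\<Sum>j\<in>J. c j * h (t + real (N j) * \<beta>))) < normsq (\<rho> q)"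
    by blast
  define v where "v = (\<lambda>t. \<Sum>j\<in>J. c j * h (t + real (N j) * \<beta>))"
  have v: "v \<in> L2" unfolding v_def by (intro L2_sum L2_translate hL)
  have "inner2 (\<rho> q) (\<lambda>t. h (t + real (N j) * \<beta>)) = 0" for j
    using inner2_Cauchy_Schwarz[OF L[OF q(1)] L2_translate[OF hL], of "real (N j) * \<beta>"] h0 by (simp add: normsq_translate)
  hence "inner2 (\<rho> q) v = 0"
    unfolding v_def by (subst inner2_sum_right) (auto intro: L2_translate hL L q)
  hence "normsq (\<lambda>t. \<rho> q t - v t) = normsq (\<rho> q) + normsq v" using normsq_diff[OF L[OF q(1)] v] by simp
  thus False using J(2) normsq_nonneg[of v] by (simp add: v_def)
qed

section \<open>The automorphisms\<close>

lemma hardy_mult_bounded: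
  assumes f: "f \<in> hardy_space" and \<psi>: "\<psi> holomorphic_on right_half_plane"
    and K: "\<And>w. w \<in> right_half_plane \<Longrightarrow> cmod (\<psi> w) \<le> K"
  shows "(\<lambda>w. \<psi> w * f w) \<in> hardy_space"
proof -
  have K0: "K \<ge> 0" using K[of 1] by (auto simp: right_half_plane_def intro: order_trans[OF norm_ge_zero])
  have hol: "(\<lambda>w. \<psi> w * f w) holomorphic_on right_half_plane"
    by (intro holomorphic_intros \<psi> hardy_space_D f)
  have KL: "(\<lambda>y. of_real K * line f x y) \<in> L2" if "x > 0" for x
    by (intro L2_scale hardy_line f that)
  have le: "cmod (line (\<lambda>w. \<psi> w * f w) x y) \<le> cmod (of_real K * line f x y)" if "x > 0" for x y
    using K[of "Complex x y"] that K0 by (simp add: line_def norm_mult right_half_plane_def mult_right_mono)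
  have L: "line (\<lambda>w. \<psi> w * f w) x \<in> L2" if "x > 0" for x
    by (rule L2_dominated[OF KL[OF that] _ le[OF that]])
      (intro borel_measurable_continuous_onI continuous_on_line holomorphic_on_imp_continuous_on hol that)
  show ?thesis
  proof (rule hardy_spaceI(1)[OF hol])
    fix x :: real assume x: "x > 0"
    have "normsq (line (\<lambda>w. \<psi> w * f w) x) \<le> normsq (\<lambda>y. of_real K * line f x y)"
      by (rule normsq_mono[OF KL[OF x] L[OF x] le[OF x]])
    also have "\<dots> = K\<^sup>2 * normsq (line f x)" by (simp add: normsq_def norm_mult power_mult_distrib)
    also have "\<dots> \<le> K\<^sup>2 * (hardy_norm f)\<^sup>2" by (intro mult_left_mono hardy_line f x) auto
    finally show "normsq (line (\<lambda>w. \<psi> w * f w) x) \<le> (K * hardy_norm f)\<^sup>2" by (simp add: power_mult_distrib)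
  qed (use L hardy_space_D(2)[OF f] K0 hardy_norm_nonneg in auto)
qed

lemma one_in_right_half_plane: "Complex 1 y \<in> right_half_plane"
  by (simp add: right_half_plane_def)

text \<open>
  On \<open>Re z = 1\<close> the oscillating factor comes from the bounded multiplier \<open>exp (- p w)\<close>, which is
  invariant under \<open>\<phi>\<close> for the chosen \<open>p\<close>. For the identity map \<open>b = 0\<close> every \<open>p\<close> is admissible.
\<close>

theorem not_cyclic_parabolic_automorphism:
  assumes b: "Re b = 0"
  shows "\<not> cyclic_on_hardy (comp_op (\<lambda>w. of_real 1 * w + b))"
proof -
  define \<eta> where "\<eta> = Im b"
  define p where "p = (if \<eta> = 0 then 1 else 2 * pi / \<bar>\<eta>\<bar>)"
  have p: "p > 0" by (simp add: p_def)
  have beq: "b = Complex 0 \<eta>" using b by (simp add: \<eta>_def complex_eq_iff)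
  have line1: "(\<lambda>t. 1 * f (Complex 1 t)) = line f 1" for f by (simp add: line_def)
  have shift: "comp_op (\<lambda>w. of_real 1 * w + Complex 0 s) f (Complex 1 t) = f (Complex 1 (t + s))" for f s t
  proof -
    have "Complex 1 t + Complex 0 s = Complex 1 (t + s)" by (simp add: complex_eq_iff)
    thus ?thesis by (simp add: comp_op_def one_in_right_half_plane)
  qed
  have comp: "comp_op (\<lambda>w. of_real 1 * w + Complex 0 s) f \<in> hardy_space" if "f \<in> hardy_space" for f s
    using that by (intro comp_op_hardy_space) auto
  show ?thesis
  proof (rule not_cyclic_if_translation[where m = "\<lambda>_. 1" and \<gamma> = "\<lambda>t. Complex 1 t" and C = 1 and \<kappa> = 1 and k = 1
        and \<beta> = \<eta> and s = "pi / p" and \<tau> = "- p" and k' = "of_real (exp (- p))"])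
    fix f assume f: "f \<in> hardy_space"
    show "comp_op (\<lambda>w. of_real 1 * w + b) f \<in> hardy_space" unfolding beq by (rule comp[OF f])
    show "(\<lambda>t. 1 * f (Complex 1 t)) \<in> L2" "normsq (\<lambda>t. 1 * f (Complex 1 t)) \<le> 1 * (hardy_norm f)\<^sup>2"
      unfolding line1 using hardy_line[OF f, of 1] by simp_all
    show "1 * comp_op (\<lambda>w. of_real 1 * w + b) f (Complex 1 t) = 1 * (1 * f (Complex 1 (t + \<eta>)))" for t
      unfolding beq shift by simp
    show "\<exists>g\<in>hardy_space. \<forall>t. 1 * g (Complex 1 t) = 1 * (1 * f (Complex 1 (t + pi / p)))"
      by (rule bexI[OF _ comp[OF f, of "pi / p"]]) (simp only: shift mult_1 simp_thms)
    have gH: "(\<lambda>w. exp (- of_real p * w) * comp_op (\<lambda>w. of_real 1 * w + Complex 0 (pi / p)) f w) \<in> hardy_space"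
      using p by (intro hardy_mult_bounded[where K = 1] comp f) (auto intro!: holomorphic_intros simp: right_half_plane_def)
    have "exp (- of_real p * Complex 1 t) = of_real (exp (- p)) * cis (- p * t)" for t
      by (simp add: exp_eq_polar)
    thus "\<exists>g\<in>hardy_space. \<forall>t. 1 * g (Complex 1 t) =
        of_real (exp (- p)) * (cis (- p * t) * (1 * f (Complex 1 (t + pi / p))))"
      by (intro bexI[OF _ gH]) (simp only: shift mult_1 mult.assoc simp_thms)
  next
    have "- p * \<eta> = 0 * (2 * pi) \<and> \<eta> = 0 \<or> - p * \<eta> = 2 * pi \<or> - p * \<eta> = - (2 * pi)"
      by (auto simp: p_def abs_if)
    moreover have "cis (- (2 * pi)) = 1" by (simp add: complex_eq_iff)
    ultimately show "cis (- p * \<eta>) = 1" by (elim disjE conjE) (simp_all only: cis_2pi, simp)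
    show "cis (- p * (pi / p)) \<noteq> 1" using p by (simp add: complex_eq_iff)
    have "normsq (line (hkernel 1) 1) = pi / 2"
    proof -
      have "line (hkernel 1) 1 = line (kernel 1) 1"
        by (simp add: line_def hkernel_def one_in_right_half_plane)
      thus ?thesis using line_kernel_L2(2)[of 1 1] by simp
    qed
    thus "\<exists>f\<in>hardy_space. normsq (\<lambda>t. 1 * f (Complex 1 t)) \<noteq> 0"
      unfolding line1 by (intro bexI[of _ "hkernel 1"] hkernel_hardy_space) auto
  qed auto
qed

lemma hardy_shift_imag:
  fixes \<eta> :: real
  assumes f: "f \<in> hardy_space"
  defines "F \<equiv> comp_op (\<lambda>w. of_real 1 * w + Complex 0 \<eta>) f"
  shows "F \<in> hardy_space" "hardy_norm F \<le> hardy_norm f" "\<And>x y. x > 0 \<Longrightarrow> F (Complex x y) = f (Complex x (y + \<eta>))"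
proof -
  show FH: "F \<in> hardy_space" unfolding F_def using f by (intro comp_op_hardy_space) auto
  show val: "F (Complex x y) = f (Complex x (y + \<eta>))" if "x > 0" for x y
  proof -
    have "Complex x y + Complex 0 \<eta> = Complex x (y + \<eta>)" by (simp add: complex_eq_iff)
    thus ?thesis using that by (simp add: F_def comp_op_def right_half_plane_def)
  qed
  show "hardy_norm F \<le> hardy_norm f"
  proof (rule hardy_spaceI(2))
    fix x :: real assume x: "x > 0"
    show "line F x \<in> L2" by (rule hardy_line[OF FH x])
    have "line F x = (\<lambda>y. line f x (y + \<eta>))" using x by (simp add: line_def val)
    thus "normsq (line F x) \<le> (hardy_norm f)\<^sup>2" using hardy_line(2)[OF f x] by (simp add: normsq_translate)
  qed (use hardy_space_D[OF FH] hardy_norm_nonneg in auto)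
qed

text \<open>
  A form of the Fejer-Riesz inequality. The function \<open>G(z) = f(z) cnj (f(cnj z))\<close> is holomorphic and
  equals \<open>\<bar>f\<bar>\<^sup>2\<close> on the real axis. By Cauchy's theorem its integral over a segment of the axis is
  carried by two vertical sides, where it is at most twice the squared norm of \<open>f\<close>, and a
  horizontal edge that can be made negligible.
\<close>

lemma fejer_riesz_real_axis:
  assumes f: "f \<in> hardy_space" and x: "0 < x" "x < X"
  shows "integral {x..X} (\<lambda>s. (cmod (f (Complex s 0)))\<^sup>2) \<le> 4 * (hardy_norm f)\<^sup>2"
proof -
  note cf = hardy_space_D(3)[OF f]
  define G where "G z = f z * cnj (f (cnj z))" for z
  have Ghol: "G holomorphic_on right_half_plane"
  proof -
    have "cnj ` right_half_plane = right_half_plane"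
      by (force simp: right_half_plane_def image_iff intro: exI[of _ "cnj _"])
    hence "(cnj \<circ> f \<circ> cnj) holomorphic_on right_half_plane"
      using holomorphic_on_compose_cnj_cnj[of f right_half_plane] hardy_space_D(1)[OF f] open_right_half_plane by simp
    hence "(\<lambda>z. f z * (cnj \<circ> f \<circ> cnj) z) holomorphic_on right_half_plane"
      by (intro holomorphic_intros hardy_space_D(1)[OF f])
    thus ?thesis by (simp add: G_def[abs_def] o_def)
  qed
  have Gcont: "continuous_on right_half_plane G" by (rule holomorphic_on_imp_continuous_on[OF Ghol])
  have Gline: "(\<integral>\<^sup>+ y. ennreal (cmod (G (Complex s y))) \<partial>lborel) \<le> ennreal (2 * (hardy_norm f)\<^sup>2)" if s: "s > 0" for s
  proof -
    let ?h = "line f s"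
    note [measurable] = L2_D[OF hardy_line(1)[OF f s]]
    have "cmod (G (Complex s y)) = cmod (?h y * cnj (cnj (?h (- y))))" for y
    proof -
      have "cnj (Complex s y) = Complex s (- y)" by (simp add: complex_eq_iff)
      thus ?thesis by (simp add: G_def line_def norm_mult)
    qed
    hence "cmod (G (Complex s y)) \<le> (cmod (?h y))\<^sup>2 + (cmod (?h (- y)))\<^sup>2" for y
      using sum_squares_bound[of "cmod (?h y)" "cmod (?h (-y))"]
        mult_nonneg_nonneg[OF norm_ge_zero[of "?h y"] norm_ge_zero[of "?h (-y)"]]
      by (simp only: norm_mult complex_mod_cnj mult.assoc)
    hence "(\<integral>\<^sup>+ y. ennreal (cmod (G (Complex s y))) \<partial>lborel)
        \<le> (\<integral>\<^sup>+ y. ennreal ((cmod (?h y))\<^sup>2) + ennreal ((cmod (?h (- y)))\<^sup>2) \<partial>lborel)"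
      by (intro nn_integral_mono) (simp add: ennreal_plus[symmetric] ennreal_leI del: ennreal_plus)
    also have "\<dots> = (\<integral>\<^sup>+ y. ennreal ((cmod (?h y))\<^sup>2) \<partial>lborel) + (\<integral>\<^sup>+ y. ennreal ((cmod (?h (- y)))\<^sup>2) \<partial>lborel)"
      by (simp add: nn_integral_add)
    also have "(\<integral>\<^sup>+ y. ennreal ((cmod (?h (- y)))\<^sup>2) \<partial>lborel) = (\<integral>\<^sup>+ y. ennreal ((cmod (?h y))\<^sup>2) \<partial>lborel)"
      using nn_integral_real_affine[of "\<lambda>y. ennreal ((cmod (?h y))\<^sup>2)" "-1" 0] by simp
    also have "(\<integral>\<^sup>+ y. ennreal ((cmod (?h y))\<^sup>2) \<partial>lborel) = ennreal (normsq ?h)"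
      by (rule nn_integral_normsq[OF hardy_line(1)[OF f s]])
    also have "ennreal (normsq ?h) + ennreal (normsq ?h) = ennreal (2 * normsq ?h)"
      using normsq_nonneg[of ?h] by (simp add: ennreal_plus[symmetric] del: ennreal_plus)
    also have "\<dots> \<le> ennreal (2 * (hardy_norm f)\<^sup>2)"
      by (intro ennreal_leI mult_left_mono hardy_line(2)[OF f s]) auto
    finally show ?thesis .
  qed
  let ?I = "integral {x..X} (\<lambda>s. (cmod (f (Complex s 0)))\<^sup>2)"
  have vert: "cmod (integral {0..Y} (\<lambda>y. G (Complex s y))) \<le> 2 * (hardy_norm f)\<^sup>2" if s: "s > 0" for s Y
  proof -
    have "continuous_on {0..Y} (\<lambda>y. G (Complex s y))"
      using s by (intro continuous_on_compose2[OF Gcont] continuous_intros) (auto simp: right_half_plane_def)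
    from norm_integral_le_nn[OF this]
    have "ennreal (cmod (integral {0..Y} (\<lambda>y. G (Complex s y)))) \<le>
       (\<integral>\<^sup>+ y. indicator {0..Y} y * ennreal (cmod (G (Complex s y))) \<partial>lborel)" .
    also have "\<dots> \<le> (\<integral>\<^sup>+ y. ennreal (cmod (G (Complex s y))) \<partial>lborel)"
      by (intro nn_integral_mono) (auto simp: indicator_def)
    also have "\<dots> \<le> ennreal (2 * (hardy_norm f)\<^sup>2)" by (rule Gline[OF s])
    finally show ?thesis by simp
  qed
  have "?I \<le> 4 * (hardy_norm f)\<^sup>2 + \<delta>" if \<delta>: "\<delta> > 0" for \<delta>
  proof -
    obtain Y where Y: "Y \<ge> 1"
      "(\<integral>\<^sup>+ s. indicator {x..X} s * ennreal (cmod (G (Complex s Y))) \<partial>lborel) \<le> ennreal \<delta>"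
      using exists_small_cross_sections[OF Gcont x Gline \<delta>, of 1] x by force
    have cG: "continuous_on {x..X} (\<lambda>s. G (Complex s v))" for v
      using x by (intro continuous_on_compose2[OF Gcont] continuous_intros) (auto simp: right_half_plane_def)
    have top: "cmod (integral {x..X} (\<lambda>s. G (Complex s Y))) \<le> \<delta>"
      using order_trans[OF norm_integral_le_nn[OF cG] Y(2)] \<delta> by simp
    have sub: "path_image (rectpath (Complex x 0) (Complex X Y)) \<subseteq> right_half_plane"
    proof -
      have "path_image (rectpath (Complex x 0) (Complex X Y)) \<subseteq> cbox (Complex x 0) (Complex X Y)"
        using x Y by (intro path_image_rectpath_subset_cbox) auto
      thus ?thesis using x by (auto simp: in_cbox_complex_iff right_half_plane_def)
    qed
    have "convex right_half_plane" unfolding right_half_plane_def by (rule convex_halfspace_Re_gt)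
    hence "(G has_contour_integral 0) (rectpath (Complex x 0) (Complex X Y))"
      using Ghol sub by (intro Cauchy_theorem_convex_simple[of G right_half_plane]) auto
    hence "contour_integral (rectpath (Complex x 0) (Complex X Y)) G = 0" by (rule contour_integral_unique)
    hence eq: "integral {x..X} (\<lambda>s. G (Complex s 0)) = integral {x..X} (\<lambda>s. G (Complex s Y))
        + \<i> * integral {0..Y} (\<lambda>y. G (Complex x y)) - \<i> * integral {0..Y} (\<lambda>y. G (Complex X y))"
      using contour_integral_rectpath[OF x(2) _ continuous_on_subset[OF Gcont sub]] Y by (simp add: algebra_simps)
    have "complex_of_real ?I = integral {x..X} (\<lambda>s. G (Complex s 0))"
    proof -
      have "G (Complex s 0) = complex_of_real ((cmod (f (Complex s 0)))\<^sup>2)" for s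
      proof -
        have "cnj (Complex s 0) = Complex s 0" by (simp add: complex_eq_iff)
        thus ?thesis unfolding G_def by (simp add: complex_norm_square del: of_real_power)
      qed
      moreover have "(\<lambda>s. (cmod (f (Complex s 0)))\<^sup>2) integrable_on {x..X}"
        using x by (intro integrable_continuous_interval continuous_intros continuous_on_compose2[OF cf])
          (auto simp: right_half_plane_def)
      hence "((\<lambda>s. complex_of_real ((cmod (f (Complex s 0)))\<^sup>2)) has_integral complex_of_real ?I) {x..X}"
        using has_integral_linear[OF integrable_integral bounded_linear_of_real] by (simp only: o_def)
      ultimately show ?thesis by (simp only: integral_unique)
    qed
    hence "\<bar>?I\<bar> = cmod (integral {x..X} (\<lambda>s. G (Complex s 0)))" by (metis norm_of_real)
    also have "\<dots> \<le> cmod (integral {x..X} (\<lambda>s. G (Complex s Y)))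
        + cmod (\<i> * integral {0..Y} (\<lambda>y. G (Complex x y))) + cmod (\<i> * integral {0..Y} (\<lambda>y. G (Complex X y)))"
      unfolding eq by (rule order_trans[OF norm_triangle_ineq4 add_right_mono[OF norm_triangle_ineq]])
    also have "\<dots> \<le> \<delta> + 2 * (hardy_norm f)\<^sup>2 + 2 * (hardy_norm f)\<^sup>2"
      using top vert[of x Y] vert[of X Y] x by (simp add: norm_mult)
    finally show ?thesis by simp
  qed
  thus ?thesis by (rule field_le_epsilon)
qed

text \<open>
  The substitution \<open>u = exp t\<close> turns the integral of \<open>\<bar>f\<bar>\<^sup>2\<close> over a horizontal ray into an \<open>L\<^sup>2(\<real>)\<close>
  norm; the weight \<open>exp (t / 2)\<close> is the square root of the Jacobian.
\<close>

lemma hardy_exp_ray: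
  fixes \<eta> :: real
  assumes f: "f \<in> hardy_space"
  defines "h \<equiv> \<lambda>t. of_real (exp (t / 2)) * f (Complex (exp t) \<eta>)"
  shows "h \<in> L2" "normsq h \<le> 4 * (hardy_norm f)\<^sup>2"
proof -
  define F where "F = comp_op (\<lambda>w. of_real 1 * w + Complex 0 \<eta>) f"
  note F = hardy_shift_imag[OF f, where \<eta> = \<eta>, folded F_def]
  have hF: "h t = of_real (exp (t / 2)) * F (Complex (exp t) 0)" for t
    using F(3)[OF exp_gt_zero, of t 0] by (simp add: h_def)
  have "continuous_on UNIV (\<lambda>t. F (Complex (exp t) 0))"
    by (intro continuous_on_compose2[OF hardy_space_D(3)[OF F(1)]] continuous_intros) (auto simp: right_half_plane_def)
  hence hc: "continuous_on UNIV h" unfolding hF[abs_def] by (intro continuous_intros) auto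
  hence hm: "h \<in> borel_measurable borel" by (rule borel_measurable_continuous_onI)
  note [measurable] = hm
  have seg: "(\<integral>\<^sup>+ t. indicator {- real (Suc n)..real (Suc n)} t * ennreal ((cmod (h t))\<^sup>2) \<partial>lborel) \<le> ennreal (4 * (hardy_norm f)\<^sup>2)" for n
  proof -
    let ?a = "- real (Suc n)" and ?b = "real (Suc n)" and ?q = "\<lambda>s. (cmod (F (Complex s 0)))\<^sup>2"
    have lt: "exp ?a < exp ?b" "?a \<le> ?b" by auto
    have qc: "continuous_on {exp ?a..exp ?b} ?q"
      by (intro continuous_intros continuous_on_compose2[OF hardy_space_D(3)[OF F(1)]])
        (auto simp: right_half_plane_def intro: less_le_trans[OF exp_gt_zero])
    have "((\<lambda>t. exp t *\<^sub>R ?q (exp t)) has_integral (integral {exp ?a..exp ?b} ?q)) {?a..?b}"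
      by (rule has_integral_substitution[OF lt(2) _ _ qc]) (use lt in \<open>auto intro!: derivative_eq_intros\<close>)
    moreover have "exp t *\<^sub>R ?q (exp t) = (cmod (h t))\<^sup>2" for t
      by (simp add: hF norm_mult power_mult_distrib exp_double[symmetric])
    ultimately have "((\<lambda>t. (cmod (h t))\<^sup>2) has_integral (integral {exp ?a..exp ?b} ?q)) {?a..?b}" by simp
    from nn_integral_has_integral_lebesgue[OF _ this]
    have "(\<integral>\<^sup>+ t. ennreal (indicator {?a..?b} t * (cmod (h t))\<^sup>2) \<partial>lborel) = ennreal (integral {exp ?a..exp ?b} ?q)"
      by (simp add: nn_integral_completion mult.commute)
    moreover have "(\<integral>\<^sup>+ t. indicator {?a..?b} t * ennreal ((cmod (h t))\<^sup>2) \<partial>lborel)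
        = (\<integral>\<^sup>+ t. ennreal (indicator {?a..?b} t * (cmod (h t))\<^sup>2) \<partial>lborel)"
      by (rule nn_integral_cong) (simp add: indicator_def)
    ultimately have "(\<integral>\<^sup>+ t. indicator {?a..?b} t * ennreal ((cmod (h t))\<^sup>2) \<partial>lborel) = ennreal (integral {exp ?a..exp ?b} ?q)"
      by (simp only:)
    also have "\<dots> \<le> ennreal (4 * (hardy_norm F)\<^sup>2)"
      using lt by (intro ennreal_leI fejer_riesz_real_axis F(1)) auto
    also have "\<dots> \<le> ennreal (4 * (hardy_norm f)\<^sup>2)"
      using F(2) by (intro ennreal_leI mult_left_mono power_mono hardy_norm_nonneg) auto
    finally show ?thesis .
  qed
  have "(\<integral>\<^sup>+ t. ennreal ((cmod (h t))\<^sup>2) \<partial>lborel)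
      = (\<integral>\<^sup>+ t. (SUP n. indicator {- real (Suc n)..real (Suc n)} t * ennreal ((cmod (h t))\<^sup>2)) \<partial>lborel)"
  proof (rule nn_integral_cong)
    fix t
    obtain n :: nat where n: "\<bar>t\<bar> \<le> real n" using real_arch_simple by blast
    show "ennreal ((cmod (h t))\<^sup>2) = (SUP n. indicator {- real (Suc n)..real (Suc n)} t * ennreal ((cmod (h t))\<^sup>2))"
    proof (rule antisym)
      show "ennreal ((cmod (h t))\<^sup>2) \<le> (SUP n. indicator {- real (Suc n)..real (Suc n)} t * ennreal ((cmod (h t))\<^sup>2))"
        using n by (intro SUP_upper2[of n]) (auto simp: indicator_def)
      show "(SUP n. indicator {- real (Suc n)..real (Suc n)} t * ennreal ((cmod (h t))\<^sup>2)) \<le> ennreal ((cmod (h t))\<^sup>2)"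
        by (intro SUP_least) (auto simp: indicator_def)
    qed
  qed
  also have "\<dots> = (SUP n. \<integral>\<^sup>+ t. indicator {- real (Suc n)..real (Suc n)} t * ennreal ((cmod (h t))\<^sup>2) \<partial>lborel)"
    by (rule nn_integral_monotone_convergence_SUP) (auto simp: incseq_def le_fun_def indicator_def)
  also have "\<dots> \<le> ennreal (4 * (hardy_norm f)\<^sup>2)" by (intro SUP_least seg)
  finally have "(\<integral>\<^sup>+ t. ennreal ((cmod (h t))\<^sup>2) \<partial>lborel) \<le> ennreal (4 * (hardy_norm f)\<^sup>2)" .
  from L2I_nn[OF hm this] show "h \<in> L2" "normsq h \<le> 4 * (hardy_norm f)\<^sup>2" by auto
qed

text \<open>
  The fixed point is \<open>\<i> \<eta>\<close>. On the ray through it, dilation by \<open>a\<close> is translation by \<open>ln a\<close>, and the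
  oscillating factor comes from the multiplier \<open>(w - \<i> \<eta>)\<^bsup>\<i>\<tau>\<^esup>\<close> with \<open>\<tau> = 2 \<pi> / ln a\<close>. It is bounded
  because the argument of \<open>w - \<i> \<eta>\<close> is.
\<close>

theorem not_cyclic_hyperbolic_automorphism:
  assumes a: "a > 0" "a \<noteq> 1" and b: "Re b = 0"
  shows "\<not> cyclic_on_hardy (comp_op (\<lambda>w. of_real a * w + b))"
proof -
  define \<eta> where "\<eta> = Im b / (1 - a)"
  have beq: "b = Complex 0 ((1 - a) * \<eta>)" using a b by (simp add: \<eta>_def complex_eq_iff)
  have lna: "ln a \<noteq> 0" using a by simp
  let ?\<gamma> = "\<lambda>t. Complex (exp t) \<eta>"
  have \<gamma>: "?\<gamma> t \<in> right_half_plane" for t by (simp add: right_half_plane_def)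
  have dil: "of_real (exp (t / 2)) * comp_op (\<lambda>w. of_real r * w + Complex 0 ((1 - r) * \<eta>)) f (?\<gamma> t)
      = of_real (exp (- (ln r / 2))) * (of_real (exp ((t + ln r) / 2)) * f (?\<gamma> (t + ln r)))" if r: "r > 0" for r t f
  proof -
    have "of_real r * ?\<gamma> t + Complex 0 ((1 - r) * \<eta>) = ?\<gamma> (t + ln r)"
      using r by (simp add: complex_eq_iff exp_add algebra_simps)
    moreover have "exp (t / 2) = exp (- (ln r / 2)) * exp ((t + ln r) / 2)"
      by (simp add: exp_add[symmetric] field_simps)
    ultimately show ?thesis using \<gamma> by (simp add: comp_op_def)
  qed
  define r where "r = exp (ln a / 2)"
  have r: "r > 0" "ln r = ln a / 2" by (simp_all add: r_def)
  have comp: "comp_op (\<lambda>w. of_real r * w + Complex 0 ((1 - r) * \<eta>)) f \<in> hardy_space" if "f \<in> hardy_space" "r > 0" for f r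
    using that by (intro comp_op_hardy_space) auto
  define \<tau> where "\<tau> = 2 * pi / ln a"
  define \<psi> where "\<psi> w = exp (\<i> * of_real \<tau> * Ln (w - Complex 0 \<eta>))" for w
  have \<psi>hol: "\<psi> holomorphic_on right_half_plane"
    unfolding \<psi>_def by (intro holomorphic_intros) (auto simp: right_half_plane_def complex_nonpos_Reals_iff)
  have \<psi>bound: "cmod (\<psi> w) \<le> exp (\<bar>\<tau>\<bar> * pi)" if "w \<in> right_half_plane" for w
  proof -
    have nz: "w - Complex 0 \<eta> \<noteq> 0" using that by (auto simp: right_half_plane_def complex_eq_iff)
    have "\<bar>Im (Ln (w - Complex 0 \<eta>))\<bar> \<le> pi"
      using mpi_less_Im_Ln[OF nz] Im_Ln_le_pi[OF nz] by simp
    hence "\<bar>\<tau> * Im (Ln (w - Complex 0 \<eta>))\<bar> \<le> \<bar>\<tau>\<bar> * pi"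
      unfolding abs_mult by (intro mult_left_mono) auto
    thus ?thesis by (simp add: \<psi>_def)
  qed
  have \<psi>\<gamma>: "\<psi> (?\<gamma> t) = cis (\<tau> * t)" for t
  proof -
    have "?\<gamma> t - Complex 0 \<eta> = of_real (exp t)" by (simp add: complex_eq_iff)
    hence "Ln (?\<gamma> t - Complex 0 \<eta>) = of_real t" by (simp add: Ln_of_real)
    thus ?thesis by (simp add: \<psi>_def cis_conv_exp mult_ac)
  qed
  let ?k = "complex_of_real (exp (- (ln r / 2)))"
  show ?thesis
  proof (rule not_cyclic_if_translation[where m = "\<lambda>t. of_real (exp (t / 2))" and \<gamma> = ?\<gamma> and C = 4
        and \<kappa> = "of_real (exp (- (ln a / 2)))" and k = ?k and k' = ?k and \<beta> = "ln a" and s = "ln r" and \<tau> = \<tau>])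
    fix f assume f: "f \<in> hardy_space"
    show "comp_op (\<lambda>w. of_real a * w + b) f \<in> hardy_space"
      using a b by (intro comp_op_hardy_space f) auto
    show "(\<lambda>t. of_real (exp (t / 2)) * f (?\<gamma> t)) \<in> L2"
      "normsq (\<lambda>t. of_real (exp (t / 2)) * f (?\<gamma> t)) \<le> 4 * (hardy_norm f)\<^sup>2"
      by (rule hardy_exp_ray[OF f])+
    show "of_real (exp (t / 2)) * comp_op (\<lambda>w. of_real a * w + b) f (?\<gamma> t) =
        of_real (exp (- (ln a / 2))) * (of_real (exp ((t + ln a) / 2)) * f (?\<gamma> (t + ln a)))" for t
      unfolding beq by (rule dil[OF a(1)])
    show "\<exists>g\<in>hardy_space. \<forall>t. of_real (exp (t / 2)) * g (?\<gamma> t) =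
        ?k * (of_real (exp ((t + ln r) / 2)) * f (?\<gamma> (t + ln r)))"
      by (rule bexI[OF _ comp[OF f r(1)]]) (intro allI dil[OF r(1)])
    have gH: "(\<lambda>w. \<psi> w * comp_op (\<lambda>w. of_real r * w + Complex 0 ((1 - r) * \<eta>)) f w) \<in> hardy_space"
      by (rule hardy_mult_bounded[OF comp[OF f r(1)] \<psi>hol \<psi>bound])
    have "of_real (exp (t / 2)) * (\<psi> (?\<gamma> t) * comp_op (\<lambda>w. of_real r * w + Complex 0 ((1 - r) * \<eta>)) f (?\<gamma> t))
        = ?k * (cis (\<tau> * t) * (of_real (exp ((t + ln r) / 2)) * f (?\<gamma> (t + ln r))))" for t
      unfolding \<psi>\<gamma> using dil[OF r(1), of t f] by (simp only: mult.left_commute)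
    thus "\<exists>g\<in>hardy_space. \<forall>t. of_real (exp (t / 2)) * g (?\<gamma> t) =
        ?k * (cis (\<tau> * t) * (of_real (exp ((t + ln r) / 2)) * f (?\<gamma> (t + ln r))))"
      by (intro bexI[OF _ gH] allI)
  next
    have "\<tau> * ln a = 2 * pi" "\<tau> * ln r = pi" using lna by (simp_all add: \<tau>_def r)
    thus "cis (\<tau> * ln a) = 1" "cis (\<tau> * ln r) \<noteq> 1" by (simp_all add: complex_eq_iff)
    let ?f = "hkernel (Complex 1 \<eta>)"
    let ?h = "\<lambda>t. of_real (exp (t / 2)) * ?f (?\<gamma> t)"
    have fH: "?f \<in> hardy_space" by (intro hkernel_hardy_space) simp
    have "?\<gamma> t + cnj (Complex 1 \<eta>) = of_real (exp t + 1)" for t by (simp add: complex_eq_iff)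
    hence val: "?h t = of_real (exp (t / 2) / (exp t + 1))" for t
      using \<gamma>[of t] by (simp add: hkernel_def kernel_def)
    have cont: "continuous_on UNIV ?h"
      unfolding val by (intro continuous_intros) (auto simp: add_nonneg_eq_0_iff add_pos_pos less_imp_neq[THEN not_sym])
    have "normsq ?h \<noteq> 0"
    proof
      assume "normsq ?h = 0"
      hence "?h 0 = 0" by (rule normsq_eq_0_imp_zero[OF cont hardy_exp_ray(1)[OF fH]])
      thus False unfolding val by simp
    qed
    thus "\<exists>f\<in>hardy_space. normsq (\<lambda>t. of_real (exp (t / 2)) * f (?\<gamma> t)) \<noteq> 0" using fH by blast
  qed auto
qed

section \<open>The classification\<close>

lemma nonautomorphism_iff:
  fixes a :: real and b :: complex
  assumes \<phi>: "\<phi> = (\<lambda>w. of_real a * w + b)"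
  shows "parabolic_nonautomorphism \<phi> \<or> hyperbolic_nonautomorphism_II \<phi> \<longleftrightarrow> a \<ge> 1 \<and> Re b > 0"
proof -
  \<comment> \<open>the values at \<open>1\<close> and \<open>2\<close> determine the coefficients\<close>
  have unique: "a = c \<and> b = d" if "\<forall>w\<in>right_half_plane. \<phi> w = of_real c * w + d" for c :: real and d
  proof -
    have "1 \<in> right_half_plane" "2 \<in> right_half_plane" by (auto simp: right_half_plane_def)
    hence eqs: "of_real a * 1 + b = of_real c * 1 + d" "of_real a * 2 + b = of_real c * 2 + d"
      using that unfolding \<phi> by blast+
    hence "complex_of_real a = of_real c" by algebra
    thus ?thesis using eqs by auto
  qed
  show ?thesis
  proof
    assume "parabolic_nonautomorphism \<phi> \<or> hyperbolic_nonautomorphism_II \<phi>"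
    thus "a \<ge> 1 \<and> Re b > 0"
    proof
      assume "parabolic_nonautomorphism \<phi>"
      then obtain d where "Re d > 0" "\<forall>w\<in>right_half_plane. \<phi> w = of_real 1 * w + d"
        unfolding parabolic_nonautomorphism_def by auto
      thus ?thesis using unique[of 1 d] by auto
    next
      assume "hyperbolic_nonautomorphism_II \<phi>"
      then obtain c d where "c > 1" "Re d > 0" "\<forall>w\<in>right_half_plane. \<phi> w = of_real c * w + d"
        unfolding hyperbolic_nonautomorphism_II_def by auto
      thus ?thesis using unique[of c d] by auto
    qed
  next
    assume ab: "a \<ge> 1 \<and> Re b > 0"
    show "parabolic_nonautomorphism \<phi> \<or> hyperbolic_nonautomorphism_II \<phi>"
    proof (cases "a = 1")
      case True
      hence "parabolic_nonautomorphism \<phi>"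
        unfolding parabolic_nonautomorphism_def \<phi> using ab by (intro exI[of _ b]) simp
      thus ?thesis ..
    next
      case False
      hence "hyperbolic_nonautomorphism_II \<phi>"
        unfolding hyperbolic_nonautomorphism_II_def \<phi> using ab by (intro exI[of _ a] exI[of _ b]) simp
      thus ?thesis ..
    qed
  qed
qed

theorem theorem9:
  fixes a :: real and b :: complex and \<phi> :: "complex \<Rightarrow> complex"
  assumes "a > 0" and "Re b \<ge> 0"
    and "\<phi> = (\<lambda>w. of_real a * w + b)"
  shows "(cyclic_on_hardy (comp_op \<phi>) \<longleftrightarrow>
            parabolic_nonautomorphism \<phi> \<or> hyperbolic_nonautomorphism_II \<phi>) \<and>
         (cyclic_on_hardy (comp_op \<phi>) \<longleftrightarrow> a \<ge> 1 \<and> Re b > 0)"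
proof -
  have "cyclic_on_hardy (comp_op \<phi>) \<longleftrightarrow> a \<ge> 1 \<and> Re b > 0"
  proof (cases "Re b = 0")
    case True
    hence "\<not> cyclic_on_hardy (comp_op \<phi>)"
      unfolding assms(3)
      using not_cyclic_parabolic_automorphism[of b] not_cyclic_hyperbolic_automorphism[of a b] assms(1)
      by (cases "a = 1") simp_all
    thus ?thesis using True by simp
  next
    case False
    hence b: "Re b > 0" using assms(2) by simp
    consider "a < 1" | "a = 1" | "a > 1" by linarith
    thus ?thesis
    proof cases
      case 1
      thus ?thesis using not_cyclic_type_I[of a b] assms b by simp
    next
      case 2
      thus ?thesis using cyclic_parabolic[of b] assms(3) b by simp
    next
      case 3
      thus ?thesis using cyclic_type_II[of a b] assms(3) b by simp
    qed
  qed
  thus ?thesis using nonautomorphism_iff[OF assms(3)] by simp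
qed

end
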